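(* Let $X,Y$ be complete bounded metric spaces and let $E,F$ be nontrivial Banach spaces. Suppose that $T:\operatorname{Lip}(X,E)\to\operatorname{Lip}(Y,F)$ is a biseparating map. Then there are a Lipschitz homeomorphism $\varphi:X\to Y$ and a function $\Phi:Y\times E\to F$ such that (1) For each $y\in Y$, $\Phi(y,\cdot):E\to F$ is a bijection with inverse $\Psi(x,\cdot):F\to E$, where $\varphi(x)=y$. (2) $Tf(y)=\Phi(y,f(\varphi^{-1}(y)))$ and $T^{-1}g(x)=\Psi(x,g(\varphi(x)))$ for all $f\in\operatorname{Lip}(X,E)$, $g\in\operatorname{Lip}(Y,F)$ and $x\in X$, $y\in Y$. (3) Let $(x_n)$ be a separated sequence in $X$. For any bounded sets $B$ in $E$ and $B'$ in $F$, there is a finite set $N\subseteq\mathbb{N}$ such that $\bigcup_{n\notin N}\Phi(\varphi(x_n),B)$ and $\bigcup_{n\notin N}\Psi(x_n,B')$ are bounded. (4) Suppose that $x_0\in X$, $u_0\in E$, $v_0\in F$ and $C<\infty$. There exist $r>0$ and $D<\infty$ such that $$\|\Phi(\varphi(x_1),u_1)-\Phi(\varphi(x_2),u_2)\|,\ \|\Psi(x_1,v_1)-\Psi(x_2,v_2)\|\le D\,d(x_1,x_2)$$ whenever $x_i\in X$, $u_i\in E$, $v_i\in F$ satisfy $\|u_1-u_2\|,\|v_1-v_2\|\le C\,d(x_1,x_2)$, $\|u_i-u_0\|,\|v_i-v_0\|\le C\,d(x_i,x_0)$ and $d(x_i,x_0)\le r$, $i=1,2$. (5) Let $(x_n)$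 be a separated sequence in $X$ and $(u_n),(v_n)$ bounded sequences in $E$ and $F$ respectively. For any $C<\infty$, there exist $r>0$ and $D<\infty$ such that $$\|\Phi(\varphi(x_n'),u_n')-\Phi(\varphi(x_n),u_n)\|,\ \|\Psi(x_n',v_n')-\Psi(x_n,v_n)\|\le D\,d(x_n',x_n)$$ for all $n$, whenever $x_n'\in X$, $u_n'\in E$, $v_n'\in F$ satisfy $\|u_n'-u_n\|,\|v_n'-v_n\|\le C\,d(x_n',x_n)$ and $d(x_n',x_n)\le r$ for all $n$. Conversely, if a Lipschitz homeomorphism $\varphi:X\to Y$ and a function $\Phi:Y\times E\to F$ satisfy conditions (1), (3), (4), (5) and $T$ is defined by the formula $Tf(y)=\Phi(y,f(\varphi^{-1}(y)))$ of (2), then $T$ is a biseparating map from $\operatorname{Lip}(X,E)$ onto $\operatorname{Lip}(Y,F)$.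
   Context: $\operatorname{Lip}(X,E)$ is the space of all Lipschitz functions $X\to E$. A Lipschitz homeomorphism is a bijection $\varphi$ such that both $\varphi$ and $\varphi^{-1}$ are Lipschitz. A sequence $(x_n)$ in $X$ is separated if $\inf_{n\neq m}d(x_n,x_m)>0$. For a set $B\subseteq E$, $\Phi(y,B)=\{\Phi(y,u):u\in B\}$, and similarly for $\Psi$. For a function $f$ let $C(f)=\{x: f(x)\neq 0\}$, and write $f\perp_h g$ if $C(f-h)\cap C(g-h)=\emptyset$. A map $T$ (not assumed linear) between two function spaces is biseparating if it is a bijection and for all $f,g,h$ in its domain: $f\perp_h g\iff Tf\perp_{Th}Tg$. *)

theory Defs
  imports "HOL-Analysis.Analysis"
begin

definition Lip :: "('a::metric_space \<Rightarrow> 'b::metric_space) set" where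
  "Lip = {f. \<exists>L. L-lipschitz_on UNIV f}"

definition lipschitz_homeomorphism :: "('a::metric_space \<Rightarrow> 'b::metric_space) \<Rightarrow> bool" where
  "lipschitz_homeomorphism \<phi> \<longleftrightarrow> bij \<phi> \<and> \<phi> \<in> Lip \<and> inv \<phi> \<in> Lip"

definition cozero :: "('a \<Rightarrow> 'b::zero) \<Rightarrow> 'a set" where
  "cozero f = {x. f x \<noteq> 0}"

text \<open>\<open>perp h f g\<close> is the relation \<open>f \<bottom>\<^sub>h g\<close>.\<close>

definition perp :: "('a \<Rightarrow> 'b::group_add) \<Rightarrow> ('a \<Rightarrow> 'b) \<Rightarrow> ('a \<Rightarrow> 'b) \<Rightarrow> bool" where
  "perp h f g \<longleftrightarrow> cozero (\<lambda>x. f x - h x) \<inter> cozero (\<lambda>x. g x - h x) = {}"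

definition biseparating ::
  "('a \<Rightarrow> 'e::group_add) set \<Rightarrow> ('b \<Rightarrow> 'f::group_add) set \<Rightarrow> (('a \<Rightarrow> 'e) \<Rightarrow> ('b \<Rightarrow> 'f)) \<Rightarrow> bool" where
  "biseparating A B T \<longleftrightarrow> bij_betw T A B \<and>
     (\<forall>f\<in>A. \<forall>g\<in>A. \<forall>h\<in>A. perp h f g \<longleftrightarrow> perp (T h) (T f) (T g))"

definition separated_seq :: "(nat \<Rightarrow> 'a::metric_space) \<Rightarrow> bool" where
  "separated_seq x \<longleftrightarrow> 0 < (INF (n, m)\<in>{(n, m). n \<noteq> m}. dist (x n) (x m))"

text \<open>The functions \<open>\<Phi>\<close> on \<open>Y \<times> E\<close> and \<open>\<Psi>\<close> on \<open>X \<times> F\<close> are curried below. The first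
  predicate determines \<open>\<Psi>\<close> from \<open>\<phi>\<close> and \<open>\<Phi>\<close>.\<close>

definition fibre_bijections ::
  "('a \<Rightarrow> 'b) \<Rightarrow> ('b \<Rightarrow> 'e \<Rightarrow> 'f) \<Rightarrow> ('a \<Rightarrow> 'f \<Rightarrow> 'e) \<Rightarrow> bool" where
  "fibre_bijections \<phi> \<Phi> \<Psi> \<longleftrightarrow>
     (\<forall>y. bij (\<Phi> y)) \<and> (\<forall>x y. \<phi> x = y \<longrightarrow> \<Psi> x = inv (\<Phi> y))"

definition bounded_along_separated ::
  "('a::metric_space \<Rightarrow> 'b) \<Rightarrow> ('b \<Rightarrow> 'e::metric_space \<Rightarrow> 'f::metric_space)
    \<Rightarrow> ('a \<Rightarrow> 'f \<Rightarrow> 'e) \<Rightarrow> bool" where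
  "bounded_along_separated \<phi> \<Phi> \<Psi> \<longleftrightarrow>
     (\<forall>x B B'. separated_seq x \<longrightarrow> bounded B \<longrightarrow> bounded B' \<longrightarrow>
        (\<exists>N::nat set. finite N \<and>
           bounded (\<Union>n\<in>- N. \<Phi> (\<phi> (x n)) ` B) \<and>
           bounded (\<Union>n\<in>- N. \<Psi> (x n) ` B')))"

definition lipschitz_near_points ::
  "('a::metric_space \<Rightarrow> 'b) \<Rightarrow> ('b \<Rightarrow> 'e::real_normed_vector \<Rightarrow> 'f::real_normed_vector)
    \<Rightarrow> ('a \<Rightarrow> 'f \<Rightarrow> 'e) \<Rightarrow> bool" where
  "lipschitz_near_points \<phi> \<Phi> \<Psi> \<longleftrightarrow>
     (\<forall>x0 u0 v0. \<forall>C::real. \<exists>r>0. \<exists>D::real. \<forall>x1 x2 u1 u2 v1 v2.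
        norm (u1 - u2) \<le> C * dist x1 x2 \<and> norm (v1 - v2) \<le> C * dist x1 x2 \<and>
        norm (u1 - u0) \<le> C * dist x1 x0 \<and> norm (u2 - u0) \<le> C * dist x2 x0 \<and>
        norm (v1 - v0) \<le> C * dist x1 x0 \<and> norm (v2 - v0) \<le> C * dist x2 x0 \<and>
        dist x1 x0 \<le> r \<and> dist x2 x0 \<le> r \<longrightarrow>
          norm (\<Phi> (\<phi> x1) u1 - \<Phi> (\<phi> x2) u2) \<le> D * dist x1 x2 \<and>
          norm (\<Psi> x1 v1 - \<Psi> x2 v2) \<le> D * dist x1 x2)"

definition lipschitz_along_separated ::
  "('a::metric_space \<Rightarrow> 'b) \<Rightarrow> ('b \<Rightarrow> 'e::real_normed_vector \<Rightarrow> 'f::real_normed_vector)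
    \<Rightarrow> ('a \<Rightarrow> 'f \<Rightarrow> 'e) \<Rightarrow> bool" where
  "lipschitz_along_separated \<phi> \<Phi> \<Psi> \<longleftrightarrow>
     (\<forall>x u v. separated_seq x \<longrightarrow> bounded (range u) \<longrightarrow> bounded (range v) \<longrightarrow>
       (\<forall>C::real. \<exists>r>0. \<exists>D::real. \<forall>x' u' v'.
         (\<forall>n::nat. norm (u' n - u n) \<le> C * dist (x' n) (x n) \<and>
                   norm (v' n - v n) \<le> C * dist (x' n) (x n) \<and>
                   dist (x' n) (x n) \<le> r) \<longrightarrow>
         (\<forall>n. norm (\<Phi> (\<phi> (x' n)) (u' n) - \<Phi> (\<phi> (x n)) (u n)) \<le> D * dist (x' n) (x n) \<and>
              norm (\<Psi> (x' n) (v' n) - \<Psi> (x n) (v n)) \<le> D * dist (x' n) (x n))))"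

end

theory Submission
  imports Defs "HOL-Library.Ramsey"
begin

text \<open>
For Lipschitz \<open>f\<close>, \<open>g\<close>, \<open>h\<close> the relation \<open>perp h f g\<close> only sees where these functions agree, and a
biseparating map is shown to act fibre by fibre over a homeomorphism.

\<^emph>\<open>Locality.\<close> Adding and removing bumps shows that a nonempty open set \<open>U\<close> determines \<open>T f\<close> on a nonempty open
set: if \<open>f = g\<close> on \<open>U\<close>, then \<open>T f = T g\<close> there (\<open>interior_determined_nonempty\<close>). Two Lipschitz functions on
a bounded space can be glued along sets at positive distance, and \<open>T\<close> is onto; hence sets at positive
distance determine sets at positive distance (\<open>far_determined\<close>). By Efremovich's lemma and completeness the sets
determined by the balls around a point \<open>x\<close> shrink to a point \<open>\<phi> x\<close>, and the symmetry between \<open>T\<close> and its inverse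
makes \<open>\<phi>\<close> a bijection (\<open>corresp_exists\<close>, \<open>corresp_unique\<close>, \<open>corresp_swap\<close>). Gluing \<open>f\<close> and \<open>g\<close> on alternate
balls that shrink to \<open>x\<close> shows that \<open>T f (\<phi> x)\<close> depends on \<open>f x\<close> alone (\<open>pointwise_determined\<close>), so the fibre
maps are \<open>\<Phi> y u = T (\<lambda>_. u) y\<close>, and similarly \<open>\<Psi>\<close> for the inverse.

\<^emph>\<open>The analytic conditions.\<close> On a complete bounded space a family \<open>\<Theta>\<close> of fibre maps sends
Lipschitz functions \<open>f\<close> to Lipschitz functions
\<open>\<lambda>x. \<Theta> x (f x)\<close> exactly if it satisfies the boundedness condition and the two Lipschitz conditions of the
theorem. A failure of one of them is witnessed by sequences of points and values, and after
passing to a subsequence a single Lipschitz function interpolates the witnesses, because bumps with disjoint supports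
and a common Lipschitz constant add up (\<open>lipschitz_disjoint_sum\<close>). Conversely, if the image of a Lipschitz
function is not Lipschitz, a convergent or a separated sequence exhibits this, and the local conditions
exclude it (\<open>fibrewise_Lip\<close>).

\<^emph>\<open>The point map.\<close> That \<open>\<phi>\<close> is Lipschitz is the delicate point, as the fibre maps are not linear. If \<open>\<phi>\<close>
stretched some pairs without bound, the fibre maps of the inverse would be nearly constant on long
intervals. At a limit point Baire's theorem turns this into a failure of injectivity
(\<open>no_fast_pairs_convergent\<close>), along a separated sequence it contradicts the boundedness condition
(\<open>no_fast_pairs_separated\<close>).
\<close>

section \<open>Gluing Lipschitz functions\<close>

lemma Lip_iff:
  fixes f :: "'a::metric_space \<Rightarrow> 'e::real_normed_vector"
  shows "f \<in> Lip \<longleftrightarrow> (\<exists>L. \<forall>x y. norm (f x - f y) \<le> L * dist x y)"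
proof
  assume "f \<in> Lip"
  then show "\<exists>L. \<forall>x y. norm (f x - f y) \<le> L * dist x y"
    by (auto simp: Lip_def lipschitz_on_def dist_norm)
next
  assume "\<exists>L. \<forall>x y. norm (f x - f y) \<le> L * dist x y"
  then obtain L where L: "norm (f x - f y) \<le> L * dist x y" for x y by blast
  have "\<bar>L\<bar>-lipschitz_on UNIV f"
  proof (rule lipschitz_onI)
    fix x y :: 'a
    have "L * dist x y \<le> \<bar>L\<bar> * dist x y" by (simp add: mult_right_mono)
    then show "dist (f x) (f y) \<le> \<bar>L\<bar> * dist x y" using L[of x y] by (simp add: dist_norm)
  qed simp
  then show "f \<in> Lip" by (auto simp: Lip_def)
qed

lemma Lip_const [simp]: "(\<lambda>x. c) \<in> Lip"
  unfolding Lip_def by (auto intro!: exI[of _ 0] lipschitz_onI)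

lemma Lip_add:
  fixes f g :: "'a::metric_space \<Rightarrow> 'e::real_normed_vector"
  shows "f \<in> Lip \<Longrightarrow> g \<in> Lip \<Longrightarrow> (\<lambda>x. f x + g x) \<in> Lip"
  unfolding Lip_def by (auto intro: lipschitz_on_add)

lemma Lip_diff:
  fixes f g :: "'a::metric_space \<Rightarrow> 'e::real_normed_vector"
  shows "f \<in> Lip \<Longrightarrow> g \<in> Lip \<Longrightarrow> (\<lambda>x. f x - g x) \<in> Lip"
  unfolding Lip_def by (auto intro: lipschitz_on_diff)

lemma Lip_comp:
  assumes "f \<in> Lip" "g \<in> Lip" shows "(\<lambda>x. g (f x)) \<in> Lip"
proof -
  obtain L L' where "L-lipschitz_on UNIV f" "L'-lipschitz_on UNIV g"
    using assms by (auto simp: Lip_def)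
  then have "(L' * L)-lipschitz_on UNIV (\<lambda>x. g (f x))"
    by (intro lipschitz_on_compose2) (auto intro: lipschitz_on_subset)
  then show ?thesis by (auto simp: Lip_def)
qed

lemma Lip_continuous_on: "f \<in> Lip \<Longrightarrow> continuous_on UNIV f"
  unfolding Lip_def by (auto intro: lipschitz_on_continuous_on)

lemma bounded_range_Lip:
  assumes "bounded (UNIV :: 'a::metric_space set)" "f \<in> Lip"
  shows "bounded (range (f :: 'a \<Rightarrow> 'b::metric_space))"
proof -
  obtain L where L: "L-lipschitz_on UNIV f" using assms by (auto simp: Lip_def)
  obtain e where e: "dist x y \<le> e" for x y :: 'a
    using assms(1) unfolding bounded_two_points by blast
  show ?thesis unfolding bounded_two_points
  proof (intro exI ballI)
    fix p q assume "p \<in> range f" "q \<in> range f"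
    then obtain x y where "p = f x" "q = f y" by blast
    then have "dist p q \<le> L * dist x y" using L by (simp add: lipschitz_on_def)
    also have "\<dots> \<le> L * e" using L e by (simp add: mult_left_mono lipschitz_on_nonneg)
    finally show "dist p q \<le> L * e" .
  qed
qed

lemma open_cozero:
  fixes f :: "'a::topological_space \<Rightarrow> 'e::{t1_space,zero}"
  assumes "continuous_on UNIV f" shows "open (cozero f)"
proof -
  have "cozero f = f -` (- {0})" by (auto simp: cozero_def)
  then show ?thesis using open_vimage[OF open_Compl[OF closed_singleton] assms] by simp
qed

text \<open>
Every open set is the cozero set of a Lipschitz function, so statements about cozero sets of
Lipschitz functions are statements about arbitrary open sets.
\<close>

lemma open_eq_cozero_Lip:
  fixes U :: "'a::metric_space set" and e :: "'e::real_normed_vector"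
  assumes "open U" "e \<noteq> 0"
  obtains k :: "'a \<Rightarrow> 'e" where "k \<in> Lip" "cozero k = U"
proof (cases "U = UNIV")
  case True
  then show ?thesis using that[of "\<lambda>x. e"] assms by (simp add: cozero_def)
next
  case False
  let ?k = "\<lambda>x. infdist x (- U) *\<^sub>R e"
  have "norm (?k x - ?k y) \<le> norm e * dist x y" for x y
  proof -
    have "norm (?k x - ?k y) = \<bar>infdist x (-U) - infdist y (-U)\<bar> * norm e"
      by (metis norm_scaleR scaleR_left_diff_distrib)
    also have "\<dots> \<le> dist x y * norm e"
      by (intro mult_right_mono infdist_triangle_abs) auto
    finally show ?thesis by (simp add: mult.commute)
  qed
  then have "?k \<in> Lip" unfolding Lip_iff by blast
  moreover have "cozero ?k = U"
    using in_closed_iff_infdist_zero[of "- U"] False assms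
    by (auto simp: cozero_def)
  ultimately show ?thesis using that by blast
qed

text \<open>
A bound that holds for all pairs of points survives taking the two infima, because the two points
may be chosen independently of each other.
\<close>

lemma le_mult_infdist_sum:
  assumes A: "A \<noteq> {}" and B: "B \<noteq> {}" and "0 \<le> M" "0 \<le> M'"
    and le: "\<And>s t. s \<in> A \<Longrightarrow> t \<in> B \<Longrightarrow> c \<le> M * dist p s + M' * dist p t"
  shows "c \<le> M * infdist p A + M' * infdist p B"
proof -
  define N where "N = M + M' + 1"
  have "c \<le> M * infdist p A + M' * infdist p B + e" if "e > 0" for e
  proof -
    have eN: "e / N > 0" using that assms by (simp add: N_def)
    have "\<exists>s\<in>A. dist p s < infdist p A + e / N"
      using eN cInf_lessD[of "dist p ` A" "infdist p A + e / N"] A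
      by (auto simp: infdist_def)
    then obtain s where s: "s \<in> A" "dist p s < infdist p A + e / N" by blast
    have "\<exists>t\<in>B. dist p t < infdist p B + e / N"
      using eN cInf_lessD[of "dist p ` B" "infdist p B + e / N"] B
      by (auto simp: infdist_def)
    then obtain t where t: "t \<in> B" "dist p t < infdist p B + e / N" by blast
    have "c \<le> M * dist p s + M' * dist p t" using le s t by blast
    also have "\<dots> \<le> M * (infdist p A + e / N) + M' * (infdist p B + e / N)"
      using s t assms by (intro add_mono mult_left_mono) auto
    also have "\<dots> = M * infdist p A + M' * infdist p B + (M + M') * (e / N)"
      by (simp add: algebra_simps add_divide_distrib)
    also have "(M + M') * (e / N) \<le> N * (e / N)"
      using eN by (intro mult_right_mono) (auto simp: N_def)
    also have "N * (e / N) = e" using assms by (simp add: N_def)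
    finally show ?thesis by simp
  qed
  then show ?thesis by (rule field_le_epsilon)
qed

text \<open>
The function \<open>a / (a + b)\<close> of two distances has local Lipschitz constant \<open>1 / (a + b)\<close>: it is steep only
near points where both distances are small.
\<close>

lemma abs_quotient_diff_le:
  fixes a b a' b' d :: real
  assumes "a \<ge> 0" "b \<ge> 0" "a' \<ge> 0" "b' \<ge> 0" "\<bar>a - a'\<bar> \<le> d" "\<bar>b - b'\<bar> \<le> d"
    and "a + b > 0" "a' + b' > 0"
  shows "\<bar>a / (a + b) - a' / (a' + b')\<bar> \<le> d / (a + b)"
proof -
  have "a / (a + b) - a' / (a' + b') = (a * (a' + b') - a' * (a + b)) / ((a + b) * (a' + b'))"
    using assms by (subst diff_frac_eq) auto
  also have "a * (a' + b') - a' * (a + b) = (a - a') * b' + a' * (b' - b)"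
    by (simp add: algebra_simps)
  finally have "a / (a + b) - a' / (a' + b') = ((a - a') * b' + a' * (b' - b)) / ((a + b) * (a' + b'))" .
  then have "\<bar>a / (a + b) - a' / (a' + b')\<bar> =
      \<bar>(a - a') * b' + a' * (b' - b)\<bar> / ((a + b) * (a' + b'))"
    using assms by (simp add: abs_mult)
  also have "\<bar>(a - a') * b' + a' * (b' - b)\<bar> \<le> \<bar>a - a'\<bar> * b' + a' * \<bar>b - b'\<bar>"
    using abs_triangle_ineq[of "(a - a') * b'" "a' * (b' - b)"] assms
    by (simp add: abs_mult abs_minus_commute[of b' b])
  also have "\<dots> \<le> d * b' + a' * d"
    using assms by (intro add_mono mult_right_mono mult_left_mono) auto
  also have "\<dots> = d * (a' + b')" by (simp add: algebra_simps)
  finally show ?thesis using assms by (simp add: divide_right_mono)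
qed

text \<open>
The values are vectors, so a Lipschitz function on a subset need not extend to the whole space with
control of the constant. Two functions that are already defined everywhere can be joined, though:
move from \<open>f\<close> to \<open>g\<close> along \<open>f + \<psi> (g - f)\<close> with \<open>\<psi> = a / (a + b)\<close>, where \<open>a\<close>, \<open>b\<close> are the distances to \<open>A\<close>
and \<open>B\<close>. The hypothesis forces \<open>g - f\<close> to be at most a multiple of \<open>a + b\<close>, which compensates the slope
\<open>1 / (a + b)\<close> of \<open>\<psi>\<close>. The constant is explicit because infinitely many such functions are summed later.
\<close>

lemma lipschitz_glue:
  fixes f g :: "'a::metric_space \<Rightarrow> 'e::real_normed_vector"
  assumes f: "L-lipschitz_on UNIV f" and g: "L'-lipschitz_on UNIV g" and K: "0 \<le> K"
    and fg: "\<And>s t. s \<in> A \<Longrightarrow> t \<in> B \<Longrightarrow> norm (f s - g t) \<le> K * dist s t"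
  obtains h where "(3 * L + 2 * L' + K)-lipschitz_on UNIV h"
    "\<And>s. s \<in> A \<Longrightarrow> h s = f s" "\<And>t. t \<in> B \<Longrightarrow> h t = g t"
proof -
  have L: "0 \<le> L" "0 \<le> L'" using f g by (auto intro: lipschitz_on_nonneg)
  show ?thesis
  proof (cases "A = {} \<or> B = {}")
    case True
    then show ?thesis
    proof
      assume "A = {}"
      moreover have "(3 * L + 2 * L' + K)-lipschitz_on UNIV g"
        using g L K by (auto intro: lipschitz_on_le)
      ultimately show ?thesis using that[of g] by blast
    next
      assume "B = {}"
      moreover have "(3 * L + 2 * L' + K)-lipschitz_on UNIV f"
        using f L K by (auto intro: lipschitz_on_le)
      ultimately show ?thesis using that[of f] by blast
    qed
  next
    case False
    then have ne: "A \<noteq> {}" "B \<noteq> {}" by auto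
    define a b where "a p = infdist p A" and "b p = infdist p B" for p
    define w where "w p = g p - f p" for p
    define \<psi> where "\<psi> p = a p / (a p + b p)" for p
    define M where "M = L + L' + K"
    have M: "0 \<le> M" using L K by (simp add: M_def)
    have ab: "0 \<le> a p" "0 \<le> b p" for p by (auto simp: a_def b_def infdist_nonneg)
    have fL: "norm (f p - f q) \<le> L * dist p q" for p q
      using f by (simp add: lipschitz_on_def dist_norm)
    have gL: "norm (g p - g q) \<le> L' * dist p q" for p q
      using g by (simp add: lipschitz_on_def dist_norm)
    have w: "norm (w p) \<le> M * (a p + b p)" for p
    proof -
      have "norm (w p) \<le> M * dist p s + M * dist p t" if "s \<in> A" "t \<in> B" for s t
      proof -
        have "w p = (g p - g t) - (f s - g t) + (f s - f p)" by (simp add: w_def)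
        then have "norm (w p) \<le> norm (g p - g t) + norm (f s - g t) + norm (f s - f p)"
          by (metis (no_types, opaque_lifting) norm_triangle_ineq norm_triangle_ineq4 add_mono_thms_linordered_semiring(3) order_trans)
        also have "\<dots> \<le> L' * dist p t + K * dist s t + L * dist s p"
          using fL gL fg that by (intro add_mono) auto
        also have "\<dots> \<le> L' * dist p t + K * (dist p s + dist p t) + L * dist p s"
          using K dist_triangle3[of s t p] by (simp add: mult_left_mono dist_commute)
        also have "\<dots> = (L + K) * dist p s + (L' + K) * dist p t" by (simp add: algebra_simps)
        also have "\<dots> \<le> M * dist p s + M * dist p t"
          using L by (intro add_mono mult_right_mono) (auto simp: M_def)
        finally show ?thesis .
      qed
      from le_mult_infdist_sum[OF ne M M this] show ?thesis
        by (simp add: a_def b_def algebra_simps)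
    qed
    have wL: "norm (w p - w q) \<le> (L + L') * dist p q" for p q
    proof -
      have "w p - w q = (g p - g q) - (f p - f q)" by (simp add: w_def)
      then have "norm (w p - w q) \<le> norm (g p - g q) + norm (f p - f q)"
        by (metis norm_triangle_ineq4)
      then show ?thesis using fL[of p q] gL[of p q] by (simp add: algebra_simps)
    qed
    have \<psi>1: "\<bar>\<psi> p\<bar> \<le> 1" for p
      using ab[of p] by (auto simp: \<psi>_def divide_le_eq_1)
    have \<psi>w: "norm (\<psi> p *\<^sub>R w p - \<psi> q *\<^sub>R w q) \<le> (L + L' + M) * dist p q" for p q
    proof (cases "a p + b p = 0 \<or> a q + b q = 0")
      case True
      then have "w p = 0 \<or> w q = 0" using w[of p] w[of q] M by auto
      moreover have "norm (\<psi> x *\<^sub>R z) \<le> norm z" for x and z :: 'e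
        using \<psi>1[of x] by (simp add: mult_left_le_one_le)
      ultimately have "norm (\<psi> p *\<^sub>R w p - \<psi> q *\<^sub>R w q) \<le> norm (w p - w q)"
        by auto
      also have "\<dots> \<le> (L + L' + M) * dist p q"
        using wL[of p q] M by (smt (verit, best) mult_right_mono zero_le_dist)
      finally show ?thesis .
    next
      case False
      then have pos: "a p + b p > 0" "a q + b q > 0" using ab[of p] ab[of q] by auto
      have 1: "\<bar>\<psi> p - \<psi> q\<bar> \<le> dist p q / (a p + b p)"
        unfolding \<psi>_def using pos ab
        by (intro abs_quotient_diff_le) (auto simp: a_def b_def infdist_triangle_abs)
      have "norm (\<psi> p *\<^sub>R w p - \<psi> q *\<^sub>R w q) =
          norm ((\<psi> p - \<psi> q) *\<^sub>R w p + \<psi> q *\<^sub>R (w p - w q))"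
        by (simp add: algebra_simps)
      also have "\<dots> \<le> \<bar>\<psi> p - \<psi> q\<bar> * norm (w p) + \<bar>\<psi> q\<bar> * norm (w p - w q)"
        by (metis norm_scaleR norm_triangle_ineq)
      also have "\<dots> \<le> (dist p q / (a p + b p)) * (M * (a p + b p)) + 1 * ((L + L') * dist p q)"
        using 1 w[of p] wL[of p q] \<psi>1[of q] pos by (intro add_mono mult_mono) auto
      also have "\<dots> = (L + L' + M) * dist p q"
        using pos by (simp add: field_simps)
      finally show ?thesis .
    qed
    define h where "h p = f p + \<psi> p *\<^sub>R w p" for p
    have "(3 * L + 2 * L' + K)-lipschitz_on UNIV h"
    proof (rule lipschitz_onI)
      fix p q
      have "h p - h q = (f p - f q) + (\<psi> p *\<^sub>R w p - \<psi> q *\<^sub>R w q)" by (simp add: h_def)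
      then have "norm (h p - h q) \<le> norm (f p - f q) + norm (\<psi> p *\<^sub>R w p - \<psi> q *\<^sub>R w q)"
        by (metis norm_triangle_ineq)
      also have "\<dots> \<le> L * dist p q + (L + L' + M) * dist p q" using fL \<psi>w by (intro add_mono)
      also have "\<dots> = (3 * L + 2 * L' + K) * dist p q" by (simp add: M_def algebra_simps)
      finally show "dist (h p) (h q) \<le> (3 * L + 2 * L' + K) * dist p q" by (simp add: dist_norm)
    qed (use L K in auto)
    moreover have "h s = f s" if "s \<in> A" for s
      using that by (simp add: h_def \<psi>_def a_def)
    moreover have "h t = g t" if "t \<in> B" for t
    proof (cases "a t = 0")
      case True
      then have "w t = 0" using w[of t] that by (simp add: b_def)
      then show ?thesis by (simp add: h_def w_def)
    next
      case False
      then show ?thesis using that by (simp add: h_def w_def \<psi>_def b_def)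
    qed
    ultimately show ?thesis using that by blast
  qed
qed

lemma Lip_glue:
  fixes f g :: "'a::metric_space \<Rightarrow> 'e::real_normed_vector"
  assumes "f \<in> Lip" "g \<in> Lip"
    and "\<And>s t. s \<in> A \<Longrightarrow> t \<in> B \<Longrightarrow> norm (f s - g t) \<le> K * dist s t"
  shows "\<exists>h\<in>Lip. (\<forall>s\<in>A. h s = f s) \<and> (\<forall>t\<in>B. h t = g t)"
proof -
  obtain L L' where "L-lipschitz_on UNIV f" "L'-lipschitz_on UNIV g"
    using assms by (auto simp: Lip_def)
  moreover have "norm (f s - g t) \<le> \<bar>K\<bar> * dist s t" if "s \<in> A" "t \<in> B" for s t
    using assms(3)[OF that] by (smt (verit) mult_right_mono zero_le_dist)
  ultimately obtain h where h: "(3 * L + 2 * L' + \<bar>K\<bar>)-lipschitz_on UNIV h"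
    "\<And>s. s \<in> A \<Longrightarrow> h s = f s" "\<And>t. t \<in> B \<Longrightarrow> h t = g t"
    using lipschitz_glue[of L f L' g "\<bar>K\<bar>" A B] by auto
  then have "h \<in> Lip" by (auto simp: Lip_def)
  with h show ?thesis by blast
qed

definition far :: "'a::metric_space set \<Rightarrow> 'a set \<Rightarrow> bool" where
  "far A B \<longleftrightarrow> (\<exists>\<delta>>0. \<forall>a\<in>A. \<forall>b\<in>B. \<delta> \<le> dist a b)"

text \<open>
On a bounded space Lipschitz functions are bounded, so any two of them can be glued along sets at
positive distance.
\<close>

lemma Lip_glue_far:
  fixes f g :: "'a::metric_space \<Rightarrow> 'e::real_normed_vector"
  assumes bdd: "bounded (UNIV :: 'a set)" and fg: "f \<in> Lip" "g \<in> Lip" and AB: "far A B"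
  shows "\<exists>h\<in>Lip. (\<forall>s\<in>A. h s = f s) \<and> (\<forall>t\<in>B. h t = g t)"
proof -
  obtain \<delta> where \<delta>: "\<delta> > 0" "\<And>a b. a \<in> A \<Longrightarrow> b \<in> B \<Longrightarrow> \<delta> \<le> dist a b"
    using AB by (auto simp: far_def)
  obtain m m' where m: "\<And>x. norm (f x) \<le> m" and m': "\<And>x. norm (g x) \<le> m'"
    using bounded_range_Lip[OF bdd fg(1)] bounded_range_Lip[OF bdd fg(2)]
    unfolding bounded_iff by blast
  have "norm (f s - g t) \<le> (m + m') / \<delta> * dist s t" if "s \<in> A" "t \<in> B" for s t
  proof -
    have mm: "0 \<le> m + m'" using m[of s] m'[of s] norm_ge_zero[of "f s"] norm_ge_zero[of "g s"] by linarith
    have "norm (f s - g t) \<le> m + m'"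
      using norm_triangle_ineq4[of "f s" "g t"] m[of s] m'[of t] by linarith
    also have "\<dots> = (m + m') / \<delta> * \<delta>" using \<delta> by simp
    also have "\<dots> \<le> (m + m') / \<delta> * dist s t"
      using \<delta> that mm by (intro mult_left_mono) auto
    finally show ?thesis .
  qed
  then show ?thesis by (rule Lip_glue[OF fg])
qed

text \<open>
Prescribing two values by linear interpolation costs nothing in the Lipschitz constant. Gluing the
result to zero on \<open>S\<close> localises it; the constant depends on \<open>C\<close> and \<open>K\<close> but not on the position of the
two points, and \<open>K\<close> may be used even when one of the points lies in \<open>S\<close> and carries the value zero.
\<close>

lemma two_point_bump:
  fixes x1 x2 :: "'a::metric_space" and u1 u2 :: "'e::real_normed_vector"
  assumes u: "norm (u1 - u2) \<le> C * dist x1 x2" and C: "0 \<le> C" and K: "0 \<le> K"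
    and S: "\<And>s. s \<in> S \<Longrightarrow> norm u1 \<le> K * dist x1 s" "\<And>s. s \<in> S \<Longrightarrow> norm u2 \<le> K * dist x2 s"
  shows "\<exists>g. (3 * C + K)-lipschitz_on UNIV g \<and> g x1 = u1 \<and> g x2 = u2 \<and> (\<forall>s\<in>S. g s = 0)"
proof -
  define \<tau> where "\<tau> p = min 1 (dist p x1 / dist x1 x2)" for p
  define h where "h p = u1 + \<tau> p *\<^sub>R (u2 - u1)" for p
  have h1: "h x1 = u1" by (simp add: h_def \<tau>_def)
  have h2: "h x2 = u2"
    using u by (cases "x1 = x2") (auto simp: h_def \<tau>_def dist_commute)
  have hC: "C-lipschitz_on UNIV h"
  proof (rule lipschitz_onI)
    fix p q
    have "h p - h q = (\<tau> p - \<tau> q) *\<^sub>R (u2 - u1)" by (simp add: h_def algebra_simps)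
    then have "norm (h p - h q) = \<bar>\<tau> p - \<tau> q\<bar> * norm (u2 - u1)" by simp
    also have "\<dots> \<le> \<bar>\<tau> p - \<tau> q\<bar> * (C * dist x1 x2)"
      using u by (intro mult_left_mono) (auto simp: norm_minus_commute)
    also have "\<dots> \<le> C * dist p q"
    proof (cases "x1 = x2")
      case False
      have "\<bar>\<tau> p - \<tau> q\<bar> \<le> \<bar>dist p x1 / dist x1 x2 - dist q x1 / dist x1 x2\<bar>"
        by (auto simp: \<tau>_def)
      also have "\<dots> = \<bar>dist p x1 - dist q x1\<bar> / dist x1 x2"
        by (simp add: diff_divide_distrib[symmetric])
      also have "\<dots> \<le> dist p q / dist x1 x2"
        using dist_triangle[of p x1 q] dist_triangle[of q x1 p]
        by (intro divide_right_mono) (auto simp: dist_commute)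
      finally have "\<bar>\<tau> p - \<tau> q\<bar> * (C * dist x1 x2) \<le> dist p q / dist x1 x2 * (C * dist x1 x2)"
        using C by (intro mult_right_mono) auto
      then show ?thesis using False by (simp add: mult.commute)
    qed (use C in auto)
    finally show "dist (h p) (h q) \<le> C * dist p q" by (simp add: dist_norm)
  qed (rule C)
  have h0: "0-lipschitz_on UNIV (\<lambda>p::'a. 0::'e)" by (simp add: lipschitz_on_def)
  have hS: "norm (h s - 0) \<le> K * dist s t" if "s \<in> {x1, x2}" "t \<in> S" for s t
    using that S h1 h2 by auto
  obtain g where g: "(3 * C + 2 * 0 + K)-lipschitz_on UNIV g"
    "\<And>s. s \<in> {x1, x2} \<Longrightarrow> g s = h s" "\<And>t. t \<in> S \<Longrightarrow> g t = 0"
    using lipschitz_glue[OF hC h0 K, of "{x1, x2}" S, OF hS] by blast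
  then show ?thesis using h1 h2 by (intro exI[of _ g]) simp
qed

text \<open>
If \<open>g m\<close> lives at \<open>x\<close> and \<open>g n\<close> at \<open>y\<close>, then \<open>g m\<close> vanishes at \<open>y\<close> and \<open>g n\<close> at \<open>x\<close>, so the difference of
the sums at \<open>x\<close> and \<open>y\<close> costs at most twice the common constant. This permits
supports that accumulate at a point.
\<close>

lemma lipschitz_disjoint_sum:
  fixes g :: "nat \<Rightarrow> 'a::metric_space \<Rightarrow> 'e::real_normed_vector"
  assumes g: "\<And>n. L-lipschitz_on UNIV (g n)"
    and disj: "\<And>m n x. m \<noteq> n \<Longrightarrow> g m x = 0 \<or> g n x = 0"
  shows "\<exists>f\<in>Lip. \<forall>n x. (\<forall>m. m \<noteq> n \<longrightarrow> g m x = 0) \<longrightarrow> f x = g n x"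
proof -
  define f where "f x = (if \<exists>n. g n x \<noteq> 0 then g (SOME n. g n x \<noteq> 0) x else 0)" for x
  have f: "f x = g n x" if "g n x \<noteq> 0" for n x
  proof -
    have "g (SOME n. g n x \<noteq> 0) x \<noteq> 0" using that by (rule someI)
    then have "(SOME n. g n x \<noteq> 0) = n" using disj that by blast
    then show ?thesis using that by (auto simp: f_def)
  qed
  have f0: "f x = 0" if "\<And>n. g n x = 0" for x
    using that by (simp add: f_def)
  have gL: "norm (g n x - g n y) \<le> L * dist x y" for n x y
    using g[of n] by (simp add: lipschitz_on_def dist_norm)
  have L: "0 \<le> L" using g by (rule lipschitz_on_nonneg)
  have half: "norm (f x - g n x) \<le> L * dist x y" if n: "f y = g n y" "f y \<noteq> 0" for x y n
  proof (cases "f x = g n x")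
    case False
    then obtain m where m: "g m x \<noteq> 0" using f f0 by metis
    then have "m \<noteq> n" using False f by metis
    then have "g n x = 0" "g m y = 0" using m n disj by metis+
    then show ?thesis using gL[of m x y] f[OF m] by simp
  qed (use L in simp)
  have "norm (f x - f y) \<le> 2 * L * dist x y" for x y
  proof (cases "f y = 0")
    case True
    show ?thesis
    proof (cases "f x = 0")
      case False
      then obtain n where n: "g n x \<noteq> 0" using f0 by blast
      then have "g n y = 0" using True f by metis
      then have "norm (f x - f y) \<le> L * dist x y" using gL[of n x y] f[OF n] True by simp
      then show ?thesis using L by (smt (verit, best) mult_right_mono zero_le_dist)
    qed (use True L in simp)
  next
    case False
    then obtain n where n: "f y = g n y" using f f0 by metis
    have "norm (f x - f y) \<le> norm (f x - g n x) + norm (g n x - g n y)"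
      using norm_triangle_ineq[of "f x - g n x" "g n x - g n y"] n by simp
    then show ?thesis using half[OF n False, of x] gL[of n x y] by simp
  qed
  then have "f \<in> Lip" unfolding Lip_iff by blast
  moreover have "f x = g n x" if "\<forall>m. m \<noteq> n \<longrightarrow> g m x = 0" for n x
    using that f[of n x] f0[of x] by metis
  ultimately show ?thesis by blast
qed

section \<open>Convergent, separated and mutually distant subsequences\<close>

lemma separated_seq_iff:
  "separated_seq x \<longleftrightarrow> (\<exists>\<delta>>0. \<forall>m n. m \<noteq> n \<longrightarrow> \<delta> \<le> dist (x m) (x n))"
proof
  let ?I = "INF (n, m)\<in>{(n::nat, m). n \<noteq> m}. dist (x n) (x m)"
  assume s: "separated_seq x"
  have "?I \<le> dist (x m) (x n)" if "m \<noteq> n" for m n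
    by (rule cINF_lower2[where x = "(m, n)"]) (use that in \<open>auto intro!: bdd_belowI2[of _ 0]\<close>)
  then show "\<exists>\<delta>>0. \<forall>m n. m \<noteq> n \<longrightarrow> \<delta> \<le> dist (x m) (x n)"
    using s by (auto simp: separated_seq_def)
next
  assume "\<exists>\<delta>>0. \<forall>m n. m \<noteq> n \<longrightarrow> \<delta> \<le> dist (x m) (x n)"
  then obtain \<delta> where \<delta>: "\<delta> > 0" "\<And>m n. m \<noteq> n \<Longrightarrow> \<delta> \<le> dist (x m) (x n)" by blast
  have "(0::nat, 1::nat) \<in> {(n, m). n \<noteq> m}" by simp
  then have "\<delta> \<le> (INF (n, m)\<in>{(n::nat, m). n \<noteq> m}. dist (x n) (x m))"
    using \<delta> by (intro cINF_greatest) auto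
  then show "separated_seq x" using \<delta> by (simp add: separated_seq_def)
qed

lemma separated_seq_subseq:
  assumes "separated_seq x" "strict_mono r"
  shows "separated_seq (\<lambda>n. x (r n))"
  using assms unfolding separated_seq_iff by (metis strict_mono_eq)

text \<open>
This dichotomy replaces compactness of the space. Without a convergent subsequence the range is
not totally bounded, and a separated subsequence can be picked greedily.
\<close>

lemma convergent_or_separated_subseq:
  fixes x :: "nat \<Rightarrow> 'a::complete_space"
  obtains (convergent) r l where "strict_mono r" "(\<lambda>n. x (r n)) \<longlonglongrightarrow> l"
  | (separated) r where "strict_mono r" "separated_seq (\<lambda>n. x (r n))"
proof (cases "compact (closure (range x))")
  case True
  then have "\<exists>l r. l \<in> closure (range x) \<and> strict_mono r \<and> (x \<circ> r) \<longlonglongrightarrow> l"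
    unfolding compact_def by (metis closure_subset range_subsetD)
  then show ?thesis using convergent by (auto simp: comp_def)
next
  case False
  then obtain e where e: "e > 0"
    and cover: "\<And>k. finite k \<Longrightarrow> \<not> closure (range x) \<subseteq> (\<Union>z\<in>k. ball z e)"
    unfolding compact_eq_totally_bounded by (auto simp: complete_eq_closed)
  have step: "\<exists>n>N. \<forall>m\<le>N. e / 2 \<le> dist (x m) (x n)" for N
  proof -
    have "\<not> closure (range x) \<subseteq> (\<Union>w\<in>x ` {..N}. ball w e)" by (rule cover) simp
    then obtain z where z: "z \<in> closure (range x)" "z \<notin> (\<Union>w\<in>x ` {..N}. ball w e)"
      by blast
    then have ze: "e \<le> dist (x m) z" if "m \<le> N" for m
      using that by force
    obtain n where n: "dist (x n) z < e / 2"
      using z(1) half_gt_zero[OF e] unfolding closure_approachable by blast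
    have le: "e / 2 \<le> dist (x m) (x n)" if "m \<le> N" for m
      using ze[OF that] n dist_triangle[of "x m" z "x n"] by linarith
    have "n > N" using le[of n] e by (cases "n \<le> N") auto
    with le show ?thesis by blast
  qed
  then obtain r :: "nat \<Rightarrow> nat" where r: "\<And>k. r k < r (Suc k) \<and> (\<forall>m\<le>r k. e / 2 \<le> dist (x m) (x (r (Suc k))))"
    using dependent_nat_choice[of "\<lambda>_ _. True" "\<lambda>_ N n. n > N \<and> (\<forall>m\<le>N. e / 2 \<le> dist (x m) (x n))"]
    by blast
  then have mono: "strict_mono r" by (simp add: strict_mono_Suc_iff)
  have lt: "e / 2 \<le> dist (x (r i)) (x (r j))" if "i < j" for i j
  proof -
    obtain k where k: "j = Suc k" "i \<le> k" using \<open>i < j\<close> by (cases j) auto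
    then show ?thesis using r[of k] mono by (simp add: strict_mono_less_eq)
  qed
  have "separated_seq (\<lambda>n. x (r n))"
    unfolding separated_seq_iff
  proof (intro exI conjI allI impI)
    show "e / 2 > 0" using e by simp
    fix m n :: nat assume "m \<noteq> n"
    then show "e / 2 \<le> dist (x (r m)) (x (r n))"
      using lt[of m n] lt[of n m] by (metis dist_commute linorder_neqE_nat)
  qed
  with mono show ?thesis using separated by blast
qed

text \<open>
Efremovich's lemma. Colour a pair \<open>i < j\<close> by which of \<open>dist (y i) (z j)\<close>, \<open>dist (y j) (z i)\<close> is less than
\<open>e / 4\<close>. On a homogeneous set neither can be small, since three small distances would give
\<open>dist (y i) (z i) < e\<close> for some \<open>i\<close>.
\<close>

lemma far_subseq:
  fixes y z :: "nat \<Rightarrow> 'a::metric_space"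
  assumes e: "e > 0" and yz: "\<And>n. e \<le> dist (y n) (z n)"
  shows "\<exists>r :: nat \<Rightarrow> nat. strict_mono r \<and> (\<forall>i j. e / 4 \<le> dist (y (r i)) (z (r j)))"
proof -
  define col :: "nat set \<Rightarrow> nat" where
    "col A = (if dist (y (Min A)) (z (Max A)) < e / 4 then 0
              else if dist (y (Max A)) (z (Min A)) < e / 4 then 1 else 2)" for A
  have col3: "col A < 3" for A unfolding col_def by simp
  have "\<forall>a\<in>UNIV. \<forall>b\<in>UNIV. a \<noteq> b \<longrightarrow> col {a, b} < 3" by (intro ballI impI col3)
  from Ramsey2[OF infinite_UNIV_nat this] obtain Y t where Y: "infinite Y"
    and t: "\<forall>a\<in>Y. \<forall>b\<in>Y. a \<noteq> b \<longrightarrow> col {a, b} = t"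
    by (elim exE conjE)
  define r where "r = enumerate Y"
  have r: "strict_mono r" "\<And>i. r i \<in> Y"
    using Y by (auto simp: r_def strict_mono_enumerate enumerate_in_set)
  have col: "col {r i, r j} = t" if "i < j" for i j
    using t r(2)[of i] r(2)[of j] strict_mono_less[OF r(1), of i j] that by auto
  have mm: "Min {r i, r j} = r i" "Max {r i, r j} = r j" if "i < j" for i j
    using that r(1) by (auto simp: strict_mono_less less_imp_le min_def max_def strict_mono_less_eq)
  have "t \<noteq> 0"
  proof
    assume t: "t = 0"
    have 1: "P" if "(if P then 0 else if Q then 1 else (2::nat)) = 0" for P Q
      using that by (cases P; cases Q) auto
    have "dist (y (r i)) (z (r j)) < e / 4" if "i < j" for i j
      by (rule 1) (use col[OF that] in \<open>unfold col_def mm[OF that] t\<close>)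
    from this[of 0 1] this[of 0 2] this[of 1 2] show False
      using e yz[of "r 1"] dist_triangle[of "y (r 1)" "z (r 1)" "y (r 0)"]
        dist_triangle2[of "y (r 1)" "y (r 0)" "z (r 2)"] by simp
  qed
  moreover have "t \<noteq> 1"
  proof
    assume t: "t = 1"
    have 1: "Q" if "(if P then 0 else if Q then 1 else (2::nat)) = 1" for P Q
      using that by (cases P; cases Q) auto
    have "dist (y (r j)) (z (r i)) < e / 4" if "i < j" for i j
      by (rule 1) (use col[OF that] in \<open>unfold col_def mm[OF that] t\<close>)
    from this[of 0 1] this[of 0 2] this[of 1 2] show False
      using e yz[of "r 1"] dist_triangle[of "y (r 1)" "z (r 1)" "z (r 0)"]
        dist_triangle3[of "z (r 0)" "z (r 1)" "y (r 2)"] by simp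
  qed
  ultimately have t2: "t \<noteq> 0" "t \<noteq> 1" by auto
  have lt: "e / 4 \<le> dist (y (r i)) (z (r j))" "e / 4 \<le> dist (y (r j)) (z (r i))" if "i < j" for i j
    using col[OF that] t2 unfolding col_def mm[OF that]
    by (metis not_less)+
  have "e / 4 \<le> dist (y (r i)) (z (r j))" for i j
  proof (cases i j rule: linorder_cases)
    case equal
    then show ?thesis using yz[of "r i"] e by simp
  qed (use lt in simp_all)
  with r(1) show ?thesis by blast
qed

section \<open>Fibrewise maps acting on Lipschitz functions\<close>

text \<open>
These are the three analytic conditions of the theorem for a single family \<open>\<Theta>\<close> of fibre maps. In the
two Lipschitz conditions the increments of \<open>\<Theta>\<close> are compared with the displacement of \<open>\<kappa>\<close>: with \<open>\<kappa>\<close>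
the point map (or its inverse) they make sense before that map is known to be Lipschitz, and the conditions of the theorem are the
case where \<open>\<kappa>\<close> is the identity.
\<close>

definition bounded_sep ::
  "('a::metric_space \<Rightarrow> 'e::real_normed_vector \<Rightarrow> 'f::real_normed_vector) \<Rightarrow> bool" where
  "bounded_sep \<Theta> \<longleftrightarrow> (\<forall>p B. separated_seq p \<longrightarrow> bounded B \<longrightarrow>
     (\<exists>N. finite N \<and> bounded (\<Union>n\<in>- N. \<Theta> (p n) ` B)))"

definition lip_near :: "('a::metric_space \<Rightarrow> 'c::metric_space)
    \<Rightarrow> ('a \<Rightarrow> 'e::real_normed_vector \<Rightarrow> 'f::real_normed_vector) \<Rightarrow> bool" where
  "lip_near \<kappa> \<Theta> \<longleftrightarrow> (\<forall>p0 u0. \<forall>C\<ge>0. \<exists>r>0. \<exists>D. \<forall>p1 p2 u1 u2.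
     norm (u1 - u2) \<le> C * dist p1 p2 \<and>
     norm (u1 - u0) \<le> C * dist p1 p0 \<and> norm (u2 - u0) \<le> C * dist p2 p0 \<and>
     dist p1 p0 \<le> r \<and> dist p2 p0 \<le> r \<longrightarrow>
       norm (\<Theta> p1 u1 - \<Theta> p2 u2) \<le> D * dist (\<kappa> p1) (\<kappa> p2))"

definition lip_sep :: "('a::metric_space \<Rightarrow> 'c::metric_space)
    \<Rightarrow> ('a \<Rightarrow> 'e::real_normed_vector \<Rightarrow> 'f::real_normed_vector) \<Rightarrow> bool" where
  "lip_sep \<kappa> \<Theta> \<longleftrightarrow> (\<forall>p u. separated_seq p \<longrightarrow> bounded (range u) \<longrightarrow>
     (\<forall>C\<ge>0. \<exists>r>0. \<exists>D. \<forall>(n::nat) p' u'.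
       norm (u' - u n) \<le> C * dist p' (p n) \<and> dist p' (p n) \<le> r \<longrightarrow>
         norm (\<Theta> p' u' - \<Theta> (p n) (u n)) \<le> D * dist (\<kappa> p') (\<kappa> (p n))))"

lemma lip_nearD:
  assumes "lip_near \<kappa> \<Theta>" "0 \<le> C"
  shows "\<exists>r>0. \<exists>D. \<forall>p1 p2 u1 u2.
     norm (u1 - u2) \<le> C * dist p1 p2 \<and>
     norm (u1 - u0) \<le> C * dist p1 p0 \<and> norm (u2 - u0) \<le> C * dist p2 p0 \<and>
     dist p1 p0 \<le> r \<and> dist p2 p0 \<le> r \<longrightarrow>
       norm (\<Theta> p1 u1 - \<Theta> p2 u2) \<le> D * dist (\<kappa> p1) (\<kappa> p2)"
  using assms by (simp only: lip_near_def)

lemma lip_sepD: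
  assumes "lip_sep \<kappa> \<Theta>" "separated_seq p" "bounded (range u)" "0 \<le> C"
  shows "\<exists>r>0. \<exists>D. \<forall>(n::nat) p' u'.
       norm (u' - u n) \<le> C * dist p' (p n) \<and> dist p' (p n) \<le> r \<longrightarrow>
         norm (\<Theta> p' u' - \<Theta> (p n) (u n)) \<le> D * dist (\<kappa> p') (\<kappa> (p n))"
  using assms by (simp only: lip_sep_def)

definition acts :: "('a::metric_space \<Rightarrow> 'c::metric_space)
    \<Rightarrow> ('a \<Rightarrow> 'e::real_normed_vector \<Rightarrow> 'f::real_normed_vector) \<Rightarrow> bool" where
  "acts \<kappa> \<Theta> \<longleftrightarrow> (\<forall>f\<in>Lip. \<exists>L. \<forall>p q.
     norm (\<Theta> p (f p) - \<Theta> q (f q)) \<le> L * dist (\<kappa> p) (\<kappa> q))"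

text \<open>
Along a separated sequence the disjoint balls of radius \<open>\<delta> / 3\<close> carry one two-point bump each; points
within \<open>\<delta> / 6\<close> of a centre keep the distance \<open>\<delta> / 6\<close> from the complement of its ball.
\<close>

lemma Lip_interpolate_separated:
  fixes p p' :: "nat \<Rightarrow> 'a::metric_space" and u u' :: "nat \<Rightarrow> 'e::real_normed_vector"
  assumes \<delta>: "0 < \<delta>" "\<And>m n. m \<noteq> n \<Longrightarrow> \<delta> \<le> dist (p m) (p n)"
    and M: "\<And>n. norm (u n) \<le> M" and C: "0 \<le> C"
    and near: "\<And>n. dist (p' n) (p n) \<le> \<delta> / 6"
    and u': "\<And>n. norm (u' n - u n) \<le> C * dist (p' n) (p n)"
  shows "\<exists>f\<in>Lip. \<forall>n. f (p n) = u n \<and> f (p' n) = u' n"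
proof -
  have M0: "0 \<le> M" using M[of 0] norm_ge_zero order_trans by blast
  define K where "K = 6 * M / \<delta> + C"
  have K: "0 \<le> K" using M0 C \<delta> by (simp add: K_def)
  have K\<delta>: "M + C * (\<delta> / 6) = K * (\<delta> / 6)" using \<delta> by (simp add: K_def field_simps)
  have ex: "\<exists>g. (3 * C + K)-lipschitz_on UNIV g \<and> g (p' n) = u' n \<and> g (p n) = u n \<and>
      (\<forall>s. s \<notin> ball (p n) (\<delta> / 3) \<longrightarrow> g s = 0)" for n
  proof -
    have *: "norm (u' n) \<le> K * dist (p' n) s" "norm (u n) \<le> K * dist (p n) s"
      if "s \<in> - ball (p n) (\<delta> / 3)" for s
    proof -
      have d: "\<delta> / 6 \<le> dist (p n) s" "\<delta> / 6 \<le> dist (p' n) s"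
        using that near[of n] \<delta> dist_triangle3[of "p n" s "p' n"] by auto
      have "C * dist (p' n) (p n) \<le> C * (\<delta> / 6)" using near C by (rule mult_left_mono)
      then have "norm (u' n) \<le> M + C * (\<delta> / 6)"
        using norm_triangle_ineq2[of "u' n" "u n"] u'[of n] M[of n] by linarith
      moreover have "norm (u n) \<le> M + C * (\<delta> / 6)" using M[of n] C \<delta> by (simp add: add_increasing2)
      ultimately show "norm (u' n) \<le> K * dist (p' n) s" "norm (u n) \<le> K * dist (p n) s"
        using K\<delta> mult_left_mono[OF d(1) K] mult_left_mono[OF d(2) K] by linarith+
    qed
    have "\<exists>g. (3 * C + K)-lipschitz_on UNIV g \<and> g (p' n) = u' n \<and> g (p n) = u n \<and>
        (\<forall>s\<in>- ball (p n) (\<delta> / 3). g s = 0)"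
      by (rule two_point_bump[OF u'[of n] C K *])
    then show ?thesis by (simp only: Ball_def Compl_iff)
  qed
  obtain g where g: "\<And>n. (3 * C + K)-lipschitz_on UNIV (g n)" "\<And>n. g n (p' n) = u' n"
    "\<And>n. g n (p n) = u n" "\<And>n s. s \<notin> ball (p n) (\<delta> / 3) \<Longrightarrow> g n s = 0"
    using ex by metis
  have off: "g m x = 0" if "m \<noteq> n" "x \<in> ball (p n) (\<delta> / 3)" for m n x
    using \<delta>(2)[OF that(1)] that(2) \<delta>(1) dist_triangle2[of "p m" "p n" x] by (intro g(4)) auto
  have disj: "g m x = 0 \<or> g n x = 0" if "m \<noteq> n" for m n x
    using off[OF that] g(4) by blast
  obtain f where f: "f \<in> Lip" "\<forall>n x. (\<forall>m. m \<noteq> n \<longrightarrow> g m x = 0) \<longrightarrow> f x = g n x"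
    using lipschitz_disjoint_sum[where g = g, OF g(1) disj] by blast
  have "f (p n) = u n" for n
    using f(2)[rule_format, of n "p n"] off[of _ n "p n"] \<delta> g(3) by auto
  moreover have "f (p' n) = u' n" for n
    using f(2)[rule_format, of n "p' n"] off[of _ n "p' n"] \<delta> near[of n] g(2) by (auto simp: dist_commute)
  ultimately show ?thesis using f(1) by blast
qed

text \<open>
Here the bumps live on annuli around \<open>p0\<close>. A pair may consist of points at very different distances from
\<open>p0\<close>, or contain \<open>p0\<close> itself, so the inner radius is governed by \<open>m n\<close>, a lower bound for the nonzero
distances of the pair; the next pair is required to be much closer to \<open>p0\<close>, which makes the annuli
disjoint. Near \<open>p0\<close> the values deviate from \<open>u0\<close> at most proportionally to the distance, hence the
constants stay uniform.
\<close>

lemma Lip_interpolate_convergent: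
  fixes p1 p2 :: "nat \<Rightarrow> 'a::metric_space" and u1 u2 :: "nat \<Rightarrow> 'e::real_normed_vector"
  assumes C: "0 \<le> C"
    and u: "\<And>n. norm (u1 n - u2 n) \<le> C * dist (p1 n) (p2 n)"
      "\<And>n. norm (u1 n - u0) \<le> C * dist (p1 n) p0" "\<And>n. norm (u2 n - u0) \<le> C * dist (p2 n) p0"
    and m: "\<And>n. 0 < m n" "\<And>n. p1 n = p0 \<or> m n \<le> dist (p1 n) p0"
      "\<And>n. p2 n = p0 \<or> m n \<le> dist (p2 n) p0"
    and decay: "\<And>i j. i < j \<Longrightarrow> dist (p1 j) p0 \<le> m i / 8"
      "\<And>i j. i < j \<Longrightarrow> dist (p2 j) p0 \<le> m i / 8"
  shows "\<exists>f\<in>Lip. \<forall>n. f (p1 n) = u1 n \<and> f (p2 n) = u2 n"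
proof -
  define M where "M n = max (dist (p1 n) p0) (dist (p2 n) p0)" for n
  define S where "S n = {s. dist s p0 \<le> m n / 2 \<or> 2 * M n \<le> dist s p0}" for n
  have far: "norm (v - u0) \<le> 2 * C * dist p s"
    if p: "p = p0 \<or> m n \<le> dist p p0" "dist p p0 \<le> M n" and v: "norm (v - u0) \<le> C * dist p p0"
      and s: "s \<in> S n" for p s n and v :: 'e
  proof -
    have "dist p p0 \<le> 2 * dist p s"
      using p s dist_triangle[of p p0 s] dist_triangle3[of s p0 p]
      by (auto simp: S_def dist_commute)
    from mult_left_mono[OF this C] v show ?thesis by simp
  qed
  have ex: "\<exists>g. (3 * C + 2 * C)-lipschitz_on UNIV g \<and> g (p1 n) = u1 n - u0 \<and> g (p2 n) = u2 n - u0 \<and>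
      (\<forall>s\<in>S n. g s = 0)" for n
  proof -
    have uu: "norm ((u1 n - u0) - (u2 n - u0)) \<le> C * dist (p1 n) (p2 n)" using u(1) by simp
    have C2: "0 \<le> 2 * C" using C by simp
    have *: "norm (u1 n - u0) \<le> 2 * C * dist (p1 n) s"
      "norm (u2 n - u0) \<le> 2 * C * dist (p2 n) s" if "s \<in> S n" for s
      using far[OF _ _ _ that] m(2,3)[of n] u(2,3)[of n] by (auto simp: M_def)
    from two_point_bump[OF uu C C2 *] show ?thesis by simp
  qed
  obtain g where g: "\<And>n. (3 * C + 2 * C)-lipschitz_on UNIV (g n)" "\<And>n. g n (p1 n) = u1 n - u0"
    "\<And>n. g n (p2 n) = u2 n - u0" "\<And>n s. s \<in> S n \<Longrightarrow> g n s = 0"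
    using ex by metis
  have lt: "M j \<le> m i / 8" if "i < j" for i j
    using decay[OF that] by (simp add: M_def)
  have lt_disj: "g i x = 0 \<or> g j x = 0" if "i < j" for i j x
  proof (rule ccontr)
    assume "\<not> ?thesis"
    then have "m i / 2 < dist x p0" "dist x p0 < 2 * M j"
      using g(4)[of x i] g(4)[of x j] by (force simp: S_def)+
    then show False using lt[OF that] m(1)[of i] by simp
  qed
  have disj: "g i x = 0 \<or> g j x = 0" if "i \<noteq> j" for i j x
    using that lt_disj[of i j x] lt_disj[of j i x] by (cases i j rule: linorder_cases) auto
  obtain f where f: "f \<in> Lip" "\<forall>n x. (\<forall>m. m \<noteq> n \<longrightarrow> g m x = 0) \<longrightarrow> f x = g n x"
    using lipschitz_disjoint_sum[where g = g, OF g(1) disj] by blast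
  have off: "g i p = 0" if "i \<noteq> n" "p = p0 \<or> m n \<le> dist p p0" "dist p p0 \<le> M n" for i n p
  proof (rule g(4), cases "p = p0")
    case True
    then show "p \<in> S i" using m(1)[of i] by (simp add: S_def)
  next
    case False
    then have *: "m n \<le> dist p p0" using that by simp
    show "p \<in> S i"
    proof (cases "i < n")
      case True
      then show ?thesis using lt[OF True] that m(1)[of i] by (simp add: S_def)
    next
      case False
      then have "n < i" using that by simp
      then show ?thesis using lt[of n i] * m(1)[of n] by (simp add: S_def)
    qed
  qed
  have 1: "f (p1 n) = u1 n - u0" "f (p2 n) = u2 n - u0" for n
    using f(2)[rule_format, of n "p1 n"] f(2)[rule_format, of n "p2 n"] off[of _ n "p1 n"] off[of _ n "p2 n"] m(2,3)[of n] g(2,3)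
    by (auto simp: M_def)
  show ?thesis
    using 1 by (intro bexI[of _ "\<lambda>x. f x + u0"] Lip_add[OF f(1) Lip_const]) simp
qed

text \<open>
If the estimate fails for every \<open>r\<close> and \<open>D\<close>, then violating pairs can be chosen one after the other, the
\<open>n\<close>-th with constant \<open>n\<close> and much closer to \<open>p0\<close> than its predecessors. One Lipschitz function passes
through all their values, and its image under \<open>\<Theta>\<close> cannot be Lipschitz.
\<close>

lemma acts_imp_lip_near:
  fixes \<kappa> :: "'a::metric_space \<Rightarrow> 'c::metric_space"
    and \<Theta> :: "'a \<Rightarrow> 'e::real_normed_vector \<Rightarrow> 'f::real_normed_vector"
  assumes "acts \<kappa> \<Theta>"
  shows "lip_near \<kappa> \<Theta>"
  unfolding lip_near_def
proof (intro allI impI)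
  fix p0 :: 'a and u0 :: 'e and C :: real
  assume C: "0 \<le> C"
  define V where "V r D p1 p2 u1 u2 \<longleftrightarrow> norm (u1 - u2) \<le> C * dist p1 p2 \<and>
     norm (u1 - u0) \<le> C * dist p1 p0 \<and> norm (u2 - u0) \<le> C * dist p2 p0 \<and>
     dist p1 p0 \<le> r \<and> dist p2 p0 \<le> r \<and>
     D * dist (\<kappa> p1) (\<kappa> p2) < norm (\<Theta> p1 u1 - \<Theta> p2 u2)" for r D p1 p2 u1 u2
  show "\<exists>r>0. \<exists>D. \<forall>p1 p2 u1 u2.
     norm (u1 - u2) \<le> C * dist p1 p2 \<and>
     norm (u1 - u0) \<le> C * dist p1 p0 \<and> norm (u2 - u0) \<le> C * dist p2 p0 \<and>
     dist p1 p0 \<le> r \<and> dist p2 p0 \<le> r \<longrightarrow>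
       norm (\<Theta> p1 u1 - \<Theta> p2 u2) \<le> D * dist (\<kappa> p1) (\<kappa> p2)"
  proof (rule ccontr)
    assume *: "\<not> ?thesis"
    have ex: "\<exists>p1 p2 u1 u2 m. V r D p1 p2 u1 u2 \<and> 0 < m \<and> m \<le> r \<and>
        (p1 = p0 \<or> m \<le> dist p1 p0) \<and> (p2 = p0 \<or> m \<le> dist p2 p0)" if r: "r > 0" for r D
    proof -
      obtain p1 p2 u1 u2 where V: "V r D p1 p2 u1 u2"
        using * r unfolding V_def by (meson not_le)
      have "p1 \<noteq> p0 \<or> p2 \<noteq> p0"
      proof (rule ccontr)
        assume "\<not> ?thesis"
        then have "p1 = p0" "p2 = p0" by auto
        then show False using V by (auto simp: V_def)
      qed
      \<comment> \<open>Not both points are \<open>p0\<close>, as then \<open>u1 = u2 = u0\<close> and there is no violation.\<close>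
      define m where "m = (if p1 = p0 then dist p2 p0 else if p2 = p0 then dist p1 p0
        else min (dist p1 p0) (dist p2 p0))"
      have "0 < m \<and> m \<le> r \<and> (p1 = p0 \<or> m \<le> dist p1 p0) \<and> (p2 = p0 \<or> m \<le> dist p2 p0)"
        using \<open>p1 \<noteq> p0 \<or> p2 \<noteq> p0\<close> V by (auto simp: m_def V_def)
      with V show ?thesis by blast
    qed
    define Q where "Q k x y \<longleftrightarrow> (case x of (p1, p2, u1, u2, m) \<Rightarrow> (case y of (q1, q2, v1, v2, m') \<Rightarrow>
        V (m / 8) (real (Suc k)) q1 q2 v1 v2 \<and> m' \<le> m))"
      for k :: nat and x y :: "'a \<times> 'a \<times> 'e \<times> 'e \<times> real"
    define P where "P k x \<longleftrightarrow> (case x of (p1, p2, u1, u2, m) \<Rightarrow> (\<exists>r. V r (real k) p1 p2 u1 u2) \<and> 0 < m \<and>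
        (p1 = p0 \<or> m \<le> dist p1 p0) \<and> (p2 = p0 \<or> m \<le> dist p2 p0))" for k :: nat and x
    have "\<exists>F. \<forall>n. P n (F n) \<and> Q n (F n) (F (Suc n))"
    proof (rule dependent_nat_choice)
      show "\<exists>x. P 0 x" using ex[of 1 "real 0"] unfolding P_def by fastforce
      fix x n assume P: "P n x"
      obtain p1 p2 u1 u2 m where x: "x = (p1, p2, u1, u2, m)" by (cases x) auto
      have m: "0 < m / 8" using P by (simp add: P_def x)
      obtain q1 q2 v1 v2 m' where y: "V (m / 8) (real (Suc n)) q1 q2 v1 v2" "0 < m'" "m' \<le> m / 8"
        "q1 = p0 \<or> m' \<le> dist q1 p0" "q2 = p0 \<or> m' \<le> dist q2 p0"
        using ex[OF m, of "real (Suc n)"] by blast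
      have "P (Suc n) (q1, q2, v1, v2, m')" using y by (auto simp: P_def simp del: of_nat_Suc)
      moreover have "Q n x (q1, q2, v1, v2, m')" using y m by (auto simp: Q_def x simp del: of_nat_Suc)
      ultimately show "\<exists>y. P (Suc n) y \<and> Q n x y" by blast
    qed
    then obtain F where F: "\<And>n. P n (F n)" "\<And>n. Q n (F n) (F (Suc n))" by blast
    define p1 p2 u1 u2 m where "p1 n = fst (F n)" and "p2 n = fst (snd (F n))"
      and "u1 n = fst (snd (snd (F n)))" and "u2 n = fst (snd (snd (snd (F n))))"
      and "m n = snd (snd (snd (snd (F n))))" for n
    have Feq: "F n = (p1 n, p2 n, u1 n, u2 n, m n)" for n
      by (simp add: p1_def p2_def u1_def u2_def m_def)
    have P: "\<exists>r. V r (real n) (p1 n) (p2 n) (u1 n) (u2 n)" "0 < m n"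
      "p1 n = p0 \<or> m n \<le> dist (p1 n) p0" "p2 n = p0 \<or> m n \<le> dist (p2 n) p0" for n
      using F(1)[of n] by (auto simp: P_def Feq)
    have Q: "dist (p1 (Suc n)) p0 \<le> m n / 8" "dist (p2 (Suc n)) p0 \<le> m n / 8" "m (Suc n) \<le> m n" for n
      using F(2)[of n] by (auto simp: Q_def Feq V_def)
    have mono: "m j \<le> m i" if "i \<le> j" for i j
      using that Q(3) by (rule lift_Suc_antimono_le[of m, rotated]) 
    have decay: "dist (p1 j) p0 \<le> m i / 8 \<and> dist (p2 j) p0 \<le> m i / 8" if "i < j" for i j
    proof -
      obtain k where k: "j = Suc k" "i \<le> k" using \<open>i < j\<close> by (cases j) auto
      then show ?thesis using Q(1,2)[of k] mono[OF k(2)] by auto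
    qed
    have "\<exists>f\<in>Lip. \<forall>n. f (p1 n) = u1 n \<and> f (p2 n) = u2 n"
    proof (rule Lip_interpolate_convergent[OF C, of u1 u2 p1 p2 u0 p0 m])
      show "norm (u1 n - u2 n) \<le> C * dist (p1 n) (p2 n)" for n
        using P(1)[of n] by (auto simp: V_def)
      show "norm (u1 n - u0) \<le> C * dist (p1 n) p0" for n
        using P(1)[of n] by (auto simp: V_def)
      show "norm (u2 n - u0) \<le> C * dist (p2 n) p0" for n
        using P(1)[of n] by (auto simp: V_def)
    qed (use P(2-4) decay in blast)+
    then obtain f where f: "f \<in> Lip" "\<And>n. f (p1 n) = u1 n" "\<And>n. f (p2 n) = u2 n" by blast
    obtain L where L: "\<And>p q. norm (\<Theta> p (f p) - \<Theta> q (f q)) \<le> L * dist (\<kappa> p) (\<kappa> q)"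
      using assms f(1) unfolding acts_def by blast
    obtain n :: nat where n: "L \<le> real n" using real_arch_simple by blast
    have "real n * dist (\<kappa> (p1 n)) (\<kappa> (p2 n)) < L * dist (\<kappa> (p1 n)) (\<kappa> (p2 n))"
      using P(1)[of n] L[of "p1 n" "p2 n"] f by (auto simp: V_def)
    moreover have "L * dist (\<kappa> (p1 n)) (\<kappa> (p2 n)) \<le> real n * dist (\<kappa> (p1 n)) (\<kappa> (p2 n))"
      using n by (intro mult_right_mono) auto
    ultimately show False by linarith
  qed
qed

text \<open>
Failure of the uniform estimate cannot come from finitely many indices, since at each single \<open>p n\<close> the
local estimate holds. So the violations with constants \<open>0, 1, 2, \<dots>\<close> can be placed at increasing indices,
where a single Lipschitz function realises them all.
\<close>

lemma acts_imp_lip_sep: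
  fixes \<kappa> :: "'a::metric_space \<Rightarrow> 'c::metric_space"
    and \<Theta> :: "'a \<Rightarrow> 'e::real_normed_vector \<Rightarrow> 'f::real_normed_vector"
  assumes acts: "acts \<kappa> \<Theta>"
  shows "lip_sep \<kappa> \<Theta>"
  unfolding lip_sep_def
proof (intro allI impI)
  fix p :: "nat \<Rightarrow> 'a" and u :: "nat \<Rightarrow> 'e" and C :: real
  assume sep: "separated_seq p" and bdd: "bounded (range u)" and C: "0 \<le> C"
  define V where "V r D n p' u' \<longleftrightarrow> norm (u' - u n) \<le> C * dist p' (p n) \<and> dist p' (p n) \<le> r \<and>
     D * dist (\<kappa> p') (\<kappa> (p n)) < norm (\<Theta> p' u' - \<Theta> (p n) (u n))" for r D n p' u'
  show "\<exists>r>0. \<exists>D. \<forall>(n::nat) p' u'.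
       norm (u' - u n) \<le> C * dist p' (p n) \<and> dist p' (p n) \<le> r \<longrightarrow>
         norm (\<Theta> p' u' - \<Theta> (p n) (u n)) \<le> D * dist (\<kappa> p') (\<kappa> (p n))"
  proof (rule ccontr)
    assume *: "\<not> ?thesis"
    have ex: "\<exists>n p' u'. V r D n p' u'" if r: "r > 0" for r D
      using * r unfolding V_def by (meson not_le)
    have "\<forall>n. \<exists>r D. r > 0 \<and> (\<forall>p' u'. norm (u' - u n) \<le> C * dist p' (p n) \<and> dist p' (p n) \<le> r \<longrightarrow>
         norm (\<Theta> p' u' - \<Theta> (p n) (u n)) \<le> D * dist (\<kappa> p') (\<kappa> (p n)))"
    proof
      fix n
      obtain r D where "r > 0" and rD: "\<And>p1 p2 u1 u2. norm (u1 - u2) \<le> C * dist p1 p2 \<and>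
         norm (u1 - u n) \<le> C * dist p1 (p n) \<and> norm (u2 - u n) \<le> C * dist p2 (p n) \<and>
         dist p1 (p n) \<le> r \<and> dist p2 (p n) \<le> r \<Longrightarrow>
           norm (\<Theta> p1 u1 - \<Theta> p2 u2) \<le> D * dist (\<kappa> p1) (\<kappa> p2)"
        using acts_imp_lip_near[OF acts] C unfolding lip_near_def by meson
      then show "\<exists>r D. r > 0 \<and> (\<forall>p' u'. norm (u' - u n) \<le> C * dist p' (p n) \<and> dist p' (p n) \<le> r \<longrightarrow>
         norm (\<Theta> p' u' - \<Theta> (p n) (u n)) \<le> D * dist (\<kappa> p') (\<kappa> (p n)))"
        by (intro exI[of _ r] exI[of _ D]) auto
    qed
    then obtain rr DD where rr: "\<And>n. rr n > 0" and DD: "\<And>n p' u'.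
        norm (u' - u n) \<le> C * dist p' (p n) \<Longrightarrow> dist p' (p n) \<le> rr n \<Longrightarrow>
         norm (\<Theta> p' u' - \<Theta> (p n) (u n)) \<le> DD n * dist (\<kappa> p') (\<kappa> (p n))"
      by metis
    have late: "\<exists>n p' u'. N \<le> n \<and> V r D n p' u'" if r: "r > 0" for r D N
    proof -
      \<comment> \<open>Constants that are good enough for all indices below \<open>N\<close> exclude these indices.\<close>
      define r' where "r' = Min (insert r (rr ` {..<N}))"
      define D' where "D' = Max (insert D (DD ` {..<N}))"
      have r': "r' > 0" "r' \<le> r" "\<And>i. i < N \<Longrightarrow> r' \<le> rr i" using r rr by (auto simp: r'_def)
      have D': "D \<le> D'" "\<And>i. i < N \<Longrightarrow> DD i \<le> D'" by (auto simp: D'_def)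
      obtain n p' u' where V: "V r' D' n p' u'" using ex[OF r'(1)] by blast
      have "N \<le> n"
      proof (rule ccontr)
        assume "\<not> N \<le> n"
        then have "norm (\<Theta> p' u' - \<Theta> (p n) (u n)) \<le> DD n * dist (\<kappa> p') (\<kappa> (p n))"
          using V r'(3)[of n] by (intro DD) (auto simp: V_def)
        also have "\<dots> \<le> D' * dist (\<kappa> p') (\<kappa> (p n))"
          using D'(2)[of n] \<open>\<not> N \<le> n\<close> by (intro mult_right_mono) auto
        finally show False using V by (simp add: V_def)
      qed
      moreover have "D * dist (\<kappa> p') (\<kappa> (p n)) \<le> D' * dist (\<kappa> p') (\<kappa> (p n))"
        using D' by (intro mult_right_mono) auto
      then have "V r D n p' u'" using V r'(2) by (auto simp: V_def)
      ultimately show ?thesis by blast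
    qed
    obtain \<delta> where \<delta>: "\<delta> > 0" "\<And>m n. m \<noteq> n \<Longrightarrow> \<delta> \<le> dist (p m) (p n)"
      using sep by (auto simp: separated_seq_iff)
    obtain M where M: "\<And>n. norm (u n) \<le> M" using bdd by (auto simp: bounded_iff)
    define P where "P k x \<longleftrightarrow> (case x of (n, p', u') \<Rightarrow> V (\<delta> / 6) (real k) n p' u')"
      for k :: nat and x :: "nat \<times> 'a \<times> 'e"
    have "\<exists>F. \<forall>n. P n (F n) \<and> fst (F n) < fst (F (Suc n))"
    proof (rule dependent_nat_choice)
      show "\<exists>x. P 0 x" using ex[of "\<delta> / 6" "real 0"] \<delta>(1) unfolding P_def by fastforce
      fix x n
      show "\<exists>y. P (Suc n) y \<and> fst x < fst y"
        using late[of "\<delta> / 6" "Suc (fst x)" "real (Suc n)"] \<delta>(1) unfolding P_def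
        by (fastforce simp: Suc_le_eq)
    qed
    then obtain F where F: "\<And>n. P n (F n)" "\<And>n. fst (F n) < fst (F (Suc n))" by blast
    define n p' u' where "n k = fst (F k)" and "p' k = fst (snd (F k))" and "u' k = snd (snd (F k))" for k
    have V: "V (\<delta> / 6) (real k) (n k) (p' k) (u' k)" for k
      using F(1)[of k] by (simp add: P_def n_def p'_def u'_def case_prod_beta)
    have n: "strict_mono n" using F(2) by (simp add: strict_mono_Suc_iff n_def)
    have "\<exists>f\<in>Lip. \<forall>k. f (p (n k)) = u (n k) \<and> f (p' k) = u' k"
    proof (rule Lip_interpolate_separated[OF \<delta>(1) _ _ C, of "\<lambda>k. p (n k)" "\<lambda>k. u (n k)" M p' u'])
      show "\<delta> \<le> dist (p (n i)) (p (n j))" if "i \<noteq> j" for i j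
        using \<delta>(2) that n by (metis strict_mono_eq)
    qed (use V M in \<open>auto simp: V_def\<close>)
    then obtain f where f: "f \<in> Lip" "\<And>k. f (p (n k)) = u (n k)" "\<And>k. f (p' k) = u' k" by blast
    obtain L where L: "\<And>p q. norm (\<Theta> p (f p) - \<Theta> q (f q)) \<le> L * dist (\<kappa> p) (\<kappa> q)"
      using acts f(1) unfolding acts_def by blast
    obtain k :: nat where k: "L \<le> real k" using real_arch_simple by blast
    have "real k * dist (\<kappa> (p' k)) (\<kappa> (p (n k))) < L * dist (\<kappa> (p' k)) (\<kappa> (p (n k)))"
      using V[of k] L[of "p' k" "p (n k)"] f by (auto simp: V_def)
    moreover have "L * dist (\<kappa> (p' k)) (\<kappa> (p (n k))) \<le> real k * dist (\<kappa> (p' k)) (\<kappa> (p (n k)))"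
      using k by (intro mult_right_mono) auto
    ultimately show False by linarith
  qed
qed

text \<open>
Unboundedness off every finite set yields values of unbounded size at increasing indices. A single
Lipschitz function realises them, although its image is a bounded function.
\<close>

lemma acts_imp_bounded_sep:
  fixes \<kappa> :: "'a::metric_space \<Rightarrow> 'c::metric_space"
    and \<Theta> :: "'a \<Rightarrow> 'e::real_normed_vector \<Rightarrow> 'f::real_normed_vector"
  assumes acts: "acts \<kappa> \<Theta>" and bdd: "bounded (range \<kappa>)"
  shows "bounded_sep \<Theta>"
  unfolding bounded_sep_def
proof (intro allI impI)
  fix p :: "nat \<Rightarrow> 'a" and B :: "'e set"
  assume sep: "separated_seq p" and B: "bounded B"
  show "\<exists>N. finite N \<and> bounded (\<Union>n\<in>- N. \<Theta> (p n) ` B)"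
  proof (rule ccontr)
    assume *: "\<not> ?thesis"
    have late: "\<exists>n b. N \<le> n \<and> b \<in> B \<and> R < norm (\<Theta> (p n) b)" for N :: nat and R
    proof -
      have "\<not> bounded (\<Union>n\<in>- {..<N}. \<Theta> (p n) ` B)" using * by blast
      then show ?thesis unfolding bounded_iff by (fastforce simp: not_le not_less)
    qed
    define P where "P k x \<longleftrightarrow> snd x \<in> B \<and> real k < norm (\<Theta> (p (fst x)) (snd x))"
      for k :: nat and x :: "nat \<times> 'e"
    have "\<exists>F. \<forall>n. P n (F n) \<and> fst (F n) < fst (F (Suc n))"
    proof (rule dependent_nat_choice)
      show "\<exists>x. P 0 x" using late[of 0 "real 0"] unfolding P_def by fastforce
      fix x n
      show "\<exists>y. P (Suc n) y \<and> fst x < fst y"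
        using late[of "Suc (fst x)" "real (Suc n)"] unfolding P_def by (fastforce simp: Suc_le_eq)
    qed
    then obtain F where F: "\<And>n. P n (F n)" "\<And>n. fst (F n) < fst (F (Suc n))" by blast
    define n b where "n k = fst (F k)" and "b k = snd (F k)" for k
    have V: "b k \<in> B" "real k < norm (\<Theta> (p (n k)) (b k))" for k
      using F(1)[of k] by (auto simp: P_def n_def b_def)
    have n: "strict_mono n" using F(2) by (simp add: strict_mono_Suc_iff n_def)
    obtain \<delta> where \<delta>: "\<delta> > 0" "\<And>i j. i \<noteq> j \<Longrightarrow> \<delta> \<le> dist (p (n i)) (p (n j))"
      using separated_seq_subseq[OF sep n] by (auto simp: separated_seq_iff)
    obtain M where M: "\<And>k. norm (b k) \<le> M" using B V(1) by (auto simp: bounded_iff)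
    have "\<exists>f\<in>Lip. \<forall>k. f (p (n k)) = b k \<and> f (p (n k)) = b k"
      by (rule Lip_interpolate_separated[OF \<delta> M order_refl]) (use \<delta>(1) in auto)
    then obtain f where f: "f \<in> Lip" "\<And>k. f (p (n k)) = b k" by blast
    obtain L where L: "\<And>p q. norm (\<Theta> p (f p) - \<Theta> q (f q)) \<le> L * dist (\<kappa> p) (\<kappa> q)"
      using acts f(1) unfolding acts_def by blast
    obtain e where e: "\<And>p q. dist (\<kappa> p) (\<kappa> q) \<le> e"
      using bdd unfolding bounded_two_points by blast
    define R where "R = norm (\<Theta> (p 0) (f (p 0))) + \<bar>L\<bar> * e"
    have "norm (\<Theta> q (f q)) \<le> R" for q
    proof -
      have "L * dist (\<kappa> q) (\<kappa> (p 0)) \<le> \<bar>L\<bar> * e"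
        using e by (intro mult_mono) auto
      then show ?thesis
        using L[of q "p 0"] norm_triangle_ineq2[of "\<Theta> q (f q)" "\<Theta> (p 0) (f (p 0))"]
        by (simp add: R_def)
    qed
    moreover obtain k :: nat where "R \<le> real k" using real_arch_simple by blast
    ultimately show False using V(2)[of k] f(2)[of k] by (metis not_less order_trans)
  qed
qed

lemma eventually_le_real_subseq:
  assumes "strict_mono s"
  shows "eventually (\<lambda>n. D \<le> real (s n)) sequentially"
proof -
  have "filterlim (\<lambda>n. real (s n)) at_top sequentially"
    using filterlim_compose[OF filterlim_real_sequentially filterlim_subseq[OF assms]] .
  then show ?thesis by (simp add: filterlim_at_top)
qed

text \<open>
Sufficiency of the three conditions. Boundedness is needed first: it forces pairs that violate the
\<open>n\<close>-th Lipschitz estimate to have distance tending to zero, so that the local estimates apply to a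
convergent or separated subsequence.
\<close>

lemma fibrewise_Lip:
  fixes \<Theta> :: "'a::complete_space \<Rightarrow> 'e::real_normed_vector \<Rightarrow> 'f::real_normed_vector"
  assumes bdd: "bounded (UNIV :: 'a set)"
    and bs: "bounded_sep \<Theta>" and ln: "lip_near (\<lambda>x. x) \<Theta>" and ls: "lip_sep (\<lambda>x. x) \<Theta>"
    and f: "f \<in> Lip"
  shows "(\<lambda>x. \<Theta> x (f x)) \<in> Lip"
proof -
  define G where "G x = \<Theta> x (f x)" for x
  obtain C where C: "0 \<le> C" "\<And>x y. norm (f x - f y) \<le> C * dist x y"
    using f by (auto simp: Lip_def lipschitz_on_def dist_norm)
  have near: "\<exists>r>0. \<exists>D. \<forall>x1 x2. dist x1 x0 \<le> r \<longrightarrow> dist x2 x0 \<le> r \<longrightarrow> norm (G x1 - G x2) \<le> D * dist x1 x2" for x0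
  proof -
    obtain r D where "r > 0" and rD: "\<And>p1 p2 u1 u2. norm (u1 - u2) \<le> C * dist p1 p2 \<and>
         norm (u1 - f x0) \<le> C * dist p1 x0 \<and> norm (u2 - f x0) \<le> C * dist p2 x0 \<and>
         dist p1 x0 \<le> r \<and> dist p2 x0 \<le> r \<Longrightarrow> norm (\<Theta> p1 u1 - \<Theta> p2 u2) \<le> D * dist p1 p2"
      using ln C unfolding lip_near_def by meson
    then have "norm (G x1 - G x2) \<le> D * dist x1 x2" if "dist x1 x0 \<le> r" "dist x2 x0 \<le> r" for x1 x2
      unfolding G_def using that C(2) by (intro rD) auto
    with \<open>r > 0\<close> show ?thesis by blast
  qed
  have "bounded (range G)"
  proof (rule ccontr)
    assume "\<not> bounded (range G)"
    then have "\<forall>n. \<exists>x. real n < norm (G x)" by (auto simp: bounded_iff not_le)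
    then obtain x where x: "\<And>n. real n < norm (G (x n))" by metis
    show False
    proof (cases rule: convergent_or_separated_subseq[of x])
      case (convergent s l)
      obtain r D where r: "r > 0" and D: "\<And>x1 x2. dist x1 l \<le> r \<Longrightarrow> dist x2 l \<le> r \<Longrightarrow> norm (G x1 - G x2) \<le> D * dist x1 x2"
        using near[of l] by blast
      have "eventually (\<lambda>n. dist (x (s n)) l < r) sequentially" using convergent(2) r by (simp add: tendstoD)
      then have "eventually (\<lambda>n. False) sequentially"
        using eventually_le_real_subseq[OF convergent(1), of "norm (G l) + \<bar>D\<bar> * r"]
      proof eventually_elim
        case (elim n)
        have "D * dist (x (s n)) l \<le> \<bar>D\<bar> * r" using elim by (intro mult_mono) auto
        then have "norm (G (x (s n))) \<le> norm (G l) + \<bar>D\<bar> * r"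
          using D[of "x (s n)" l] elim(1) r norm_triangle_ineq2[of "G (x (s n))" "G l"] by simp
        then show False using x[of "s n"] elim(2) by linarith
      qed
      then show False by simp
    next
      case (separated s)
      obtain N where N: "finite N" "bounded (\<Union>n\<in>- N. \<Theta> (x (s n)) ` range f)"
        using bs separated(2) bounded_range_Lip[OF bdd f] unfolding bounded_sep_def by meson
      then obtain R where R: "\<And>n. n \<notin> N \<Longrightarrow> norm (G (x (s n))) \<le> R"
        by (auto simp: bounded_iff G_def)
      obtain k :: nat where k: "R \<le> real k" using real_arch_simple by blast
      obtain m where m: "\<forall>i\<in>N. i \<le> m" using N(1) by (auto simp: finite_nat_set_iff_bounded_le)
      define n where "n = Suc (max m k)"
      have n: "n \<notin> N" "k \<le> n" using m by (force simp: n_def)+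
      then have "real k \<le> real (s n)" using seq_suble[OF separated(1), of n] by simp
      then show False using R[OF n(1)] k x[of "s n"] by linarith
    qed
  qed
  then obtain R where R: "\<And>x. norm (G x) \<le> R" by (auto simp: bounded_iff)
  have "\<exists>L. \<forall>x y. norm (G x - G y) \<le> L * dist x y"
  proof (rule ccontr)
    assume "\<not> ?thesis"
    then have "\<forall>n. \<exists>x y. real n * dist x y < norm (G x - G y)" by (meson not_le)
    then obtain x y where xy: "\<And>n. real n * dist (x n) (y n) < norm (G (x n) - G (y n))" by metis
    have "norm (dist (x n) (y n)) \<le> 2 * R * inverse (real n)" if "n > 0" for n
    proof -
      have "real n * dist (x n) (y n) \<le> 2 * R"
        using xy[of n] norm_triangle_ineq4[of "G (x n)" "G (y n)"] R[of "x n"] R[of "y n"] by linarith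
      then show ?thesis using that by (simp add: field_simps)
    qed
    then have "eventually (\<lambda>n. norm (dist (x n) (y n)) \<le> 2 * R * inverse (real n)) sequentially"
      by (intro eventually_mono[OF eventually_gt_at_top[of "0::nat"]]) blast
    moreover have "(\<lambda>n. 2 * R * inverse (real n)) \<longlonglongrightarrow> 0"
      by (intro tendsto_mult_right_zero lim_inverse_n)
    ultimately have d0: "(\<lambda>n. dist (x n) (y n)) \<longlonglongrightarrow> 0" by (rule Lim_null_comparison)
    show False
    proof (cases rule: convergent_or_separated_subseq[of x])
      case (convergent s l)
      obtain r D where r: "r > 0" and D: "\<And>x1 x2. dist x1 l \<le> r \<Longrightarrow> dist x2 l \<le> r \<Longrightarrow> norm (G x1 - G x2) \<le> D * dist x1 x2"
        using near[of l] by blast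
      have "eventually (\<lambda>n. dist (x (s n)) l < r / 2) sequentially" using convergent(2) r by (intro tendstoD) auto
      moreover have "(\<lambda>n. dist (x (s n)) (y (s n))) \<longlonglongrightarrow> 0"
        using LIMSEQ_subseq_LIMSEQ[OF d0 convergent(1)] by (simp add: comp_def)
      then have "eventually (\<lambda>n. dist (x (s n)) (y (s n)) < r / 2) sequentially"
        using r by (intro order_tendstoD(2)) auto
      ultimately have "eventually (\<lambda>n. False) sequentially" using eventually_le_real_subseq[OF convergent(1), of D]
      proof eventually_elim
        case (elim n)
        have "dist (y (s n)) l \<le> r" "dist (x (s n)) l \<le> r"
          using elim(1,2) dist_triangle3[of "y (s n)" l "x (s n)"] r by simp_all
        then have "norm (G (x (s n)) - G (y (s n))) \<le> D * dist (x (s n)) (y (s n))" using D by blast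
        also have "\<dots> \<le> real (s n) * dist (x (s n)) (y (s n))" using elim(3) by (intro mult_right_mono) auto
        finally show False using xy[of "s n"] by linarith
      qed
      then show False by simp
    next
      case (separated s)
      have "bounded (range (\<lambda>n. f (x (s n))))"
        by (rule bounded_subset[OF bounded_range_Lip[OF bdd f]]) auto
      from lip_sepD[OF ls separated(2) this C(1)] obtain r D where r: "r > 0"
        and D: "\<forall>n p' u'. norm (u' - f (x (s n))) \<le> C * dist p' (x (s n)) \<and>
          dist p' (x (s n)) \<le> r \<longrightarrow> norm (\<Theta> p' u' - \<Theta> (x (s n)) (f (x (s n)))) \<le> D * dist p' (x (s n))"
        by blast
      have "(\<lambda>n. dist (x (s n)) (y (s n))) \<longlonglongrightarrow> 0"
        using LIMSEQ_subseq_LIMSEQ[OF d0 separated(1)] by (simp add: comp_def)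
      then have "eventually (\<lambda>n. dist (x (s n)) (y (s n)) < r) sequentially"
        using r by (intro order_tendstoD(2)) auto
      then have "eventually (\<lambda>n. False) sequentially" using eventually_le_real_subseq[OF separated(1), of D]
      proof eventually_elim
        case (elim n)
        have "norm (G (x (s n)) - G (y (s n))) \<le> D * dist (x (s n)) (y (s n))"
          using D[rule_format, of "f (y (s n))" n "y (s n)"] C(2) elim(1)
          by (simp add: G_def dist_commute norm_minus_commute)
        also have "\<dots> \<le> real (s n) * dist (x (s n)) (y (s n))" using elim(2) by (intro mult_right_mono) auto
        finally show False using xy[of "s n"] by linarith
      qed
      then show False by simp
    qed
  qed
  then show ?thesis by (simp add: Lip_iff G_def)
qed

section \<open>The point map of a biseparating map\<close>

lemma perp_iff: "perp h f g \<longleftrightarrow> (\<forall>x. f x = h x \<or> g x = h x)"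
  for f g h :: "'a \<Rightarrow> 'e::real_normed_vector"
  by (auto simp: perp_def cozero_def)

definition determined :: "(('a::metric_space \<Rightarrow> 'e::metric_space) \<Rightarrow> 'b \<Rightarrow> 'f) \<Rightarrow> 'a set \<Rightarrow> 'b set" where
  "determined T U = {y. \<forall>f\<in>Lip. \<forall>g\<in>Lip. (\<forall>x\<in>U. f x = g x) \<longrightarrow> T f y = T g y}"

lemma determinedD:
  "y \<in> determined T U \<Longrightarrow> f \<in> Lip \<Longrightarrow> g \<in> Lip \<Longrightarrow> (\<And>x. x \<in> U \<Longrightarrow> f x = g x) \<Longrightarrow> T f y = T g y"
  unfolding determined_def mem_Collect_eq by blast

lemma determined_mono: "U \<subseteq> U' \<Longrightarrow> determined T U \<subseteq> determined T U'"
  unfolding determined_def by blast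

text \<open>
The interior is taken before the closure so that the swap of \<open>T\<close> with its inverse, which works with
open sets, is available; \<open>y\<close> itself need not be an interior point.
\<close>

definition corresp :: "(('a::metric_space \<Rightarrow> 'e::metric_space) \<Rightarrow> 'b::metric_space \<Rightarrow> 'f) \<Rightarrow> 'a \<Rightarrow> 'b \<Rightarrow> bool" where
  "corresp T x y \<longleftrightarrow> (\<forall>d>0. y \<in> closure (interior (determined T (ball x d))))"

text \<open>
The map and its inverse enter symmetrically, so each result about \<open>T\<close> may be read for \<open>S\<close>.
\<close>

locale biseparating_pair =
  fixes T :: "('a::complete_space \<Rightarrow> 'e::real_normed_vector) \<Rightarrow> ('b::complete_space \<Rightarrow> 'f::real_normed_vector)"
    and S :: "('b \<Rightarrow> 'f) \<Rightarrow> ('a \<Rightarrow> 'e)"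
  assumes bounded_X: "bounded (UNIV :: 'a set)" and bounded_Y: "bounded (UNIV :: 'b set)"
    and nontrivial_E: "\<exists>u::'e. u \<noteq> 0" and nontrivial_F: "\<exists>v::'f. v \<noteq> 0"
    and T_Lip: "\<And>f. f \<in> Lip \<Longrightarrow> T f \<in> Lip" and S_Lip: "\<And>g. g \<in> Lip \<Longrightarrow> S g \<in> Lip"
    and S_T: "\<And>f. f \<in> Lip \<Longrightarrow> S (T f) = f" and T_S: "\<And>g. g \<in> Lip \<Longrightarrow> T (S g) = g"
    and perp_T: "\<And>f g h. f \<in> Lip \<Longrightarrow> g \<in> Lip \<Longrightarrow> h \<in> Lip \<Longrightarrow> perp (T h) (T f) (T g) \<longleftrightarrow> perp h f g"

lemma biseparating_pair_swap:
  fixes T :: "('a::complete_space \<Rightarrow> 'e::real_normed_vector) \<Rightarrow> ('b::complete_space \<Rightarrow> 'f::real_normed_vector)"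
  assumes "biseparating_pair T S"
  shows "biseparating_pair S T"
proof -
  from assms interpret biseparating_pair T S .
  show ?thesis
  proof
    fix f g h :: "'b \<Rightarrow> 'f" assume "f \<in> Lip" "g \<in> Lip" "h \<in> Lip"
    then show "perp (S h) (S f) (S g) \<longleftrightarrow> perp h f g"
      using perp_T[OF S_Lip S_Lip S_Lip, of f g h] by (simp add: T_S)
  qed (use bounded_X bounded_Y nontrivial_E nontrivial_F T_Lip S_Lip S_T T_S in auto)
qed

context biseparating_pair
begin

lemma T_perpD:
  assumes "f \<in> Lip" "g \<in> Lip" "h \<in> Lip" "\<And>x. f x = h x \<or> g x = h x"
  shows "T f y = T h y \<or> T g y = T h y"
  using perp_T[OF assms(1-3)] assms(4) by (auto simp: perp_iff)

text \<open>
Where \<open>T\<close> notices that \<open>k\<close> has been added depends only on the behaviour of the function on the cozero set of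
\<open>k\<close>. For if \<open>T (h + k)\<close> differs from \<open>T h\<close> at \<open>y\<close>, then separation relative to \<open>h\<close> gives \<open>T f y = T h y\<close>, and
separation relative to \<open>h + k\<close> gives \<open>T (f + k) y = T (h + k) y\<close>.
\<close>

lemma T_shift:
  assumes L: "f \<in> Lip" "h \<in> Lip" "k \<in> Lip" and eq: "\<And>x. k x \<noteq> 0 \<Longrightarrow> f x = h x"
    and neq: "T (\<lambda>x. h x + k x) y \<noteq> T h y"
  shows "T (\<lambda>x. f x + k x) y \<noteq> T f y"
proof -
  note L' = Lip_add[OF L(1,3)] Lip_add[OF L(2,3)]
  have "T f y = T h y \<or> T (\<lambda>x. h x + k x) y = T h y"
    by (rule T_perpD[OF L(1) L'(2) L(2)]) (use eq in auto)
  moreover have "T (\<lambda>x. f x + k x) y = T (\<lambda>x. h x + k x) y \<or> T h y = T (\<lambda>x. h x + k x) y"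
    by (rule T_perpD[OF L'(1) L(2) L'(2)]) (use eq in auto)
  ultimately show ?thesis using neq by auto
qed

lemma closed_eq_set: "f \<in> Lip \<Longrightarrow> g \<in> Lip \<Longrightarrow> closed {y. T f y = T g y}"
  using T_Lip by (intro closed_Collect_eq Lip_continuous_on)

lemma closed_determined: "closed (determined T U)"
proof -
  have "determined T U = (\<Inter>f\<in>Lip. \<Inter>g\<in>{g\<in>Lip. \<forall>x\<in>U. f x = g x}. {y. T f y = T g y})"
    by (auto simp: determined_def)
  then show ?thesis using closed_eq_set by (simp add: closed_INT)
qed

text \<open>
Take a ball \<open>B\<close> well inside \<open>U\<close> and \<open>k\<close> with cozero set \<open>B\<close>, and let \<open>V\<close> be the open set where \<open>T k\<close> differs from
\<open>T 0\<close>. If \<open>f\<close> and \<open>g\<close> agree on \<open>U\<close>, then \<open>T f\<close> and \<open>T g\<close> agree wherever adding to \<open>f\<close> a function with cozero set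
\<open>U\<close> is noticed, so it suffices that these points are dense in \<open>V\<close>, whatever \<open>f\<close> is. Otherwise \<open>T f\<close> could be
altered on an open part \<open>W\<close> of \<open>V\<close> without altering \<open>f\<close> on \<open>U\<close>. Passing to a function \<open>q\<close> that equals \<open>f\<close> off
\<open>U\<close> and \<open>0\<close> on \<open>B\<close>, this alteration and \<open>k\<close> have disjoint cozero sets while both are noticed on \<open>W\<close>,
contradicting separation.
\<close>

lemma interior_determined_nonempty:
  assumes U: "open U" "U \<noteq> {}"
  shows "interior (determined T U) \<noteq> {}"
proof -
  obtain u :: 'e where u: "u \<noteq> 0" using nontrivial_E by blast
  obtain v :: 'f where v: "v \<noteq> 0" using nontrivial_F by blast
  obtain z e where "e > 0" "ball z e \<subseteq> U" using U open_contains_ball by blast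
  define r where "r = e / 2"
  have r: "r > 0" "ball z (2 * r) \<subseteq> U" using \<open>e > 0\<close> \<open>ball z e \<subseteq> U\<close> by (auto simp: r_def)
  have far: "far (- U) (ball z r)"
    unfolding far_def
  proof (intro exI[of _ r] conjI ballI)
    fix a b assume "a \<in> - U" "b \<in> ball z r"
    then have "2 * r \<le> dist z a" "dist z b < r" using r by (auto simp: not_less[symmetric])
    then show "r \<le> dist a b" using dist_triangle[of z a b] by (simp add: dist_commute)
  qed (use r in auto)
  obtain k :: "'a \<Rightarrow> 'e" where k: "k \<in> Lip" "cozero k = ball z r"
    using open_eq_cozero_Lip[OF open_ball u] by blast
  obtain k2 :: "'a \<Rightarrow> 'e" where k2: "k2 \<in> Lip" "cozero k2 = U"
    using open_eq_cozero_Lip[OF U(1) u] by blast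
  let ?zero = "\<lambda>x::'a. 0::'e"
  define V where "V = cozero (\<lambda>y. T k y - T ?zero y)"
  have "open V" unfolding V_def
    using k by (intro open_cozero Lip_continuous_on Lip_diff T_Lip) auto
  have "k z \<noteq> 0" using k(2) r by (auto simp: cozero_def)
  then have "k \<noteq> ?zero" by auto
  then have "T k \<noteq> T ?zero" using S_T[OF k(1)] S_T[OF Lip_const, of 0] by metis
  then obtain y0 where "T k y0 \<noteq> T ?zero y0" by (auto simp only: fun_eq_iff)
  then have "y0 \<in> V" by (simp add: V_def cozero_def)
  then have "V \<noteq> {}" by blast
  have "V \<subseteq> closure (cozero (\<lambda>y. T (\<lambda>x. f x + k2 x) y - T f y))" (is "_ \<subseteq> closure ?C") if f: "f \<in> Lip" for f
  proof (rule ccontr)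
    assume "\<not> V \<subseteq> closure ?C"
    then obtain y where y: "y \<in> V" "y \<notin> closure ?C" by blast
    have "open (V - closure ?C)" using \<open>open V\<close> by auto
    then obtain w :: "'b \<Rightarrow> 'f" where w: "w \<in> Lip" "cozero w = V - closure ?C"
      using open_eq_cozero_Lip[OF _ v] by blast
    \<comment> \<open>The alteration of \<open>T f\<close> on \<open>W\<close>, and the function \<open>g\<close> that produces it.\<close>
    define g where "g = S (\<lambda>y. T f y + w y)"
    have g: "g \<in> Lip" "\<And>y. T g y = T f y + w y"
      unfolding g_def using T_S[OF Lip_add[OF T_Lip[OF f] w(1)]] S_Lip[OF Lip_add[OF T_Lip[OF f] w(1)]]
      by auto
    note fk2 = Lip_add[OF f k2(1)]
    have "w y = 0 \<or> T (\<lambda>x. f x + k2 x) y = T f y" for y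
      using w(2) closure_subset[of ?C] by (auto simp: cozero_def)
    then have "perp (T f) (T g) (T (\<lambda>x. f x + k2 x))" by (auto simp: perp_iff g(2))
    then have "perp f g (\<lambda>x. f x + k2 x)" using perp_T[OF g(1) fk2 f] by simp
    then have gU: "g x = f x" if "x \<in> U" for x using that k2(2) by (auto simp: perp_iff cozero_def)
    obtain q where q: "q \<in> Lip" "\<forall>x\<in>- U. q x = f x" "\<forall>x\<in>ball z r. q x = 0"
      using Lip_glue_far[OF bounded_X f Lip_const far] by blast
    define d where "d x = g x - f x" for x
    have d: "d \<in> Lip" unfolding d_def using g(1) f by (intro Lip_diff)
    have dU: "d x \<noteq> 0 \<Longrightarrow> x \<notin> U" for x using gU by (auto simp: d_def)
    have kb: "k x \<noteq> 0 \<Longrightarrow> x \<in> ball z r" for x using k(2) by (auto simp: cozero_def)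
    have "T (\<lambda>x. f x + d x) y \<noteq> T f y"
      using y w(2) g(2)[of y] by (auto simp: d_def cozero_def)
    then have 1: "T (\<lambda>x. q x + d x) y \<noteq> T q y"
      by (intro T_shift[OF q(1) f d]) (use q(2) dU in auto)
    have "T (\<lambda>x. ?zero x + k x) y \<noteq> T ?zero y" using y by (auto simp: V_def cozero_def)
    then have 2: "T (\<lambda>x. q x + k x) y \<noteq> T q y"
      by (intro T_shift[OF q(1) Lip_const k(1)]) (use q(3) kb in auto)
    have "T (\<lambda>x. q x + d x) y = T q y \<or> T (\<lambda>x. q x + k x) y = T q y"
    proof (rule T_perpD[OF Lip_add[OF q(1) d] Lip_add[OF q(1) k(1)] q(1)])
      fix x
      have "ball z r \<subseteq> U" using r by (force simp: subset_iff)
      then have "d x = 0 \<or> k x = 0" using dU[of x] kb[of x] by blast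
      then show "q x + d x = q x \<or> q x + k x = q x" by auto
    qed
    with 1 2 show False by auto
  qed note V = this
  have "V \<subseteq> determined T U"
    unfolding determined_def
  proof (intro subsetI CollectI ballI impI)
    fix y and f g :: "'a \<Rightarrow> 'e" assume y: "y \<in> V" and f: "f \<in> Lip" and g: "g \<in> Lip" and eq: "\<forall>x\<in>U. f x = g x"
    have "cozero (\<lambda>y. T (\<lambda>x. f x + k2 x) y - T f y) \<subseteq> {y. T f y = T g y}"
    proof
      fix y assume "y \<in> cozero (\<lambda>y. T (\<lambda>x. f x + k2 x) y - T f y)"
      moreover have "T g y = T f y \<or> T (\<lambda>x. f x + k2 x) y = T f y"
        by (rule T_perpD[OF g Lip_add[OF f k2(1)] f]) (use eq k2(2) in \<open>auto simp: cozero_def\<close>)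
      ultimately show "y \<in> {y. T f y = T g y}" by (auto simp: cozero_def)
    qed
    then have "closure (cozero (\<lambda>y. T (\<lambda>x. f x + k2 x) y - T f y)) \<subseteq> {y. T f y = T g y}"
      by (rule closure_minimal[OF _ closed_eq_set[OF f g]])
    then show "T f y = T g y" using V[OF f] y by blast
  qed
  then show ?thesis using \<open>open V\<close> \<open>V \<noteq> {}\<close> interior_maximal by blast
qed

text \<open>
Any two Lipschitz functions can be glued along sets at positive distance. Choosing those that \<open>T\<close> sends
to two distinct constants, the Lipschitz function \<open>T h\<close> takes two distinct constant values on the two
determined sets.
\<close>

lemma far_determined:
  assumes "far U U'"
  shows "far (determined T U) (determined T U')"
proof -
  obtain v :: 'f where v: "v \<noteq> 0" using nontrivial_F by blast
  obtain h where h: "h \<in> Lip" "\<forall>x\<in>U. h x = S (\<lambda>y. 0) x" "\<forall>x\<in>U'. h x = S (\<lambda>y. v) x"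
    using Lip_glue_far[OF bounded_X S_Lip[OF Lip_const] S_Lip[OF Lip_const] assms] by blast
  obtain L where L: "\<And>y y'. norm (T h y - T h y') \<le> L * dist y y'"
    using T_Lip[OF h(1)] unfolding Lip_iff by blast
  define M where "M = \<bar>L\<bar> + 1"
  have "norm v / M \<le> dist y y'" if y: "y \<in> determined T U" "y' \<in> determined T U'" for y y'
  proof -
    have "T h y = T (S (\<lambda>y. 0)) y"
      using determinedD[OF y(1) h(1) S_Lip[OF Lip_const]] h(2) by blast
    moreover have "T h y' = T (S (\<lambda>y. v)) y'"
      using determinedD[OF y(2) h(1) S_Lip[OF Lip_const]] h(3) by blast
    ultimately have "norm v \<le> L * dist y y'"
      using L[of y y'] by (simp add: T_S)
    also have "\<dots> \<le> M * dist y y'" by (intro mult_right_mono) (auto simp: M_def)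
    finally show ?thesis by (simp add: M_def divide_le_eq mult.commute)
  qed
  moreover have "norm v / M > 0" using v by (simp add: M_def)
  ultimately show ?thesis unfolding far_def by blast
qed

text \<open>
A point of \<open>determined S W\<close> outside the closure of \<open>U\<close> has a small ball \<open>G\<close> far from \<open>U\<close> in this set. What \<open>G\<close>
determines lies in the closure of \<open>W\<close>, hence of what \<open>U\<close> determines, although the two must be far apart.
\<close>

lemma determined_back:
  assumes W: "open W" "W \<noteq> {}" "W \<subseteq> determined T U"
  shows "interior (determined S W) \<subseteq> closure U"
proof (rule ccontr)
  assume "\<not> ?thesis"
  then obtain z where "z \<in> interior (determined S W) - closure U" by blast
  moreover have "open (interior (determined S W) - closure U)" by auto
  ultimately obtain e where e: "e > 0" "ball z e \<subseteq> interior (determined S W) - closure U"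
    by (metis open_contains_ball)
  let ?G = "ball z (e / 2)"
  have "far ?G U"
    unfolding far_def
  proof (intro exI[of _ "e / 2"] conjI ballI)
    fix a b assume a: "a \<in> ?G" and b: "b \<in> U"
    have "b \<notin> ball z e" using b e(2) closure_subset[of U] by blast
    then show "e / 2 \<le> dist a b" using a dist_triangle[of z b a] by simp
  qed (use e in simp)
  then obtain \<delta> where \<delta>: "\<delta> > 0" "\<And>a b. a \<in> determined T ?G \<Longrightarrow> b \<in> determined T U \<Longrightarrow> \<delta> \<le> dist a b"
    using far_determined[of ?G U] by (auto simp: far_def)
  have "interior (determined T ?G) \<noteq> {}"
    using e(1) by (intro interior_determined_nonempty) auto
  then obtain y where y: "y \<in> determined T ?G" using interior_subset by blast
  have "y \<in> closure W"
  proof (rule ccontr)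
    assume "y \<notin> closure W"
    obtain v :: 'f where v: "v \<noteq> 0" using nontrivial_F by blast
    obtain w :: "'b \<Rightarrow> 'f" where w: "w \<in> Lip" "cozero w = - closure W"
      using open_eq_cozero_Lip[OF _ v, of "- closure W"] by auto
    have "w x = 0" if "x \<in> W" for x
      using that w(2) closure_subset[of W] by (auto simp: cozero_def)
    then have "S w x = S (\<lambda>y. 0) x" if "x \<in> ?G" for x
      using e that interior_subset[of "determined S W"]
      by (intro determinedD[of x S W]) (auto simp: w(1) subset_iff)
    then have "T (S w) y = T (S (\<lambda>y. 0)) y"
      using y by (intro determinedD[of y T ?G] S_Lip w) auto
    then have "w y = 0" by (simp add: T_S w(1))
    then show False using w(2) \<open>y \<notin> closure W\<close> by (auto simp: cozero_def)
  qed
  then obtain y' where "y' \<in> W" "dist y' y < \<delta>" using \<delta>(1) by (auto simp: closure_approachable)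
  then show False using \<delta>(2)[OF y, of y'] W(3) by (auto simp: dist_commute)
qed

lemma corresp_determined:
  assumes "corresp T x y" "0 < d" "ball x d \<subseteq> U"
  shows "y \<in> determined T U"
proof -
  have "y \<in> closure (interior (determined T (ball x d)))" using assms by (simp add: corresp_def)
  also have "\<dots> \<subseteq> determined T (ball x d)"
    by (intro closure_minimal interior_subset closed_determined)
  also have "\<dots> \<subseteq> determined T U" using assms by (intro determined_mono)
  finally show ?thesis .
qed

end

lemma corresp_swap:
  assumes "biseparating_pair T S" "corresp T x y"
  shows "corresp S y x"
  unfolding corresp_def
proof (intro allI impI)
  interpret biseparating_pair T S by fact
  interpret swap: biseparating_pair S T by (rule biseparating_pair_swap) fact
  fix d :: real assume d: "d > 0"
  show "x \<in> closure (interior (determined S (ball y d)))"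
    unfolding closure_approachable
  proof (intro allI impI)
    fix e :: real assume e: "e > 0"
    let ?Q = "interior (determined T (ball x (e / 2)))"
    define W where "W = ?Q \<inter> ball y d"
    have "y \<in> closure ?Q" using assms(2) e by (simp add: corresp_def)
    then obtain w where "w \<in> ?Q" "dist w y < d" using d by (auto simp: closure_approachable)
    then have W: "open W" "W \<noteq> {}" "W \<subseteq> determined T (ball x (e / 2))"
      using interior_subset by (auto simp: W_def dist_commute)
    then obtain z where z: "z \<in> interior (determined S W)"
      using swap.interior_determined_nonempty by blast
    have "z \<in> closure (ball x (e / 2))" using determined_back[OF W] z by blast
    also have "\<dots> \<subseteq> cball x (e / 2)" by (simp add: closure_minimal ball_subset_cball)
    finally have "dist z x < e" using e by (simp add: dist_commute)
    moreover have "z \<in> interior (determined S (ball y d))"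
      using z interior_mono[OF determined_mono[of W "ball y d" S]] by (auto simp: W_def)
    ultimately show "\<exists>z\<in>interior (determined S (ball y d)). dist z x < e" by blast
  qed
qed

text \<open>
If \<open>y\<close> and \<open>y'\<close> had positive distance, small balls around them would be far apart, but both
determine \<open>x\<close>.
\<close>

lemma corresp_unique:
  assumes bp: "biseparating_pair T S" and xy: "corresp T x y" "corresp T x y'"
  shows "y = y'"
proof (rule ccontr)
  interpret swap: biseparating_pair S T by (rule biseparating_pair_swap) fact
  assume "y \<noteq> y'"
  define d where "d = dist y y' / 4"
  have d: "d > 0" using \<open>y \<noteq> y'\<close> by (simp add: d_def)
  have "far (ball y d) (ball y' d)"
    unfolding far_def
  proof (intro exI[of _ d] conjI ballI)
    fix a b assume "a \<in> ball y d" "b \<in> ball y' d"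
    then show "d \<le> dist a b"
      using zero_le_dist[of y y'] dist_triangle[of y y' a] dist_triangle[of a y' b]
      unfolding d_def mem_ball by (simp only: dist_commute)
  qed (rule d)
  then obtain \<delta> where \<delta>: "\<delta> > 0"
    "\<And>a b. a \<in> determined S (ball y d) \<Longrightarrow> b \<in> determined S (ball y' d) \<Longrightarrow> \<delta> \<le> dist a b"
    using swap.far_determined[of "ball y d" "ball y' d"] by (auto simp: far_def)
  have "x \<in> determined S (ball y d)" "x \<in> determined S (ball y' d)"
    using swap.corresp_determined[OF corresp_swap[OF bp] d] xy by auto
  from \<delta>(2)[OF this] \<delta>(1) show False by simp
qed

text \<open>
Otherwise the open sets determined by the balls around \<open>x\<close> contain pairs at distance \<open>\<epsilon>\<close>. After
Efremovich's lemma the two halves of these pairs, thickened to open sets, are far apart; what they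
determine is then far apart too, although both parts come arbitrarily close to \<open>x\<close>.
\<close>

lemma determined_ball_small:
  fixes T :: "('a::complete_space \<Rightarrow> 'e::real_normed_vector) \<Rightarrow> ('b::complete_space \<Rightarrow> 'f::real_normed_vector)"
  assumes bp: "biseparating_pair T S" and \<epsilon>: "\<epsilon> > 0"
  shows "\<exists>d>0. \<forall>y\<in>interior (determined T (ball x d)). \<forall>z\<in>interior (determined T (ball x d)). dist y z < \<epsilon>"
proof (rule ccontr)
  interpret biseparating_pair T S by fact
  interpret swap: biseparating_pair S T by (rule biseparating_pair_swap) fact
  assume *: "\<not> ?thesis"
  define Q where "Q n = interior (determined T (ball x (inverse (real (Suc n)))))" for n
  have "\<forall>n. \<exists>y z. y \<in> Q n \<and> z \<in> Q n \<and> \<epsilon> \<le> dist y z"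
  proof
    fix n
    have "inverse (real (Suc n)) > 0" by simp
    then show "\<exists>y z. y \<in> Q n \<and> z \<in> Q n \<and> \<epsilon> \<le> dist y z"
      using * unfolding Q_def by (meson not_le)
  qed
  then obtain y z where yz: "\<And>n. y n \<in> Q n" "\<And>n. z n \<in> Q n" "\<And>n. \<epsilon> \<le> dist (y n) (z n)" by metis
  obtain r :: "nat \<Rightarrow> nat" where r: "strict_mono r" "\<And>i j. \<epsilon> / 4 \<le> dist (y (r i)) (z (r j))"
    using far_subseq[of \<epsilon> y z, OF \<epsilon> yz(3)] by blast
  define A where "A p = (\<Union>i. ball (p (r i)) (\<epsilon> / 16) \<inter> Q (r i))" for p :: "nat \<Rightarrow> 'b"
  have "far (A y) (A z)"
    unfolding far_def
  proof (intro exI[of _ "\<epsilon> / 8"] conjI ballI)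
    fix a b assume "a \<in> A y" "b \<in> A z"
    then obtain i j where ij: "dist (y (r i)) a < \<epsilon> / 16" "dist (z (r j)) b < \<epsilon> / 16" by (auto simp: A_def)
    then show "\<epsilon> / 8 \<le> dist a b"
      using r(2)[of i j] dist_triangle[of "y (r i)" "z (r j)" a] dist_triangle[of a "z (r j)" b]
      by (simp add: dist_commute)
  qed (use \<epsilon> in simp)
  then have "far (determined S (A y)) (determined S (A z))" by (rule swap.far_determined)
  then obtain \<delta> where \<delta>: "\<delta> > 0" "\<And>a b. a \<in> determined S (A y) \<Longrightarrow> b \<in> determined S (A z) \<Longrightarrow> \<delta> \<le> dist a b"
    by (auto simp: far_def)
  obtain n :: nat where n: "inverse (real (Suc n)) < \<delta> / 2"
    using reals_Archimedean[of "\<delta> / 2"] \<delta>(1) by auto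
  have near: "\<exists>a\<in>determined S (A p). dist x a < \<delta> / 2" if p: "\<And>n. p n \<in> Q n" for p
  proof -
    define W where "W = ball (p (r n)) (\<epsilon> / 16) \<inter> Q (r n)"
    have "p (r n) \<in> W" using p[of "r n"] \<epsilon> by (simp add: W_def)
    then have "W \<noteq> {}" by blast
    moreover have "open W" "W \<subseteq> determined T (ball x (inverse (real (Suc (r n)))))"
      using interior_subset unfolding W_def Q_def by auto
    ultimately have W: "open W" "W \<noteq> {}" "W \<subseteq> determined T (ball x (inverse (real (Suc (r n)))))"
      by auto
    then obtain a where a: "a \<in> interior (determined S W)"
      using swap.interior_determined_nonempty by blast
    have "a \<in> closure (ball x (inverse (real (Suc (r n)))))" using determined_back[OF W] a by blast
    also have "\<dots> \<subseteq> cball x (inverse (real (Suc (r n))))" by (simp add: closure_minimal ball_subset_cball)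
    finally have "dist x a \<le> inverse (real (Suc (r n)))" by simp
    also have "\<dots> \<le> inverse (real (Suc n))" using seq_suble[OF r(1), of n] by (intro le_imp_inverse_le) auto
    finally have "dist x a < \<delta> / 2" using n by simp
    moreover have "a \<in> determined S (A p)"
      using a interior_subset determined_mono[of W "A p" S] by (auto simp: W_def A_def)
    ultimately show ?thesis by blast
  qed
  obtain a b where "a \<in> determined S (A y)" "dist x a < \<delta> / 2" "b \<in> determined S (A z)" "dist x b < \<delta> / 2"
    using near[OF yz(1)] near[OF yz(2)] by blast
  then show False using \<delta>(2)[of a b] dist_triangle3[of a b x] by simp
qed

lemma determined_ball_small_closure:
  assumes bp: "biseparating_pair T S" and \<epsilon>: "\<epsilon> > 0"
  shows "\<exists>d>0. \<forall>y\<in>closure (interior (determined T (ball x d))).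
    \<forall>z\<in>closure (interior (determined T (ball x d))). dist y z < \<epsilon>"
proof -
  obtain d where d: "d > 0" "\<And>y z. y \<in> interior (determined T (ball x d)) \<Longrightarrow>
      z \<in> interior (determined T (ball x d)) \<Longrightarrow> dist y z < \<epsilon> / 2"
    using determined_ball_small[OF bp, of "\<epsilon> / 2" x] \<epsilon> by auto
  have "dist y z < \<epsilon>" if yz: "y \<in> closure (interior (determined T (ball x d)))"
    "z \<in> closure (interior (determined T (ball x d)))" for y z
  proof -
    have "\<epsilon> / 4 > 0" using \<epsilon> by simp
    then obtain y' z' where "y' \<in> interior (determined T (ball x d))" "dist y' y < \<epsilon> / 4"
      "z' \<in> interior (determined T (ball x d))" "dist z' z < \<epsilon> / 4"
      using yz unfolding closure_approachable by meson
    then show ?thesis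
      using d(2)[of y' z'] dist_triangle[of y z y'] dist_triangle[of y' z z'] by (simp add: dist_commute)
  qed
  with d(1) show ?thesis by blast
qed

text \<open>
Completeness of the target enters here, through the nested closed sets determined by shrinking balls.
\<close>

lemma corresp_exists:
  fixes T :: "('a::complete_space \<Rightarrow> 'e::real_normed_vector) \<Rightarrow> ('b::complete_space \<Rightarrow> 'f::real_normed_vector)"
  assumes bp: "biseparating_pair T S"
  shows "\<exists>y. corresp T x y"
proof -
  interpret biseparating_pair T S by fact
  define Q where "Q d = closure (interior (determined T (ball x d)))" for d
  have mono: "Q d \<subseteq> Q d'" if "d \<le> d'" for d d'
    unfolding Q_def using that by (intro closure_mono interior_mono determined_mono subset_ball)
  have inv: "\<exists>n. inverse (real (Suc n)) < d" if "d > 0" for d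
    using reals_Archimedean[OF that] by auto
  obtain a where a: "\<And>n. a \<in> Q (inverse (real (Suc n)))"
  proof (rule decreasing_closed_nest[of "\<lambda>n. Q (inverse (real (Suc n)))"])
    show "Q (inverse (real (Suc n))) \<noteq> {}" for n
      unfolding Q_def using interior_determined_nonempty[of "ball x (inverse (real (Suc n)))"]
      by (simp add: closure_eq_empty)
    show "Q (inverse (real (Suc n))) \<subseteq> Q (inverse (real (Suc m)))" if "m \<le> n" for m n
      using that by (intro mono le_imp_inverse_le) auto
    show "\<exists>n. \<forall>y\<in>Q (inverse (real (Suc n))). \<forall>z\<in>Q (inverse (real (Suc n))). dist y z < e" if "0 < e" for e
    proof -
      obtain d where d: "d > 0" "\<forall>y\<in>Q d. \<forall>z\<in>Q d. dist y z < e"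
        using determined_ball_small_closure[OF bp \<open>0 < e\<close>, of x] unfolding Q_def by blast
      obtain n where "inverse (real (Suc n)) < d" using inv[OF d(1)] by blast
      then have "Q (inverse (real (Suc n))) \<subseteq> Q d" by (intro mono) simp
      then show ?thesis using d(2) by blast
    qed
  qed (auto simp: Q_def)
  have "a \<in> Q d" if "0 < d" for d
  proof -
    obtain n where "inverse (real (Suc n)) < d" using inv[OF \<open>0 < d\<close>] by blast
    then have "Q (inverse (real (Suc n))) \<subseteq> Q d" by (intro mono) simp
    then show ?thesis using a by blast
  qed
  then have "corresp T x a" unfolding corresp_def Q_def by blast
  then show ?thesis by blast
qed

lemma corresp_continuous:
  assumes bp: "biseparating_pair T S" and \<phi>: "\<And>x. corresp T x (\<phi> x)"
  shows "continuous_on UNIV \<phi>"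
  unfolding continuous_on_iff
proof (intro ballI allI impI)
  fix x and e :: real assume e: "0 < e"
  obtain d where d: "d > 0" "\<forall>y\<in>closure (interior (determined T (ball x d))).
      \<forall>z\<in>closure (interior (determined T (ball x d))). dist y z < e"
    using determined_ball_small_closure[OF bp e] by blast
  have "dist (\<phi> x') (\<phi> x) < e" if "dist x' x < d / 2" for x'
  proof -
    have "ball x' (d / 2) \<subseteq> ball x d"
    proof
      fix z assume "z \<in> ball x' (d / 2)"
      then show "z \<in> ball x d" using that dist_triangle[of x z x'] by (simp add: dist_commute)
    qed
    then have "closure (interior (determined T (ball x' (d / 2)))) \<subseteq> closure (interior (determined T (ball x d)))"
      by (intro closure_mono interior_mono determined_mono)
    moreover have "\<phi> x' \<in> closure (interior (determined T (ball x' (d / 2))))"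
      "\<phi> x \<in> closure (interior (determined T (ball x d)))"
      using \<phi> d(1) by (auto simp: corresp_def)
    ultimately show ?thesis using d(2) by blast
  qed
  then show "\<exists>d>0. \<forall>x'\<in>UNIV. dist x' x < d \<longrightarrow> dist (\<phi> x') (\<phi> x) < e"
    using d(1) by (intro exI[of _ "d / 2"]) auto
qed

text \<open>
At an isolated point this is locality. Otherwise take balls around points \<open>z n\<close> that converge to \<open>x\<close>
geometrically, with radii proportional to the distance from \<open>x\<close>. As \<open>f x = g x\<close>, a Lipschitz function \<open>h\<close> can
equal \<open>f\<close> on the balls with even index and \<open>g\<close> on those with odd index; by continuity at \<open>\<phi> x\<close>, \<open>T h\<close> agrees
there with both \<open>T f\<close> and \<open>T g\<close>.
\<close>

lemma pointwise_determined:
  fixes T :: "('a::complete_space \<Rightarrow> 'e::real_normed_vector) \<Rightarrow> ('b::complete_space \<Rightarrow> 'f::real_normed_vector)"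
  assumes bp: "biseparating_pair T S" and \<phi>: "\<And>x. corresp T x (\<phi> x)"
    and f: "f \<in> Lip" and g: "g \<in> Lip" and eq: "f x = g x"
  shows "T f (\<phi> x) = T g (\<phi> x)"
proof (cases "x islimpt UNIV")
  case False
  interpret biseparating_pair T S by fact
  obtain d where d: "d > 0" "\<forall>x'. x' = x \<or> \<not> dist x' x < d"
    using False unfolding islimpt_approachable by auto
  then have d: "d > 0" "ball x d \<subseteq> {x}" by (auto simp: dist_commute)
  have "\<phi> x \<in> determined T {x}" by (rule corresp_determined[OF \<phi> d])
  then show ?thesis using eq by (auto intro: determinedD[OF _ f g])
next
  case True
  interpret biseparating_pair T S by fact
  have ex: "\<exists>z. z \<noteq> x \<and> dist z x < e" if "e > 0" for e
    using True that unfolding islimpt_approachable by auto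
  have "\<exists>z. \<forall>n. z n \<noteq> x \<and> dist (z (Suc n)) x < dist (z n) x / 4"
  proof (rule dependent_nat_choice)
    show "\<exists>z. z \<noteq> x" using ex[of 1] by auto
    fix z :: 'a and n :: nat
    assume "z \<noteq> x"
    then show "\<exists>z'. z' \<noteq> x \<and> dist z' x < dist z x / 4" using ex[of "dist z x / 4"] by simp
  qed
  then obtain z where z: "\<And>n. z n \<noteq> x" "\<And>n. dist (z (Suc n)) x < dist (z n) x / 4" by blast
  define \<rho> where "\<rho> n = dist (z n) x" for n
  have \<rho>: "\<rho> n > 0" "\<rho> (Suc n) < \<rho> n / 4" for n using z by (auto simp: \<rho>_def)
  have dec: "\<rho> (Suc n) \<le> \<rho> n" for n using \<rho>[of n] by simp
  have lt: "\<rho> m \<le> \<rho> n / 4" if "n < m" for n m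
    using \<rho>(2)[of n] lift_Suc_antimono_le[of \<rho>, OF dec, of "Suc n" m] that by simp
  have "\<rho> n \<le> \<rho> 0 * (1 / 4) ^ n" for n
  proof (induction n)
    case (Suc n)
    have "\<rho> (Suc n) \<le> \<rho> n / 4" using \<rho>(2)[of n] by simp
    also have "\<dots> \<le> (\<rho> 0 * (1 / 4) ^ n) / 4" using Suc by (intro divide_right_mono) auto
    finally show ?case by simp
  qed simp
  moreover have "(\<lambda>n. \<rho> 0 * (1 / 4) ^ n) \<longlonglongrightarrow> 0"
    by (intro tendsto_mult_right_zero LIMSEQ_power_zero) simp
  moreover have "norm (\<rho> n) = \<rho> n" for n using \<rho>(1)[of n] by simp
  ultimately have "\<rho> \<longlonglongrightarrow> 0"
    by (intro Lim_null_comparison[of \<rho> "\<lambda>n. \<rho> 0 * (1 / 4) ^ n"] always_eventually) simp_all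
  then have zx: "z \<longlonglongrightarrow> x" unfolding \<rho>_def by (rule iffD2[OF tendsto_dist_iff])
  have sep: "dist s x + dist t x \<le> 4 * dist s t"
    if "n < m" "s \<in> ball (z n) (\<rho> n / 4)" "t \<in> ball (z m) (\<rho> m / 4)" for n m s t
    using that(2,3) lt[OF that(1)] \<rho>(1)[of n] dist_triangle[of "z n" x s] dist_triangle[of s x "z n"]
      dist_triangle[of t x "z m"] dist_triangle[of s x t]
    by (simp add: \<rho>_def dist_commute)
  define A where "A par = (\<Union>n\<in>{n. even n = par}. ball (z n) (\<rho> n / 4))" for par
  obtain L L' where L: "\<And>p q. norm (f p - f q) \<le> L * dist p q" "0 \<le> L"
    and L': "\<And>p q. norm (g p - g q) \<le> L' * dist p q" "0 \<le> L'"
    using f g by (auto simp: Lip_def lipschitz_on_def dist_norm)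
  have glue: "norm (f s - g t) \<le> ((L + L') * 4) * dist s t" if st: "s \<in> A True" "t \<in> A False" for s t
  proof -
    obtain n m where nm: "even n" "odd m" "s \<in> ball (z n) (\<rho> n / 4)" "t \<in> ball (z m) (\<rho> m / 4)"
      using st by (auto simp: A_def)
    then have "n \<noteq> m" by blast
    then have st4: "dist s x + dist t x \<le> 4 * dist s t"
      using sep[of n m s t] sep[of m n t s] nm(3,4)
      by (cases n m rule: linorder_cases) (simp_all add: dist_commute)
    have "norm (f s - g t) \<le> norm (f s - f x) + norm (g x - g t)"
      using norm_triangle_ineq[of "f s - f x" "g x - g t"] eq by simp
    also have "\<dots> \<le> L * dist s x + L' * dist t x"
      using L(1)[of s x] L'(1)[of x t] by (simp add: dist_commute)
    also have "\<dots> \<le> (L + L') * (dist s x + dist t x)"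
      using L(2) L'(2) by (simp add: algebra_simps)
    also have "\<dots> \<le> (L + L') * (4 * dist s t)"
      using st4 L(2) L'(2) by (intro mult_left_mono) auto
    finally show ?thesis by (simp only: mult.assoc)
  qed
  have "\<exists>h\<in>Lip. (\<forall>s\<in>A True. h s = f s) \<and> (\<forall>t\<in>A False. h t = g t)"
    by (rule Lip_glue[OF f g glue])
  then obtain h where h: "h \<in> Lip"
    "\<And>s. s \<in> A True \<Longrightarrow> h s = f s" "\<And>t. t \<in> A False \<Longrightarrow> h t = g t" by auto
  have \<phi>z: "\<phi> (z n) \<in> determined T (A (even n))" for n
    by (rule corresp_determined[OF \<phi>, of "\<rho> n / 4"]) (use \<rho>(1)[of n] in \<open>auto simp: A_def\<close>)
  have \<phi>x: "(\<lambda>n. F (\<phi> (z (c n)))) \<longlonglongrightarrow> F (\<phi> x)" if "F \<in> Lip" "strict_mono c"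
    for F :: "'b \<Rightarrow> 'f" and c :: "nat \<Rightarrow> nat"
  proof -
    have "continuous_on UNIV (\<lambda>x. F (\<phi> x))"
      using continuous_on_compose2[OF Lip_continuous_on[OF that(1)] corresp_continuous[OF bp \<phi>]] by simp
    then have "isCont (\<lambda>x. F (\<phi> x)) x" by (simp add: continuous_on_eq_continuous_at)
    then show ?thesis
      using isCont_tendsto_compose LIMSEQ_subseq_LIMSEQ[OF zx that(2)] unfolding comp_def by blast
  qed
  have "T h (\<phi> (z (2 * n))) = T f (\<phi> (z (2 * n)))" for n
    by (rule determinedD[OF \<phi>z h(1) f]) (simp add: h(2))
  then have "T h (\<phi> x) = T f (\<phi> x)"
    using \<phi>x[OF T_Lip[OF h(1)], of "\<lambda>n. 2 * n"] \<phi>x[OF T_Lip[OF f], of "\<lambda>n. 2 * n"]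
    by (simp add: strict_mono_def LIMSEQ_unique)
  moreover have "T h (\<phi> (z (2 * n + 1))) = T g (\<phi> (z (2 * n + 1)))" for n
    by (rule determinedD[OF \<phi>z h(1) g]) (simp add: h(3))
  then have "T h (\<phi> x) = T g (\<phi> x)"
    using \<phi>x[OF T_Lip[OF h(1)], of "\<lambda>n. 2 * n + 1"] \<phi>x[OF T_Lip[OF g], of "\<lambda>n. 2 * n + 1"]
    by (simp add: strict_mono_def LIMSEQ_unique)
  ultimately show ?thesis by simp
qed

text \<open>
If close points \<open>p n\<close>, \<open>q n\<close> had images at distance \<open>e\<close>, then after Efremovich's lemma \<open>T 0\<close> and \<open>T u\<close> could be
glued along the images. Pulling back gives a Lipschitz function with values \<open>0\<close> at \<open>p n\<close> and \<open>u\<close> at \<open>q n\<close>.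
\<close>

lemma corresp_uniformly_continuous:
  fixes T :: "('a::complete_space \<Rightarrow> 'e::real_normed_vector) \<Rightarrow> ('b::complete_space \<Rightarrow> 'f::real_normed_vector)"
  assumes bp: "biseparating_pair T S" and \<phi>: "\<And>x. corresp T x (\<phi> x)"
    and \<psi>: "\<And>y. corresp S y (\<psi> y)" "\<And>x. \<psi> (\<phi> x) = x"
  shows "uniformly_continuous_on UNIV \<phi>"
proof (rule ccontr)
  interpret biseparating_pair T S by fact
  assume "\<not> ?thesis"
  then obtain e where e: "e > 0" and *: "\<forall>d>0. \<exists>x x'. dist x' x < d \<and> e \<le> dist (\<phi> x') (\<phi> x)"
    unfolding uniformly_continuous_on_def by (meson UNIV_I not_less)
  have "\<exists>p q. dist p q < inverse (real (Suc n)) \<and> e \<le> dist (\<phi> p) (\<phi> q)" for n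
  proof -
    have "inverse (real (Suc n)) > 0" by simp
    then show ?thesis using * by blast
  qed
  then obtain p q where pq: "\<And>n. dist (p n) (q n) < inverse (real (Suc n))" "\<And>n. e \<le> dist (\<phi> (p n)) (\<phi> (q n))"
    by metis
  obtain r :: "nat \<Rightarrow> nat" where r: "strict_mono r" "\<And>i j. e / 4 \<le> dist (\<phi> (p (r i))) (\<phi> (q (r j)))"
    using far_subseq[of e "\<lambda>n. \<phi> (p n)" "\<lambda>n. \<phi> (q n)", OF e pq(2)] by blast
  obtain u :: 'e where u: "u \<noteq> 0" using nontrivial_E by blast
  let ?c0 = "\<lambda>x::'a. 0::'e" and ?cu = "\<lambda>x::'a. u"
  have "far (range (\<lambda>i. \<phi> (p (r i)))) (range (\<lambda>i. \<phi> (q (r i))))"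
    unfolding far_def using r(2) e by (intro exI[of _ "e / 4"]) auto
  from Lip_glue_far[OF bounded_Y T_Lip[OF Lip_const] T_Lip[OF Lip_const] this, of 0 u]
  obtain g where g: "g \<in> Lip" "\<And>i. g (\<phi> (p (r i))) = T ?c0 (\<phi> (p (r i)))"
    "\<And>i. g (\<phi> (q (r i))) = T ?cu (\<phi> (q (r i)))" by auto
  have undo: "S g x = f x" if "f \<in> Lip" "g (\<phi> x) = T f (\<phi> x)" for f and x
    using pointwise_determined[OF biseparating_pair_swap[OF bp] \<psi>(1) g(1) T_Lip[OF that(1)] that(2)]
    by (simp add: \<psi>(2) S_T that(1))
  have Sg: "S g (p (r i)) = 0" "S g (q (r i)) = u" for i
    using undo[of ?c0] undo[of ?cu] g(2,3) by auto
  obtain L where L: "\<And>x x'. norm (S g x - S g x') \<le> L * dist x x'" "0 \<le> L"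
    using S_Lip[OF g(1)] by (auto simp: Lip_def lipschitz_on_def dist_norm)
  have "norm u \<le> L * inverse (real (Suc n))" for n
  proof -
    have "norm u \<le> L * dist (p (r n)) (q (r n))" using L(1)[of "p (r n)" "q (r n)"] by (simp add: Sg)
    also have "\<dots> \<le> L * inverse (real (Suc (r n)))" using pq(1)[of "r n"] L(2) by (intro mult_left_mono) auto
    also have "\<dots> \<le> L * inverse (real (Suc n))"
      using seq_suble[OF r(1), of n] L(2) by (intro mult_left_mono le_imp_inverse_le) auto
    finally show ?thesis .
  qed
  moreover have "(\<lambda>n. L * inverse (real (Suc n))) \<longlonglongrightarrow> 0"
    by (intro tendsto_mult_right_zero LIMSEQ_inverse_real_of_nat)
  ultimately have "norm u \<le> 0" by (intro LIMSEQ_le_const) auto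
  then show False using u by simp
qed

section \<open>The point map is Lipschitz\<close>

text \<open>
Suppose that \<open>\<kappa>\<close> contracts some pairs by arbitrarily large factors: \<open>dist (\<kappa> p) (\<kappa> q)\<close> is much less than
\<open>h = dist p q\<close>. A change of the argument of \<open>\<Theta> q\<close> by about \<open>h\<close> is Lipschitz-compatible with moving from \<open>p\<close> to
\<open>q\<close>, so it changes the value by a multiple of \<open>dist (\<kappa> p) (\<kappa> q)\<close> only. An interval of fixed length consists
of about \<open>1 / h\<close> such steps, so \<open>\<Theta> q\<close> is almost constant along it, which the invertibility of the fibre
maps excludes.
\<close>

lemma norm_diff_le_chain:
  fixes \<gamma> :: "real \<Rightarrow> 'e::real_normed_vector"
  assumes h: "0 < h" and ab: "a \<le> b"
    and step: "\<And>s s'. s \<in> {a..b} \<Longrightarrow> s' \<in> {a..b} \<Longrightarrow> \<bar>s - s'\<bar> \<le> h \<Longrightarrow> norm (\<gamma> s - \<gamma> s') \<le> c"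
  shows "norm (\<gamma> a - \<gamma> b) \<le> ((b - a) / h + 1) * c"
proof -
  have c: "0 \<le> c" using step[of a a] ab h by simp
  define N where "N = nat \<lceil>(b - a) / h\<rceil>"
  have N: "(b - a) / h \<le> real N" "real N \<le> (b - a) / h + 1"
    using ab h by (auto simp: N_def le_nat_iff of_nat_nat)
  define t where "t i = min b (a + real i * h)" for i
  have t: "t i \<in> {a..b}" for i using ab h by (simp add: t_def)
  have tt: "\<bar>t i - t (Suc i)\<bar> \<le> h" for i
    using h by (auto simp: t_def min_def algebra_simps)
  have le: "norm (\<gamma> a - \<gamma> (t i)) \<le> real i * c" for i
  proof (induction i)
    case 0
    then show ?case using ab by (simp add: t_def)
  next
    case (Suc i)
    have "norm (\<gamma> a - \<gamma> (t (Suc i))) \<le> norm (\<gamma> a - \<gamma> (t i)) + norm (\<gamma> (t i) - \<gamma> (t (Suc i)))"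
      using norm_triangle_ineq[of "\<gamma> a - \<gamma> (t i)" "\<gamma> (t i) - \<gamma> (t (Suc i))"] by simp
    also have "\<dots> \<le> real i * c + c" using Suc step[OF t t tt] by (rule add_mono)
    finally show ?case by (simp add: algebra_simps)
  qed
  have "t N = b" using N(1) h by (simp add: t_def min_def field_simps)
  then have "norm (\<gamma> a - \<gamma> b) \<le> real N * c" using le[of N] by simp
  also have "\<dots> \<le> ((b - a) / h + 1) * c" using N(2) c by (rule mult_right_mono)
  finally show ?thesis .
qed

text \<open>
The total variation is at most the number of steps, about \<open>2 (b - a) / h n\<close>, times \<open>2 m e n\<close>, and
\<open>e n / h n\<close> is at most \<open>1 / n\<close>.
\<close>

lemma chain_limit:
  fixes \<gamma> :: "nat \<Rightarrow> real \<Rightarrow> 'e::real_normed_vector"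
  assumes ab: "a \<le> b" and pos: "\<And>n. 0 < h n" and small: "\<And>n. real n * e n \<le> h n"
    and h0: "h \<longlonglongrightarrow> 0"
    and step: "\<And>n s s'. m \<le> n \<Longrightarrow> s \<in> {a..b} \<Longrightarrow> s' \<in> {a..b} \<Longrightarrow> \<bar>s - s'\<bar> \<le> h n / 2 \<Longrightarrow>
      norm (\<gamma> n s - \<gamma> n s') \<le> 2 * real m * e n"
  shows "(\<lambda>n. \<gamma> n a - \<gamma> n b) \<longlonglongrightarrow> 0"
proof (rule Lim_null_comparison)
  show "\<forall>\<^sub>F n in sequentially. norm (\<gamma> n a - \<gamma> n b) \<le>
      4 * real m * (b - a) * inverse (real n) + 2 * real m * h n"
    using eventually_ge_at_top[of "Suc m"]
  proof eventually_elim
    case (elim n)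
    then have n: "real n \<ge> 1" "m \<le> n" by auto
    have hn: "0 < h n / 2" using pos[of n] by simp
    have e1: "e n \<le> h n * inverse (real n)"
      using small[of n] n by (simp add: field_simps)
    have e2: "e n \<le> h n"
    proof -
      have "h n * inverse (real n) \<le> h n * 1"
        using n pos[of n] by (intro mult_left_mono) (auto simp: inverse_le_1_iff)
      then show ?thesis using e1 by simp
    qed
    have "norm (\<gamma> n a - \<gamma> n b) \<le> ((b - a) / (h n / 2) + 1) * (2 * real m * e n)"
      using norm_diff_le_chain[OF hn ab, of "\<gamma> n"] step[OF n(2)] by blast
    also have "\<dots> = (b - a) / (h n / 2) * (2 * real m) * e n + 2 * real m * e n"
      by (simp add: algebra_simps)
    also have "\<dots> \<le> (b - a) / (h n / 2) * (2 * real m) * (h n * inverse (real n)) + 2 * real m * h n"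
      using e1 e2 ab pos[of n] by (intro add_mono mult_left_mono) auto
    also have "(b - a) / (h n / 2) * (2 * real m) * (h n * inverse (real n)) =
        ((b - a) / (h n / 2) * h n) * (2 * real m * inverse (real n))"
      by (simp only: mult_ac)
    also have "(b - a) / (h n / 2) * h n = 2 * (b - a)"
      using pos[of n] by simp
    also have "2 * (b - a) * (2 * real m * inverse (real n)) = 4 * real m * (b - a) * inverse (real n)"
      by simp
    finally show ?case .
  qed
  have "(\<lambda>n. 4 * real m * (b - a) * inverse (real n) + 2 * real m * h n) \<longlonglongrightarrow> 0 + 0"
    by (intro tendsto_add tendsto_mult_right_zero lim_inverse_n h0)
  then show "(\<lambda>n. 4 * real m * (b - a) * inverse (real n) + 2 * real m * h n) \<longlonglongrightarrow> 0" by simp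
qed

lemma countable_cover_somewhere_dense:
  fixes A :: "nat \<Rightarrow> real set"
  assumes cover: "(\<Union>m. A m) = UNIV"
  shows "\<exists>m a b. a < b \<and> {a..b} \<subseteq> closure (A m)"
proof -
  have "\<exists>m. interior (closure (A m)) \<noteq> {}"
  proof (rule ccontr)
    assume *: "\<not> ?thesis"
    let ?G = "range (\<lambda>m. - closure (A m))"
    have "UNIV \<subseteq> closure (\<Inter>?G)"
    proof (rule Baire)
      fix T assume "T \<in> ?G"
      then obtain m where T: "T = - closure (A m)" by blast
      have "closure T = - interior (closure (A m))" unfolding T by (rule closure_complement)
      then show "openin (top_of_set UNIV) T \<and> UNIV \<subseteq> closure T"
        using * by (simp add: T open_Compl)
    qed auto
    moreover have "\<Inter>?G = {}"
    proof (rule equals0I)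
      fix x assume x: "x \<in> \<Inter>?G"
      obtain m where "x \<in> A m" using cover by blast
      then have "x \<in> closure (A m)" using closure_subset by blast
      then show False using x by blast
    qed
    ultimately show False by auto
  qed
  then obtain m x where "x \<in> interior (closure (A m))" by blast
  then obtain e where e: "e > 0" "ball x e \<subseteq> closure (A m)" by (auto simp: mem_interior)
  have "{x..x + e / 2} \<subseteq> ball x e" using e(1) by (auto simp: dist_real_def)
  then show ?thesis using e by (intro exI[of _ m] exI[of _ x] exI[of _ "x + e / 2"]) auto
qed

lemma acts_constD:
  assumes "acts \<kappa> \<Theta>"
  shows "\<exists>L\<ge>0. \<forall>p q. norm (\<Theta> p u - \<Theta> q u) \<le> L * dist (\<kappa> p) (\<kappa> q)"
proof -
  obtain L where L: "\<And>p q. norm (\<Theta> p u - \<Theta> q u) \<le> L * dist (\<kappa> p) (\<kappa> q)"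
    using bspec[OF assms[unfolded acts_def] Lip_const[of u]] by blast
  have "L * dist (\<kappa> p) (\<kappa> q) \<le> \<bar>L\<bar> * dist (\<kappa> p) (\<kappa> q)" for p q by (intro mult_right_mono) auto
  then have "norm (\<Theta> p u - \<Theta> q u) \<le> \<bar>L\<bar> * dist (\<kappa> p) (\<kappa> q)" for p q
    by (rule order_trans[OF L])
  then show ?thesis by (intro exI[of _ "\<bar>L\<bar>"]) simp
qed

text \<open>
The local estimates of \<open>\<Theta>\<close> at \<open>y0\<close> have constants that depend on the base value \<open>t v\<close>, and nothing is known
about this dependence. By Baire's theorem one constant serves a set of parameters \<open>t\<close> that is dense in an
interval, and this suffices to walk through the interval in steps of length \<open>h n / 2\<close>. In the limit
\<open>\<Theta> y0\<close> takes the same value at both ends. The hypothesis that \<open>b n\<close> is far from \<open>y0\<close> relative to \<open>h n\<close> permits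
the value at \<open>b n\<close> to deviate from the base value by \<open>h n / 2\<close>.
\<close>

lemma no_fast_pairs_convergent:
  fixes \<kappa> :: "'b::metric_space \<Rightarrow> 'a::metric_space"
    and \<Theta> :: "'b \<Rightarrow> 'f::real_normed_vector \<Rightarrow> 'e::real_normed_vector"
  assumes acts: "acts \<kappa> \<Theta>" and inj: "\<And>y. inj (\<Theta> y)" and v: "norm (v::'f) = 1"
    and cont: "continuous_on UNIV \<kappa>"
    and lim: "a \<longlonglongrightarrow> y0" "b \<longlonglongrightarrow> y0"
    and far: "\<And>n. dist (a n) (b n) \<le> 2 * dist (b n) y0"
    and pos: "\<And>n. a n \<noteq> b n"
    and fast: "\<And>n. real n * dist (\<kappa> (a n)) (\<kappa> (b n)) \<le> dist (a n) (b n)"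
  shows False
proof -
  define e h where "e n = dist (\<kappa> (a n)) (\<kappa> (b n))" and "h n = dist (a n) (b n)" for n
  have h0: "h \<longlonglongrightarrow> 0" unfolding h_def using tendsto_dist[OF lim] by simp
  have hpos: "0 < h n" for n using pos by (simp add: h_def)
  define A where "A m = {t. \<forall>n\<ge>m. \<forall>s. \<bar>s - t\<bar> \<le> h n / 2 \<longrightarrow>
      norm (\<Theta> (b n) (s *\<^sub>R v) - \<Theta> (b n) (t *\<^sub>R v)) \<le> real m * e n}" for m
  have nv: "norm (s *\<^sub>R v - t *\<^sub>R v) = \<bar>s - t\<bar>" for s t
    using v by (simp flip: scaleR_left_diff_distrib)
  have "\<exists>m. t \<in> A m" for t
  proof -
    obtain r D where r: "r > 0" and D: "\<forall>p1 p2 u1 u2.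
        norm (u1 - u2) \<le> 1 * dist p1 p2 \<and>
        norm (u1 - t *\<^sub>R v) \<le> 1 * dist p1 y0 \<and> norm (u2 - t *\<^sub>R v) \<le> 1 * dist p2 y0 \<and>
        dist p1 y0 \<le> r \<and> dist p2 y0 \<le> r \<longrightarrow>
          norm (\<Theta> p1 u1 - \<Theta> p2 u2) \<le> D * dist (\<kappa> p1) (\<kappa> p2)"
      using lip_nearD[OF acts_imp_lip_near[OF acts], of 1 "t *\<^sub>R v" y0] by auto
    have "\<forall>\<^sub>F n in sequentially. dist (a n) y0 < r \<and> dist (b n) y0 < r"
      using tendstoD[OF lim(1) r] tendstoD[OF lim(2) r] by (rule eventually_conj)
    then obtain n0 where n0: "\<And>n. n0 \<le> n \<Longrightarrow> dist (a n) y0 < r \<and> dist (b n) y0 < r"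
      unfolding eventually_sequentially by blast
    obtain k :: nat where k: "2 * D \<le> real k" using real_arch_simple by blast
    have "t \<in> A (max n0 k)"
      unfolding A_def
    proof (intro CollectI allI impI)
      fix n s assume n: "max n0 k \<le> n" and s: "\<bar>s - t\<bar> \<le> h n / 2"
      have 1: "norm (\<Theta> (a n) (t *\<^sub>R v) - \<Theta> (b n) (s' *\<^sub>R v)) \<le> D * e n" if "\<bar>s' - t\<bar> \<le> h n / 2" for s'
      proof -
        have "\<bar>s' - t\<bar> \<le> h n" using that hpos[of n] by linarith
        then show ?thesis
          unfolding e_def using n0[of n] n that far[of n]
          by (intro D[rule_format]) (simp add: nv h_def abs_minus_commute)
      qed
      have "norm (\<Theta> (b n) (s *\<^sub>R v) - \<Theta> (b n) (t *\<^sub>R v)) \<le> D * e n + D * e n"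
        using norm_triangle_ineq4[of "\<Theta> (a n) (t *\<^sub>R v) - \<Theta> (b n) (t *\<^sub>R v)"
            "\<Theta> (a n) (t *\<^sub>R v) - \<Theta> (b n) (s *\<^sub>R v)"] 1[OF s] 1[of t] hpos[of n] by simp
      also have "\<dots> = 2 * D * e n" by simp
      also have "\<dots> \<le> real (max n0 k) * e n"
        using k by (intro mult_right_mono) (auto simp: e_def)
      finally show "norm (\<Theta> (b n) (s *\<^sub>R v) - \<Theta> (b n) (t *\<^sub>R v)) \<le> real (max n0 k) * e n" .
    qed
    then show ?thesis by blast
  qed
  then have "(\<Union>m. A m) = UNIV" by blast
  from countable_cover_somewhere_dense[OF this] obtain m \<alpha> \<beta> where \<alpha>\<beta>: "\<alpha> < \<beta>" "{\<alpha>..\<beta>} \<subseteq> closure (A m)"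
    by blast
  have step: "norm (\<Theta> (b n) (s *\<^sub>R v) - \<Theta> (b n) (s' *\<^sub>R v)) \<le> 2 * real m * e n"
    if "m \<le> n" "s \<in> {\<alpha>..\<beta>}" "s' \<in> {\<alpha>..\<beta>}" "\<bar>s - s'\<bar> \<le> h n / 2" for n s s'
  proof -
    \<comment> \<open>A parameter \<open>t\<close> of \<open>A m\<close> near the midpoint is within \<open>h n / 2\<close> of both \<open>s\<close> and \<open>s'\<close>.\<close>
    have "(s + s') / 2 \<in> closure (A m)" using \<alpha>\<beta>(2) that(2,3) by auto
    moreover have "h n / 4 > 0" using hpos[of n] by simp
    ultimately obtain t where t: "t \<in> A m" "dist t ((s + s') / 2) < h n / 4"
      unfolding closure_approachable by blast
    have "\<bar>s - t\<bar> \<le> h n / 2" "\<bar>s' - t\<bar> \<le> h n / 2"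
      using t(2) that(4) by (auto simp: dist_real_def abs_if field_simps split: if_splits)
    then have "norm (\<Theta> (b n) (s *\<^sub>R v) - \<Theta> (b n) (t *\<^sub>R v)) \<le> real m * e n"
      "norm (\<Theta> (b n) (s' *\<^sub>R v) - \<Theta> (b n) (t *\<^sub>R v)) \<le> real m * e n"
      using t(1) that(1) by (auto simp: A_def)
    then show ?thesis
      using norm_triangle_ineq4[of "\<Theta> (b n) (s *\<^sub>R v) - \<Theta> (b n) (t *\<^sub>R v)"
          "\<Theta> (b n) (s' *\<^sub>R v) - \<Theta> (b n) (t *\<^sub>R v)"] by simp
  qed
  have "(\<lambda>n. \<Theta> (b n) (\<alpha> *\<^sub>R v) - \<Theta> (b n) (\<beta> *\<^sub>R v)) \<longlonglongrightarrow> 0"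
    by (rule chain_limit[where h = h and e = e and m = m and \<gamma> = "\<lambda>n s. \<Theta> (b n) (s *\<^sub>R v)"])
      (use \<alpha>\<beta>(1) hpos fast h0 step in \<open>auto simp: h_def e_def\<close>)
  moreover have "(\<lambda>n. \<Theta> (b n) w) \<longlonglongrightarrow> \<Theta> y0 w" for w
  proof -
    obtain L where L: "\<And>p q. norm (\<Theta> p w - \<Theta> q w) \<le> L * dist (\<kappa> p) (\<kappa> q)"
      using acts_constD[OF acts, of w] by blast
    have "(\<lambda>n. \<kappa> (b n)) \<longlonglongrightarrow> \<kappa> y0"
      using continuous_on_tendsto_compose[OF cont lim(2)] by simp
    then have "(\<lambda>n. dist (\<kappa> (b n)) (\<kappa> y0)) \<longlonglongrightarrow> 0" by (rule iffD1[OF tendsto_dist_iff])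
    then have "(\<lambda>n. L * dist (\<kappa> (b n)) (\<kappa> y0)) \<longlonglongrightarrow> 0" by (rule tendsto_mult_right_zero)
    then have "(\<lambda>n. \<Theta> (b n) w - \<Theta> y0 w) \<longlonglongrightarrow> 0"
      by (rule Lim_null_comparison[rotated]) (intro always_eventually allI L)
    then show ?thesis by (rule LIM_zero_cancel)
  qed
  then have "(\<lambda>n. \<Theta> (b n) (\<alpha> *\<^sub>R v) - \<Theta> (b n) (\<beta> *\<^sub>R v)) \<longlonglongrightarrow> \<Theta> y0 (\<alpha> *\<^sub>R v) - \<Theta> y0 (\<beta> *\<^sub>R v)"
    by (intro tendsto_diff)
  ultimately have "\<Theta> y0 (\<alpha> *\<^sub>R v) - \<Theta> y0 (\<beta> *\<^sub>R v) = 0" by (rule LIMSEQ_unique[rotated])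
  then have "\<Theta> y0 (\<alpha> *\<^sub>R v) = \<Theta> y0 (\<beta> *\<^sub>R v)" by simp
  then have "\<alpha> *\<^sub>R v = \<beta> *\<^sub>R v" using inj by (metis injD)
  then show False using \<alpha>\<beta>(1) v by auto
qed

text \<open>
Along a separated sequence the base values may vary with \<open>n\<close>, so the estimates are uniform on bounded sets
of parameters without Baire's theorem. Almost constancy on \<open>[0, k]\<close> for every \<open>k\<close> then gives vectors \<open>k v\<close> of
unbounded norm with bounded images, against coercivity.
\<close>

lemma no_fast_pairs_separated:
  fixes \<kappa> :: "'b::metric_space \<Rightarrow> 'a::metric_space"
    and \<Theta> :: "'b \<Rightarrow> 'f::real_normed_vector \<Rightarrow> 'e::real_normed_vector"
  assumes acts: "acts \<kappa> \<Theta>" and v: "norm (v::'f) = 1"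
    and bdd: "bounded (range \<kappa>)"
    and coercive: "\<And>p B. separated_seq p \<Longrightarrow> bounded B \<Longrightarrow>
      \<exists>N. finite N \<and> bounded {v. \<exists>n. n \<notin> N \<and> \<Theta> (p n) v \<in> B}"
    and sep: "separated_seq p" and lim: "(\<lambda>n. dist (p n) (q n)) \<longlonglongrightarrow> 0"
    and pos: "\<And>n. p n \<noteq> q n"
    and fast: "\<And>n. real n * dist (\<kappa> (p n)) (\<kappa> (q n)) \<le> dist (p n) (q n)"
  shows False
proof -
  define e h where "e n = dist (\<kappa> (p n)) (\<kappa> (q n))" and "h n = dist (p n) (q n)" for n
  have h0: "h \<longlonglongrightarrow> 0" unfolding h_def by (rule lim)
  have hpos: "0 < h n" for n using pos by (simp add: h_def)
  have nv: "norm (s *\<^sub>R v - t *\<^sub>R v) = \<bar>s - t\<bar>" for s t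
    using v by (simp flip: scaleR_left_diff_distrib)
  have unif: "\<exists>m. \<forall>n\<ge>m. \<forall>t t'. \<bar>t\<bar> \<le> M \<and> \<bar>t' - t\<bar> \<le> h n \<longrightarrow>
      norm (\<Theta> (q n) (t' *\<^sub>R v) - \<Theta> (p n) (t *\<^sub>R v)) \<le> real m * e n" for M
  proof (rule ccontr)
    assume *: "\<not> ?thesis"
    have late: "\<exists>n t t'. K \<le> n \<and> \<bar>t\<bar> \<le> M \<and> \<bar>t' - t\<bar> \<le> h n \<and>
        real k * e n < norm (\<Theta> (q n) (t' *\<^sub>R v) - \<Theta> (p n) (t *\<^sub>R v))" for K k
    proof -
      obtain n t t' where n: "max K k \<le> n" "\<bar>t\<bar> \<le> M" "\<bar>t' - t\<bar> \<le> h n"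
        "real (max K k) * e n < norm (\<Theta> (q n) (t' *\<^sub>R v) - \<Theta> (p n) (t *\<^sub>R v))"
        using * by (meson not_le)
      moreover have "real k * e n \<le> real (max K k) * e n"
        by (intro mult_right_mono) (auto simp: e_def)
      ultimately show ?thesis by (intro exI[of _ n] exI[of _ t] exI[of _ t']) auto
    qed
    define P where "P k x \<longleftrightarrow> (case x of (n, t, t') \<Rightarrow> \<bar>t\<bar> \<le> M \<and> \<bar>t' - t\<bar> \<le> h n \<and>
        real k * e n < norm (\<Theta> (q n) (t' *\<^sub>R v) - \<Theta> (p n) (t *\<^sub>R v)))"
      for k :: nat and x :: "nat \<times> real \<times> real"
    have "\<exists>F. \<forall>n. P n (F n) \<and> fst (F n) < fst (F (Suc n))"
    proof (rule dependent_nat_choice)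
      show "\<exists>x. P 0 x" using late[of 0 0] unfolding P_def by fastforce
      fix x n
      show "\<exists>y. P (Suc n) y \<and> fst x < fst y"
        using late[of "Suc (fst x)" "Suc n"] unfolding P_def by (fastforce simp: Suc_le_eq)
    qed
    then obtain F where F: "\<And>n. P n (F n)" "\<And>n. fst (F n) < fst (F (Suc n))" by blast
    define N t t' where "N k = fst (F k)" and "t k = fst (snd (F k))" and "t' k = snd (snd (F k))" for k
    have V: "\<bar>t k\<bar> \<le> M" "\<bar>t' k - t k\<bar> \<le> h (N k)"
      "real k * e (N k) < norm (\<Theta> (q (N k)) (t' k *\<^sub>R v) - \<Theta> (p (N k)) (t k *\<^sub>R v))" for k
      using F(1)[of k] by (simp_all add: P_def N_def t_def t'_def case_prod_beta)
    have N: "strict_mono N" using F(2) by (simp add: strict_mono_Suc_iff N_def)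
    have bt: "bounded (range (\<lambda>k. t k *\<^sub>R v))"
      using V(1) v by (auto simp: bounded_iff)
    from lip_sepD[OF acts_imp_lip_sep[OF acts] separated_seq_subseq[OF sep N] bt, of 1]
    obtain r D where r: "r > 0" and D: "\<forall>k p' u'.
        norm (u' - t k *\<^sub>R v) \<le> 1 * dist p' (p (N k)) \<and> dist p' (p (N k)) \<le> r \<longrightarrow>
          norm (\<Theta> p' u' - \<Theta> (p (N k)) (t k *\<^sub>R v)) \<le> D * dist (\<kappa> p') (\<kappa> (p (N k)))"
      by auto
    have "(\<lambda>k. h (N k)) \<longlonglongrightarrow> 0" using LIMSEQ_subseq_LIMSEQ[OF h0 N] by (simp add: comp_def)
    then have "\<forall>\<^sub>F k in sequentially. h (N k) < r" using r by (rule order_tendstoD(2))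
    moreover have "\<forall>\<^sub>F k in sequentially. D \<le> real k"
      using eventually_le_real_subseq[OF strict_mono_id, of D] by simp
    ultimately have "\<forall>\<^sub>F k in sequentially. False"
    proof eventually_elim
      case (elim k)
      have "norm (\<Theta> (q (N k)) (t' k *\<^sub>R v) - \<Theta> (p (N k)) (t k *\<^sub>R v)) \<le> D * dist (\<kappa> (q (N k))) (\<kappa> (p (N k)))"
        using V(2)[of k] elim(1) by (intro D[rule_format]) (simp add: nv h_def dist_commute)
      also have "\<dots> \<le> real k * e (N k)"
        using elim(2) by (auto simp: e_def dist_commute intro: mult_right_mono)
      finally show False using V(3)[of k] by linarith
    qed
    then show False by simp
  qed
  have lim0: "(\<lambda>n. \<Theta> (p n) (0 *\<^sub>R v) - \<Theta> (p n) (M *\<^sub>R v)) \<longlonglongrightarrow> 0" if M: "0 \<le> M" for M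
  proof -
    obtain m where m: "\<And>n t t'. m \<le> n \<Longrightarrow> \<bar>t\<bar> \<le> M \<Longrightarrow> \<bar>t' - t\<bar> \<le> h n \<Longrightarrow>
      norm (\<Theta> (q n) (t' *\<^sub>R v) - \<Theta> (p n) (t *\<^sub>R v)) \<le> real m * e n"
      using unif[of M] by blast
    have step: "norm (\<Theta> (p n) (s *\<^sub>R v) - \<Theta> (p n) (s' *\<^sub>R v)) \<le> 2 * real m * e n"
      if n: "m \<le> n" "s \<in> {0..M}" "s' \<in> {0..M}" "\<bar>s - s'\<bar> \<le> h n / 2" for n s s'
    proof -
      have "norm (\<Theta> (q n) (s *\<^sub>R v) - \<Theta> (p n) (s *\<^sub>R v)) \<le> real m * e n"
        "norm (\<Theta> (q n) (s *\<^sub>R v) - \<Theta> (p n) (s' *\<^sub>R v)) \<le> real m * e n"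
        using n hpos[of n] by (auto intro!: m)
      then show ?thesis
        using norm_triangle_ineq4[of "\<Theta> (q n) (s *\<^sub>R v) - \<Theta> (p n) (s' *\<^sub>R v)"
          "\<Theta> (q n) (s *\<^sub>R v) - \<Theta> (p n) (s *\<^sub>R v)"] by simp
    qed
    show ?thesis
      by (rule chain_limit[where h = h and e = e and m = m and \<gamma> = "\<lambda>n s. \<Theta> (p n) (s *\<^sub>R v)"])
        (use M hpos fast h0 step in \<open>auto simp: h_def e_def\<close>)
  qed
  have near: "\<exists>n\<ge>K. norm (\<Theta> (p n) 0 - \<Theta> (p n) (real k *\<^sub>R v)) < 1" for K k
  proof -
    have "\<forall>\<^sub>F n in sequentially. dist (\<Theta> (p n) (0 *\<^sub>R v) - \<Theta> (p n) (real k *\<^sub>R v)) 0 < 1"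
      using lim0[of "real k"] by (intro tendstoD) auto
    from eventually_conj[OF this eventually_ge_at_top[of K]] show ?thesis
      unfolding eventually_sequentially by (auto simp: dist_norm)
  qed
  have "\<exists>N. \<forall>k. norm (\<Theta> (p (N k)) 0 - \<Theta> (p (N k)) (real k *\<^sub>R v)) < 1 \<and> N k < N (Suc k)"
  proof (rule dependent_nat_choice)
    show "\<exists>n. norm (\<Theta> (p n) 0 - \<Theta> (p n) (real 0 *\<^sub>R v)) < 1" using near[of 0 0] by blast
    fix n k
    show "\<exists>n'. norm (\<Theta> (p n') 0 - \<Theta> (p n') (real (Suc k) *\<^sub>R v)) < 1 \<and> n < n'"
      using near[of "Suc n" "Suc k"] by (auto simp: Suc_le_eq)
  qed
  then obtain N where N: "\<And>k. norm (\<Theta> (p (N k)) 0 - \<Theta> (p (N k)) (real k *\<^sub>R v)) < 1" "strict_mono N"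
    by (auto simp: strict_mono_Suc_iff)
  obtain L where L: "0 \<le> L" "\<And>x y. norm (\<Theta> x 0 - \<Theta> y 0) \<le> L * dist (\<kappa> x) (\<kappa> y)"
    using acts_constD[OF acts, of 0] by blast
  obtain c where c: "\<And>x y. dist (\<kappa> x) (\<kappa> y) \<le> c"
    using bdd unfolding bounded_two_points by blast
  define R where "R = norm (\<Theta> (p 0) 0) + L * c + 1"
  have R: "\<Theta> (p (N k)) (real k *\<^sub>R v) \<in> cball 0 R" for k
  proof -
    have "norm (\<Theta> (p (N k)) 0 - \<Theta> (p 0) 0) \<le> L * c"
      using L(2)[of "p (N k)" "p 0"] mult_left_mono[OF c L(1), of "p (N k)" "p 0"] by linarith
    then show ?thesis
      using N(1)[of k] norm_triangle_ineq2[of "\<Theta> (p (N k)) 0" "\<Theta> (p 0) 0"]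
        norm_triangle_ineq3[of "\<Theta> (p (N k)) 0" "\<Theta> (p (N k)) (real k *\<^sub>R v)"]
      by (simp add: R_def)
  qed
  obtain N0 b where N0: "finite N0" "\<forall>w\<in>{w. \<exists>k. k \<notin> N0 \<and> \<Theta> (p (N k)) w \<in> cball 0 R}. norm w \<le> b"
    using coercive[OF separated_seq_subseq[OF sep N(2)] bounded_cball, of 0 R]
    unfolding bounded_iff by blast
  obtain j where j: "\<forall>i\<in>N0. i \<le> j" using N0(1) by (auto simp: finite_nat_set_iff_bounded_le)
  obtain i :: nat where i: "b < real i" using reals_Archimedean2 by blast
  define k where "k = Suc (max i j)"
  have "k \<notin> N0" using j by (force simp: k_def)
  then have "norm (real k *\<^sub>R v) \<le> b" using N0(2) R by blast
  then show False using i v by (simp add: k_def)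
qed

lemma inverse_Lipschitz_of_acts:
  fixes \<kappa> :: "'b::complete_space \<Rightarrow> 'a::metric_space"
    and \<Theta> :: "'b \<Rightarrow> 'f::real_normed_vector \<Rightarrow> 'e::real_normed_vector"
  assumes acts: "acts \<kappa> \<Theta>" and inj: "\<And>y. inj (\<Theta> y)" and nontrivial: "\<exists>v::'f. v \<noteq> 0"
    and bddY: "bounded (UNIV :: 'b set)" and bdd: "bounded (range \<kappa>)"
    and cont: "continuous_on UNIV \<kappa>"
    and uc: "\<And>\<epsilon>. \<epsilon> > 0 \<Longrightarrow> \<exists>d>0. \<forall>p q. dist (\<kappa> p) (\<kappa> q) < d \<longrightarrow> dist p q < \<epsilon>"
    and coercive: "\<And>p B. separated_seq p \<Longrightarrow> bounded B \<Longrightarrow>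
      \<exists>N. finite N \<and> bounded {v. \<exists>n. n \<notin> N \<and> \<Theta> (p n) v \<in> B}"
  shows "\<exists>D. \<forall>p q. dist p q \<le> D * dist (\<kappa> p) (\<kappa> q)"
proof (rule ccontr)
  obtain v0 :: 'f where "v0 \<noteq> 0" using nontrivial by blast
  define v where "v = sgn v0"
  have v: "norm v = 1" using \<open>v0 \<noteq> 0\<close> by (simp add: v_def norm_sgn)
  assume "\<not> ?thesis"
  then have "\<exists>p q. real n * dist (\<kappa> p) (\<kappa> q) < dist p q" for n by (meson not_le)
  then obtain p q where pq: "\<And>n. real n * dist (\<kappa> (p n)) (\<kappa> (q n)) < dist (p n) (q n)" by metis
  obtain c where c: "\<And>x y :: 'b. dist x y \<le> c" using bddY unfolding bounded_two_points by blast
  have e0: "(\<lambda>n. dist (\<kappa> (p n)) (\<kappa> (q n))) \<longlonglongrightarrow> 0"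
  proof (rule Lim_null_comparison)
    show "\<forall>\<^sub>F n in sequentially. norm (dist (\<kappa> (p n)) (\<kappa> (q n))) \<le> c * inverse (real n)"
      using eventually_gt_at_top[of 0]
    proof eventually_elim
      case (elim n)
      then show ?case using pq[of n] c[of "p n" "q n"] by (simp add: field_simps)
    qed
    show "(\<lambda>n. c * inverse (real n)) \<longlonglongrightarrow> 0" by (intro tendsto_mult_right_zero lim_inverse_n)
  qed
  have h0: "(\<lambda>n. dist (p n) (q n)) \<longlonglongrightarrow> 0"
  proof (rule tendstoI)
    fix \<epsilon> :: real assume "\<epsilon> > 0"
    then obtain d where d: "d > 0" "\<And>p q. dist (\<kappa> p) (\<kappa> q) < d \<Longrightarrow> dist p q < \<epsilon>" using uc by blast
    have "\<forall>\<^sub>F n in sequentially. dist (\<kappa> (p n)) (\<kappa> (q n)) < d" using e0 d(1) by (rule order_tendstoD(2))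
    then show "\<forall>\<^sub>F n in sequentially. dist (dist (p n) (q n)) 0 < \<epsilon>"
      by eventually_elim (simp add: d(2))
  qed
  have sub: "real n * dist (\<kappa> (p (s n))) (\<kappa> (q (s n))) \<le> dist (p (s n)) (q (s n))"
    if "strict_mono s" for s n
  proof -
    have "real n * dist (\<kappa> (p (s n))) (\<kappa> (q (s n))) \<le> real (s n) * dist (\<kappa> (p (s n))) (\<kappa> (q (s n)))"
      using seq_suble[OF that, of n] by (intro mult_right_mono) auto
    then show ?thesis using pq[of "s n"] by linarith
  qed
  have ne: "p n \<noteq> q n" for n using pq[of n] by auto
  show False
  proof (cases rule: convergent_or_separated_subseq[of p])
    case (convergent s l)
    have hs: "(\<lambda>n. dist (p (s n)) (q (s n))) \<longlonglongrightarrow> 0"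
      using LIMSEQ_subseq_LIMSEQ[OF h0 convergent(1)] by (simp add: comp_def)
    have d0: "(\<lambda>n. dist (p (s n)) l + dist (p (s n)) (q (s n))) \<longlonglongrightarrow> 0"
      using tendsto_add[OF iffD1[OF tendsto_dist_iff convergent(2)] hs] by simp
    \<comment> \<open>Name the pairs so that \<open>b n\<close> is the point farther from the limit.\<close>
    define a where "a n = (if dist (p (s n)) l \<le> dist (q (s n)) l then p (s n) else q (s n))" for n
    define b where "b n = (if dist (p (s n)) l \<le> dist (q (s n)) l then q (s n) else p (s n))" for n
    have le: "dist (a n) l \<le> dist (b n) l"
      "dist (b n) l \<le> dist (p (s n)) l + dist (p (s n)) (q (s n))" for n
      using dist_triangle[of "q (s n)" l "p (s n)"] by (auto simp: a_def b_def dist_commute)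
    have "(\<lambda>n. dist (b n) l) \<longlonglongrightarrow> 0" "(\<lambda>n. dist (a n) l) \<longlonglongrightarrow> 0"
      using le order_trans[OF le(1) le(2)]
      by (auto intro!: Lim_null_comparison[OF always_eventually d0])
    then have lim: "a \<longlonglongrightarrow> l" "b \<longlonglongrightarrow> l" using iffD2[OF tendsto_dist_iff] by blast+
    show False
    proof (rule no_fast_pairs_convergent[OF acts inj v cont lim])
      show "dist (a n) (b n) \<le> 2 * dist (b n) l" for n
        using le(1)[of n] dist_triangle2[of "a n" "b n" l] by simp
      show "a n \<noteq> b n" for n using ne[of "s n"] by (auto simp: a_def b_def)
      show "real n * dist (\<kappa> (a n)) (\<kappa> (b n)) \<le> dist (a n) (b n)" for n
        using sub[OF convergent(1), of n] by (auto simp: a_def b_def dist_commute)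
    qed
  next
    case (separated s)
    have "(\<lambda>n. dist (p (s n)) (q (s n))) \<longlonglongrightarrow> 0"
      using LIMSEQ_subseq_LIMSEQ[OF h0 separated(1)] by (simp add: comp_def)
    from no_fast_pairs_separated[OF acts v bdd coercive separated(2) this ne sub[OF separated(1)]]
    show False .
  qed
qed

lemma corresp_acts:
  fixes T :: "('a::complete_space \<Rightarrow> 'e::real_normed_vector) \<Rightarrow> ('b::complete_space \<Rightarrow> 'f::real_normed_vector)"
  assumes bp: "biseparating_pair T S" and \<phi>: "\<And>x. corresp T x (\<phi> x)"
  shows "acts \<phi> (\<lambda>x u. T (\<lambda>_. u) (\<phi> x))"
  unfolding acts_def
proof
  interpret biseparating_pair T S by fact
  fix f :: "'a \<Rightarrow> 'e" assume f: "f \<in> Lip"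
  obtain L where L: "\<And>y y'. norm (T f y - T f y') \<le> L * dist y y'"
    using T_Lip[OF f] unfolding Lip_iff by blast
  have "T (\<lambda>_. f x) (\<phi> x) = T f (\<phi> x)" for x
    by (rule pointwise_determined[OF bp \<phi> Lip_const f]) simp
  then show "\<exists>L. \<forall>p q. norm (T (\<lambda>_. f p) (\<phi> p) - T (\<lambda>_. f q) (\<phi> q)) \<le> L * dist (\<phi> p) (\<phi> q)"
    using L by auto
qed

lemma Lip_distI:
  assumes "\<And>x y. dist (f x) (f y) \<le> D * dist x y" shows "f \<in> Lip"
proof -
  have "D * dist x y \<le> \<bar>D\<bar> * dist x y" for x y :: 'a by (intro mult_right_mono) auto
  then have "\<bar>D\<bar>-lipschitz_on UNIV f"
    by (intro lipschitz_onI order_trans[OF assms]) auto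
  then show ?thesis by (auto simp: Lip_def)
qed

text \<open>
\<open>inverse_Lipschitz_of_acts\<close> is applied to the inverse point map \<open>\<psi>\<close> and the fibre maps of \<open>S\<close>. Their coercivity is
the boundedness condition for the fibre maps of \<open>T\<close>, which invert them.
\<close>

lemma corresp_Lip:
  fixes T :: "('a::complete_space \<Rightarrow> 'e::real_normed_vector) \<Rightarrow> ('b::complete_space \<Rightarrow> 'f::real_normed_vector)"
  assumes bp: "biseparating_pair T S"
    and \<phi>: "\<And>x. corresp T x (\<phi> x)" and \<psi>: "\<And>y. corresp S y (\<psi> y)"
    and inv: "\<And>x. \<psi> (\<phi> x) = x" "\<And>y. \<phi> (\<psi> y) = y"
  shows "\<phi> \<in> Lip"
proof -
  interpret biseparating_pair T S by fact
  note swap = biseparating_pair_swap[OF bp]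
  have "uniformly_continuous_on UNIV \<phi>"
    by (rule corresp_uniformly_continuous[OF bp \<phi> \<psi> inv(1)])
  then have uc: "\<exists>d>0. \<forall>x x'. dist x' x < d \<longrightarrow> dist (\<phi> x') (\<phi> x) < \<epsilon>" if "\<epsilon> > 0" for \<epsilon>
    using that unfolding uniformly_continuous_on_def by simp
  define \<Theta> where "\<Theta> y v = S (\<lambda>_. v) (\<psi> y)" for y v
  have T\<Theta>: "T (\<lambda>_. \<Theta> y v) y = v" for y v
  proof -
    have "T (\<lambda>_. \<Theta> y v) (\<phi> (\<psi> y)) = T (S (\<lambda>_. v)) (\<phi> (\<psi> y))"
      by (rule pointwise_determined[OF bp \<phi> Lip_const S_Lip[OF Lip_const]]) (simp add: \<Theta>_def)
    then show ?thesis by (simp add: inv T_S)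
  qed
  have "\<exists>D. \<forall>p q. dist p q \<le> D * dist (\<psi> p) (\<psi> q)"
  proof (rule inverse_Lipschitz_of_acts)
    show "acts \<psi> \<Theta>" using corresp_acts[OF swap \<psi>] by (simp add: \<Theta>_def[abs_def])
    show "inj (\<Theta> y)" for y by (rule inj_on_inverseI[of _ "\<lambda>u. T (\<lambda>_. u) y"]) (rule T\<Theta>)
    show "\<exists>v::'f. v \<noteq> 0" by (rule nontrivial_F)
    show "bounded (UNIV :: 'b set)" by (rule bounded_Y)
    show "bounded (range \<psi>)" by (rule bounded_subset[OF bounded_X]) simp
    show "continuous_on UNIV \<psi>" by (rule corresp_continuous[OF swap \<psi>])
    show "\<exists>d>0. \<forall>p q. dist (\<psi> p) (\<psi> q) < d \<longrightarrow> dist p q < \<epsilon>" if "\<epsilon> > 0" for \<epsilon>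
    proof -
      obtain d where d: "d > 0" "\<And>x x'. dist x' x < d \<Longrightarrow> dist (\<phi> x') (\<phi> x) < \<epsilon>"
        using uc[OF \<open>\<epsilon> > 0\<close>] by blast
      then have "dist p q < \<epsilon>" if "dist (\<psi> p) (\<psi> q) < d" for p q
        using d(2)[OF that] by (simp add: inv)
      with d(1) show ?thesis by blast
    qed
    show "\<exists>N. finite N \<and> bounded {v. \<exists>n. n \<notin> N \<and> \<Theta> (p n) v \<in> B}"
      if p: "separated_seq p" and B: "bounded B" for p :: "nat \<Rightarrow> 'b" and B :: "'e set"
    proof -
      obtain \<delta> where \<delta>: "\<delta> > 0" "\<And>m n. m \<noteq> n \<Longrightarrow> \<delta> \<le> dist (p m) (p n)"
        using p by (auto simp: separated_seq_iff)
      obtain d where d: "d > 0" "\<And>x x'. dist x' x < d \<Longrightarrow> dist (\<phi> x') (\<phi> x) < \<delta>"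
        using uc[OF \<delta>(1)] by blast
      have "d \<le> dist (\<psi> (p m)) (\<psi> (p n))" if "m \<noteq> n" for m n
        using d(2)[of "\<psi> (p m)" "\<psi> (p n)"] \<delta>(2)[OF that] by (force simp: inv)
      then have "separated_seq (\<lambda>n. \<psi> (p n))" using d(1) unfolding separated_seq_iff by blast
      moreover have "bounded_sep (\<lambda>x u. T (\<lambda>_. u) (\<phi> x))"
        by (rule acts_imp_bounded_sep[OF corresp_acts[OF bp \<phi>] bounded_subset[OF bounded_Y]]) simp
      ultimately obtain N where N: "finite N"
        "bounded (\<Union>n\<in>- N. (\<lambda>u. T (\<lambda>_. u) (\<phi> (\<psi> (p n)))) ` B)"
        using B unfolding bounded_sep_def by blast
      have "{v. \<exists>n. n \<notin> N \<and> \<Theta> (p n) v \<in> B} \<subseteq> (\<Union>n\<in>- N. (\<lambda>u. T (\<lambda>_. u) (\<phi> (\<psi> (p n)))) ` B)"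
      proof
        fix v assume "v \<in> {v. \<exists>n. n \<notin> N \<and> \<Theta> (p n) v \<in> B}"
        then obtain n where n: "n \<notin> N" "\<Theta> (p n) v \<in> B" by blast
        have "v = T (\<lambda>_. \<Theta> (p n) v) (\<phi> (\<psi> (p n)))" by (simp add: inv T\<Theta>)
        with n show "v \<in> (\<Union>n\<in>- N. (\<lambda>u. T (\<lambda>_. u) (\<phi> (\<psi> (p n)))) ` B)" by blast
      qed
      with N show ?thesis using bounded_subset by blast
    qed
  qed
  then obtain D where D: "\<And>p q. dist p q \<le> D * dist (\<psi> p) (\<psi> q)" by blast
  show ?thesis
    by (rule Lip_distI[of _ D]) (use D[of "\<phi> _" "\<phi> _"] in \<open>simp add: inv\<close>)
qed

section \<open>Splitting the conditions into their two sides\<close>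

text \<open>
The statement treats \<open>\<Phi>\<close> and \<open>\<Psi>\<close> simultaneously. Each half is recovered by choosing trivial data for the
other: the empty set, or the constant value zero.
\<close>

lemma bounded_along_separated_iff:
  fixes \<phi> :: "'a::metric_space \<Rightarrow> 'b" and \<Phi> :: "'b \<Rightarrow> 'e::real_normed_vector \<Rightarrow> 'f::real_normed_vector"
  shows "bounded_along_separated \<phi> \<Phi> \<Psi> \<longleftrightarrow> bounded_sep (\<lambda>x. \<Phi> (\<phi> x)) \<and> bounded_sep \<Psi>"
proof
  assume *: "bounded_along_separated \<phi> \<Phi> \<Psi>"
  show "bounded_sep (\<lambda>x. \<Phi> (\<phi> x)) \<and> bounded_sep \<Psi>"
    unfolding bounded_sep_def
  proof (intro conjI allI impI)
    fix p :: "nat \<Rightarrow> 'a" and B :: "'e set" assume pB: "separated_seq p" "bounded B"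
    from *[unfolded bounded_along_separated_def, rule_format, OF pB bounded_empty]
    show "\<exists>N. finite N \<and> bounded (\<Union>n\<in>- N. \<Phi> (\<phi> (p n)) ` B)" by blast
  next
    fix p :: "nat \<Rightarrow> 'a" and B :: "'f set" assume pB: "separated_seq p" "bounded B"
    from *[unfolded bounded_along_separated_def, rule_format, OF pB(1) bounded_empty pB(2)]
    show "\<exists>N. finite N \<and> bounded (\<Union>n\<in>- N. \<Psi> (p n) ` B)" by blast
  qed
next
  assume *: "bounded_sep (\<lambda>x. \<Phi> (\<phi> x)) \<and> bounded_sep \<Psi>"
  show "bounded_along_separated \<phi> \<Phi> \<Psi>"
    unfolding bounded_along_separated_def
  proof (intro allI impI)
    fix x :: "nat \<Rightarrow> 'a" and B :: "'e set" and B' :: "'f set" assume x: "separated_seq x" and B: "bounded B" "bounded B'"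
    obtain N where N: "finite N" "bounded (\<Union>n\<in>- N. \<Phi> (\<phi> (x n)) ` B)"
      using * x B(1) unfolding bounded_sep_def by blast
    obtain N' where N': "finite N'" "bounded (\<Union>n\<in>- N'. \<Psi> (x n) ` B')"
      using * x B(2) unfolding bounded_sep_def by blast
    have "bounded (\<Union>n\<in>- (N \<union> N'). \<Phi> (\<phi> (x n)) ` B)" by (rule bounded_subset[OF N(2)]) blast
    moreover have "bounded (\<Union>n\<in>- (N \<union> N'). \<Psi> (x n) ` B')" by (rule bounded_subset[OF N'(2)]) blast
    ultimately show "\<exists>N. finite N \<and> bounded (\<Union>n\<in>- N. \<Phi> (\<phi> (x n)) ` B) \<and> bounded (\<Union>n\<in>- N. \<Psi> (x n) ` B')"
      using N(1) N'(1) by (intro exI[of _ "N \<union> N'"]) simp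
  qed
qed

lemma lipschitz_near_points_iff:
  fixes \<phi> :: "'a::metric_space \<Rightarrow> 'b" and \<Phi> :: "'b \<Rightarrow> 'e::real_normed_vector \<Rightarrow> 'f::real_normed_vector"
  shows "lipschitz_near_points \<phi> \<Phi> \<Psi> \<longleftrightarrow> lip_near (\<lambda>x. x) (\<lambda>x. \<Phi> (\<phi> x)) \<and> lip_near (\<lambda>x. x) \<Psi>"
proof
  assume *: "lipschitz_near_points \<phi> \<Phi> \<Psi>"
  show "lip_near (\<lambda>x. x) (\<lambda>x. \<Phi> (\<phi> x)) \<and> lip_near (\<lambda>x. x) \<Psi>"
    unfolding lip_near_def
  proof (intro conjI allI impI)
    fix p0 u0 and C :: real assume C: "0 \<le> C"
    obtain r D where r: "r > 0" and D: "\<forall>x1 x2 u1 u2 v1 v2.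
        norm (u1 - u2) \<le> C * dist x1 x2 \<and> norm (v1 - v2) \<le> C * dist x1 x2 \<and>
        norm (u1 - u0) \<le> C * dist x1 p0 \<and> norm (u2 - u0) \<le> C * dist x2 p0 \<and>
        norm (v1 - 0) \<le> C * dist x1 p0 \<and> norm (v2 - 0) \<le> C * dist x2 p0 \<and>
        dist x1 p0 \<le> r \<and> dist x2 p0 \<le> r \<longrightarrow>
          norm (\<Phi> (\<phi> x1) u1 - \<Phi> (\<phi> x2) u2) \<le> D * dist x1 x2 \<and>
          norm (\<Psi> x1 v1 - \<Psi> x2 v2) \<le> D * dist x1 x2"
      using *[unfolded lipschitz_near_points_def, rule_format, where ?x0.0 = p0 and ?u0.0 = u0 and ?v0.0 = 0 and C = C]
      by blast
    show "\<exists>r>0. \<exists>D. \<forall>p1 p2 u1 u2. norm (u1 - u2) \<le> C * dist p1 p2 \<and>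
       norm (u1 - u0) \<le> C * dist p1 p0 \<and> norm (u2 - u0) \<le> C * dist p2 p0 \<and>
       dist p1 p0 \<le> r \<and> dist p2 p0 \<le> r \<longrightarrow>
         norm (\<Phi> (\<phi> p1) u1 - \<Phi> (\<phi> p2) u2) \<le> D * dist p1 p2"
      using r D[rule_format, where ?v1.0 = 0 and ?v2.0 = 0] C
      by (intro exI[of _ r] conjI exI[of _ D]) simp_all
  next
    fix p0 v0 and C :: real assume C: "0 \<le> C"
    obtain r D where r: "r > 0" and D: "\<forall>x1 x2 u1 u2 v1 v2.
        norm (u1 - u2) \<le> C * dist x1 x2 \<and> norm (v1 - v2) \<le> C * dist x1 x2 \<and>
        norm (u1 - 0) \<le> C * dist x1 p0 \<and> norm (u2 - 0) \<le> C * dist x2 p0 \<and>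
        norm (v1 - v0) \<le> C * dist x1 p0 \<and> norm (v2 - v0) \<le> C * dist x2 p0 \<and>
        dist x1 p0 \<le> r \<and> dist x2 p0 \<le> r \<longrightarrow>
          norm (\<Phi> (\<phi> x1) u1 - \<Phi> (\<phi> x2) u2) \<le> D * dist x1 x2 \<and>
          norm (\<Psi> x1 v1 - \<Psi> x2 v2) \<le> D * dist x1 x2"
      using *[unfolded lipschitz_near_points_def, rule_format, where ?x0.0 = p0 and ?u0.0 = 0 and ?v0.0 = v0 and C = C]
      by blast
    show "\<exists>r>0. \<exists>D. \<forall>p1 p2 u1 u2. norm (u1 - u2) \<le> C * dist p1 p2 \<and>
       norm (u1 - v0) \<le> C * dist p1 p0 \<and> norm (u2 - v0) \<le> C * dist p2 p0 \<and>
       dist p1 p0 \<le> r \<and> dist p2 p0 \<le> r \<longrightarrow>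
         norm (\<Psi> p1 u1 - \<Psi> p2 u2) \<le> D * dist p1 p2"
      using r D[rule_format, where ?u1.0 = 0 and ?u2.0 = 0] C
      by (intro exI[of _ r] conjI exI[of _ D]) simp_all
  qed
next
  assume *: "lip_near (\<lambda>x. x) (\<lambda>x. \<Phi> (\<phi> x)) \<and> lip_near (\<lambda>x. x) \<Psi>"
  show "lipschitz_near_points \<phi> \<Phi> \<Psi>"
    unfolding lipschitz_near_points_def
  proof (intro allI)
    fix x0 u0 v0 and C :: real
    let ?C = "\<bar>C\<bar>"
    obtain r D where r: "r > 0" and D: "\<forall>p1 p2 u1 u2. norm (u1 - u2) \<le> ?C * dist p1 p2 \<and>
       norm (u1 - u0) \<le> ?C * dist p1 x0 \<and> norm (u2 - u0) \<le> ?C * dist p2 x0 \<and>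
       dist p1 x0 \<le> r \<and> dist p2 x0 \<le> r \<longrightarrow> norm (\<Phi> (\<phi> p1) u1 - \<Phi> (\<phi> p2) u2) \<le> D * dist p1 p2"
      using lip_nearD[OF conjunct1[OF *], of ?C u0 x0] by auto
    obtain r' D' where r': "r' > 0" and D': "\<forall>p1 p2 v1 v2. norm (v1 - v2) \<le> ?C * dist p1 p2 \<and>
       norm (v1 - v0) \<le> ?C * dist p1 x0 \<and> norm (v2 - v0) \<le> ?C * dist p2 x0 \<and>
       dist p1 x0 \<le> r' \<and> dist p2 x0 \<le> r' \<longrightarrow> norm (\<Psi> p1 v1 - \<Psi> p2 v2) \<le> D' * dist p1 p2"
      using lip_nearD[OF conjunct2[OF *], of ?C v0 x0] by auto
    have C: "z \<le> ?C * dist x y" if "z \<le> C * dist x y" for z x and y :: 'a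
      using that mult_right_mono[OF abs_ge_self[of C] zero_le_dist[of x y]] by linarith
    have M: "z \<le> max D D' * dist x y" if "z \<le> D * dist x y \<or> z \<le> D' * dist x y" for z x and y :: 'a
      using that mult_right_mono[OF max.cobounded1[of D D'] zero_le_dist[of x y]]
        mult_right_mono[OF max.cobounded2[of D' D] zero_le_dist[of x y]] by linarith
    show "\<exists>r>0. \<exists>D. \<forall>x1 x2 u1 u2 v1 v2.
        norm (u1 - u2) \<le> C * dist x1 x2 \<and> norm (v1 - v2) \<le> C * dist x1 x2 \<and>
        norm (u1 - u0) \<le> C * dist x1 x0 \<and> norm (u2 - u0) \<le> C * dist x2 x0 \<and>
        norm (v1 - v0) \<le> C * dist x1 x0 \<and> norm (v2 - v0) \<le> C * dist x2 x0 \<and>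
        dist x1 x0 \<le> r \<and> dist x2 x0 \<le> r \<longrightarrow>
          norm (\<Phi> (\<phi> x1) u1 - \<Phi> (\<phi> x2) u2) \<le> D * dist x1 x2 \<and>
          norm (\<Psi> x1 v1 - \<Psi> x2 v2) \<le> D * dist x1 x2"
    proof (rule exI[of _ "min r r'"], rule conjI, goal_cases)
      case 1
      show ?case using r r' by simp
    next
      case 2
      show ?case
      proof (rule exI[of _ "max D D'"], intro allI impI, elim conjE, intro conjI, goal_cases)
        case 1
        then show ?case by (intro M disjI1 D[rule_format]) (simp add: C)
      next
        case 2
        then show ?case by (intro M disjI2 D'[rule_format]) (simp add: C)
      qed
    qed
  qed
qed

text \<open>
The original condition quantifies over whole sequences of perturbations. The estimate at a single index
follows by leaving all other terms unperturbed.
\<close>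

lemma lipschitz_along_separated_iff:
  fixes \<phi> :: "'a::metric_space \<Rightarrow> 'b" and \<Phi> :: "'b \<Rightarrow> 'e::real_normed_vector \<Rightarrow> 'f::real_normed_vector"
  shows "lipschitz_along_separated \<phi> \<Phi> \<Psi> \<longleftrightarrow> lip_sep (\<lambda>x. x) (\<lambda>x. \<Phi> (\<phi> x)) \<and> lip_sep (\<lambda>x. x) \<Psi>"
proof
  assume *: "lipschitz_along_separated \<phi> \<Phi> \<Psi>"
  have one: "\<exists>r>0. \<exists>D. \<forall>n x' u' v'.
      norm (u' - u n) \<le> C * dist x' (x n) \<and> norm (v' - v n) \<le> C * dist x' (x n) \<and> dist x' (x n) \<le> r \<longrightarrow>
        norm (\<Phi> (\<phi> x') u' - \<Phi> (\<phi> (x n)) (u n)) \<le> D * dist x' (x n) \<and>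
        norm (\<Psi> x' v' - \<Psi> (x n) (v n)) \<le> D * dist x' (x n)"
    if xuv: "separated_seq x" "bounded (range u)" "bounded (range v)" and C: "0 \<le> C"
    for x :: "nat \<Rightarrow> 'a" and u :: "nat \<Rightarrow> 'e" and v :: "nat \<Rightarrow> 'f" and C
  proof -
    obtain r D where r: "r > 0" and D: "\<forall>x' u' v'.
         (\<forall>n::nat. norm (u' n - u n) \<le> C * dist (x' n) (x n) \<and>
                   norm (v' n - v n) \<le> C * dist (x' n) (x n) \<and> dist (x' n) (x n) \<le> r) \<longrightarrow>
         (\<forall>n. norm (\<Phi> (\<phi> (x' n)) (u' n) - \<Phi> (\<phi> (x n)) (u n)) \<le> D * dist (x' n) (x n) \<and>
              norm (\<Psi> (x' n) (v' n) - \<Psi> (x n) (v n)) \<le> D * dist (x' n) (x n))"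
      using *[unfolded lipschitz_along_separated_def, rule_format, OF xuv] by blast
    show ?thesis
    proof (rule exI[of _ r], intro conjI r, rule exI[of _ D], intro allI impI conjI)
      fix n x' u' v'
      assume "norm (u' - u n) \<le> C * dist x' (x n) \<and> norm (v' - v n) \<le> C * dist x' (x n) \<and> dist x' (x n) \<le> r"
      then have "\<forall>k. norm ((u(n := u')) k - u k) \<le> C * dist ((x(n := x')) k) (x k) \<and>
          norm ((v(n := v')) k - v k) \<le> C * dist ((x(n := x')) k) (x k) \<and> dist ((x(n := x')) k) (x k) \<le> r"
        using r by simp
      from D[rule_format, OF this[rule_format], of n]
      show "norm (\<Phi> (\<phi> x') u' - \<Phi> (\<phi> (x n)) (u n)) \<le> D * dist x' (x n)"
        "norm (\<Psi> x' v' - \<Psi> (x n) (v n)) \<le> D * dist x' (x n)" by simp_all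
    qed
  qed
  show "lip_sep (\<lambda>x. x) (\<lambda>x. \<Phi> (\<phi> x)) \<and> lip_sep (\<lambda>x. x) \<Psi>"
    unfolding lip_sep_def
  proof (intro conjI allI impI)
    fix p :: "nat \<Rightarrow> 'a" and u :: "nat \<Rightarrow> 'e" and C :: real assume p: "separated_seq p" and u: "bounded (range u)" and C: "0 \<le> C"
    have "bounded (range (\<lambda>n::nat. 0::'f))" by (simp add: image_constant_conv)
    from one[OF p u this C] obtain r D where r: "r > 0" and D: "\<forall>n x' u' v'.
      norm (u' - u n) \<le> C * dist x' (p n) \<and> norm (v' - 0) \<le> C * dist x' (p n) \<and> dist x' (p n) \<le> r \<longrightarrow>
        norm (\<Phi> (\<phi> x') u' - \<Phi> (\<phi> (p n)) (u n)) \<le> D * dist x' (p n) \<and>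
        norm (\<Psi> x' v' - \<Psi> (p n) 0) \<le> D * dist x' (p n)"
      by blast
    show "\<exists>r>0. \<exists>D. \<forall>n p' u'. norm (u' - u n) \<le> C * dist p' (p n) \<and> dist p' (p n) \<le> r \<longrightarrow>
        norm (\<Phi> (\<phi> p') u' - \<Phi> (\<phi> (p n)) (u n)) \<le> D * dist p' (p n)"
      using r D[rule_format, where v' = 0] C by (intro exI[of _ r] conjI exI[of _ D]) simp_all
  next
    fix p :: "nat \<Rightarrow> 'a" and v :: "nat \<Rightarrow> 'f" and C :: real assume p: "separated_seq p" and v: "bounded (range v)" and C: "0 \<le> C"
    have "bounded (range (\<lambda>n::nat. 0::'e))" by (simp add: image_constant_conv)
    from one[OF p this v C] obtain r D where r: "r > 0" and D: "\<forall>n x' u' v'.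
      norm (u' - 0) \<le> C * dist x' (p n) \<and> norm (v' - v n) \<le> C * dist x' (p n) \<and> dist x' (p n) \<le> r \<longrightarrow>
        norm (\<Phi> (\<phi> x') u' - \<Phi> (\<phi> (p n)) 0) \<le> D * dist x' (p n) \<and>
        norm (\<Psi> x' v' - \<Psi> (p n) (v n)) \<le> D * dist x' (p n)"
      by blast
    show "\<exists>r>0. \<exists>D. \<forall>n p' u'. norm (u' - v n) \<le> C * dist p' (p n) \<and> dist p' (p n) \<le> r \<longrightarrow>
        norm (\<Psi> p' u' - \<Psi> (p n) (v n)) \<le> D * dist p' (p n)"
      using r D[rule_format, where u' = 0] C by (intro exI[of _ r] conjI exI[of _ D]) simp_all
  qed
next
  assume *: "lip_sep (\<lambda>x. x) (\<lambda>x. \<Phi> (\<phi> x)) \<and> lip_sep (\<lambda>x. x) \<Psi>"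
  show "lipschitz_along_separated \<phi> \<Phi> \<Psi>"
    unfolding lipschitz_along_separated_def
  proof (intro allI impI)
    fix x :: "nat \<Rightarrow> 'a" and u :: "nat \<Rightarrow> 'e" and v :: "nat \<Rightarrow> 'f" and C :: real
    assume x: "separated_seq x" and u: "bounded (range u)" and v: "bounded (range v)"
    let ?C = "\<bar>C\<bar>"
    obtain r D where r: "r > 0" and D: "\<forall>n p' u'. norm (u' - u n) \<le> ?C * dist p' (x n) \<and> dist p' (x n) \<le> r \<longrightarrow>
        norm (\<Phi> (\<phi> p') u' - \<Phi> (\<phi> (x n)) (u n)) \<le> D * dist p' (x n)"
      using lip_sepD[OF conjunct1[OF *] x u, of ?C] by auto
    obtain r' D' where r': "r' > 0" and D': "\<forall>n p' v'. norm (v' - v n) \<le> ?C * dist p' (x n) \<and> dist p' (x n) \<le> r' \<longrightarrow>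
        norm (\<Psi> p' v' - \<Psi> (x n) (v n)) \<le> D' * dist p' (x n)"
      using lip_sepD[OF conjunct2[OF *] x v, of ?C] by auto
    have C: "z \<le> ?C * dist x y" if "z \<le> C * dist x y" for z x and y :: 'a
      using that mult_right_mono[OF abs_ge_self[of C] zero_le_dist[of x y]] by linarith
    have M: "z \<le> max D D' * dist x y" if "z \<le> D * dist x y \<or> z \<le> D' * dist x y" for z x and y :: 'a
      using that mult_right_mono[OF max.cobounded1[of D D'] zero_le_dist[of x y]]
        mult_right_mono[OF max.cobounded2[of D' D] zero_le_dist[of x y]] by linarith
    show "\<exists>r>0. \<exists>D. \<forall>x' u' v'.
         (\<forall>n. norm (u' n - u n) \<le> C * dist (x' n) (x n) \<and>
              norm (v' n - v n) \<le> C * dist (x' n) (x n) \<and> dist (x' n) (x n) \<le> r) \<longrightarrow>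
         (\<forall>n. norm (\<Phi> (\<phi> (x' n)) (u' n) - \<Phi> (\<phi> (x n)) (u n)) \<le> D * dist (x' n) (x n) \<and>
              norm (\<Psi> (x' n) (v' n) - \<Psi> (x n) (v n)) \<le> D * dist (x' n) (x n))"
    proof (rule exI[of _ "min r r'"], rule conjI, goal_cases)
      case 1
      show ?case using r r' by simp
    next
      case 2
      show ?case
      proof (rule exI[of _ "max D D'"], intro allI impI conjI)
        fix x' u' v' n
        assume "\<forall>n. norm (u' n - u n) \<le> C * dist (x' n) (x n) \<and>
                norm (v' n - v n) \<le> C * dist (x' n) (x n) \<and> dist (x' n) (x n) \<le> min r r'"
        then have n: "norm (u' n - u n) \<le> C * dist (x' n) (x n)" "norm (v' n - v n) \<le> C * dist (x' n) (x n)"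
          "dist (x' n) (x n) \<le> r" "dist (x' n) (x n) \<le> r'" by auto
        show "norm (\<Phi> (\<phi> (x' n)) (u' n) - \<Phi> (\<phi> (x n)) (u n)) \<le> max D D' * dist (x' n) (x n)"
          by (rule M, rule disjI1, rule D[rule_format]) (simp add: C n)
        show "norm (\<Psi> (x' n) (v' n) - \<Psi> (x n) (v n)) \<le> max D D' * dist (x' n) (x n)"
          by (rule M, rule disjI2, rule D'[rule_format]) (simp add: C n)
      qed
    qed
  qed
qed

section \<open>The representation theorem\<close>

lemma biseparating_pair_representation:
  fixes T :: "('a::complete_space \<Rightarrow> 'e::real_normed_vector) \<Rightarrow> ('b::complete_space \<Rightarrow> 'f::real_normed_vector)"
  assumes bp: "biseparating_pair T S"
  shows "\<exists>(\<phi> :: 'a \<Rightarrow> 'b) (\<Phi> :: 'b \<Rightarrow> 'e \<Rightarrow> 'f) (\<Psi> :: 'a \<Rightarrow> 'f \<Rightarrow> 'e).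
     lipschitz_homeomorphism \<phi> \<and> fibre_bijections \<phi> \<Phi> \<Psi> \<and>
     (\<forall>f\<in>Lip. \<forall>y. T f y = \<Phi> y (f (inv \<phi> y))) \<and>
     (\<forall>g\<in>Lip. \<forall>x. S g x = \<Psi> x (g (\<phi> x))) \<and>
     bounded_along_separated \<phi> \<Phi> \<Psi> \<and> lipschitz_near_points \<phi> \<Phi> \<Psi> \<and>
     lipschitz_along_separated \<phi> \<Phi> \<Psi>"
proof -
  interpret biseparating_pair T S by fact
  note swap = biseparating_pair_swap[OF bp]
  obtain \<phi> where \<phi>: "\<And>x. corresp T x (\<phi> x)" using corresp_exists[OF bp] by metis
  obtain \<psi> where \<psi>: "\<And>y. corresp S y (\<psi> y)" using corresp_exists[OF swap] by metis
  have inv: "\<psi> (\<phi> x) = x" "\<phi> (\<psi> y) = y" for x y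
    using corresp_unique[OF swap \<psi> corresp_swap[OF bp \<phi>]]
      corresp_unique[OF bp \<phi> corresp_swap[OF swap \<psi>]] by auto
  have Lip\<phi>: "\<phi> \<in> Lip" by (rule corresp_Lip[OF bp \<phi> \<psi> inv])
  have Lip\<psi>: "\<psi> \<in> Lip" by (rule corresp_Lip[OF swap \<psi> \<phi> inv(2,1)])
  have inv\<phi>: "inv \<phi> = \<psi>" by (rule inv_equality) (simp_all add: inv)
  define \<Phi> where "\<Phi> y u = T (\<lambda>_. u) y" for y u
  define \<Psi> where "\<Psi> x v = S (\<lambda>_. v) x" for x v
  have Tf: "T f (\<phi> x) = \<Phi> (\<phi> x) (f x)" if "f \<in> Lip" for f x
    unfolding \<Phi>_def by (rule pointwise_determined[OF bp \<phi> that Lip_const]) simp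
  have Sg: "S g (\<psi> y) = \<Psi> (\<psi> y) (g y)" if "g \<in> Lip" for g y
    unfolding \<Psi>_def by (rule pointwise_determined[OF swap \<psi> that Lip_const]) simp
  have Tf': "T f y = \<Phi> y (f (\<psi> y))" if "f \<in> Lip" for f y
    using Tf[OF that, of "\<psi> y"] by (simp add: inv)
  have Sg': "S g x = \<Psi> x (g (\<phi> x))" if "g \<in> Lip" for g x
    using Sg[OF that, of "\<phi> x"] by (simp add: inv)
  have \<Psi>\<Phi>: "\<Psi> x (\<Phi> (\<phi> x) u) = u" for x u
    using Sg'[OF T_Lip[OF Lip_const[of u]], of x] by (simp add: S_T flip: \<Phi>_def)
  have \<Phi>\<Psi>: "\<Phi> (\<phi> x) (\<Psi> x v) = v" for x v
    using Tf[OF S_Lip[OF Lip_const[of v]], of x] by (simp add: T_S flip: \<Psi>_def)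
  have homeo: "lipschitz_homeomorphism \<phi>"
    using Lip\<phi> Lip\<psi> o_bij[of \<psi> \<phi>] by (simp add: lipschitz_homeomorphism_def inv\<phi> fun_eq_iff inv)
  have "bij (\<Phi> y)" for y
    using o_bij[of "\<Psi> (\<psi> y)" "\<Phi> y"] \<Psi>\<Phi>[of "\<psi> y"] \<Phi>\<Psi>[of "\<psi> y"] by (auto simp: fun_eq_iff inv)
  moreover have "\<Psi> x = inv (\<Phi> (\<phi> x))" for x
    by (rule inv_equality[symmetric]) (simp_all add: \<Psi>\<Phi> \<Phi>\<Psi>)
  ultimately have fibre: "fibre_bijections \<phi> \<Phi> \<Psi>" by (auto simp: fibre_bijections_def)
  have actsI: "acts (\<lambda>x. x) \<Theta>" if "\<And>f. f \<in> Lip \<Longrightarrow> (\<lambda>x. \<Theta> x (f x)) \<in> Lip"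
    for \<Theta> :: "'a \<Rightarrow> 'u::real_normed_vector \<Rightarrow> 'w::real_normed_vector"
    unfolding acts_def
  proof
    fix f :: "'a \<Rightarrow> 'u" assume "f \<in> Lip"
    from that[OF this] show "\<exists>L. \<forall>p q. norm (\<Theta> p (f p) - \<Theta> q (f q)) \<le> L * dist p q"
      unfolding Lip_iff .
  qed
  have "acts (\<lambda>x. x) (\<lambda>x. \<Phi> (\<phi> x))"
  proof (rule actsI)
    fix f :: "'a \<Rightarrow> 'e" assume f: "f \<in> Lip"
    show "(\<lambda>x. \<Phi> (\<phi> x) (f x)) \<in> Lip"
      using Lip_comp[OF Lip\<phi> T_Lip[OF f]] by (simp add: Tf[OF f])
  qed
  moreover have "acts (\<lambda>x. x) \<Psi>"
  proof (rule actsI)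
    fix g :: "'a \<Rightarrow> 'f" assume g: "g \<in> Lip"
    have "S (\<lambda>y. g (\<psi> y)) = (\<lambda>x. \<Psi> x (g x))"
      using Sg'[OF Lip_comp[OF Lip\<psi> g]] by (simp add: fun_eq_iff inv)
    then show "(\<lambda>x. \<Psi> x (g x)) \<in> Lip" using S_Lip[OF Lip_comp[OF Lip\<psi> g]] by simp
  qed
  ultimately show ?thesis
    using homeo fibre Tf' Sg' bounded_X
    by (intro exI[of _ \<phi>] exI[of _ \<Phi>] exI[of _ \<Psi>])
      (simp add: inv\<phi> bounded_along_separated_iff lipschitz_near_points_iff
        lipschitz_along_separated_iff acts_imp_bounded_sep acts_imp_lip_near acts_imp_lip_sep)
qed

text \<open>
The fibre maps are injective, so \<open>T f\<close> and \<open>T g\<close> agree at \<open>\<phi> x\<close> exactly if \<open>f\<close> and \<open>g\<close> agree at \<open>x\<close>, and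
\<open>perp\<close> is expressed by agreement alone.
\<close>

lemma biseparating_of_fibrewise:
  fixes T :: "('a::complete_space \<Rightarrow> 'e::real_normed_vector) \<Rightarrow> ('b::metric_space \<Rightarrow> 'f::real_normed_vector)"
  assumes bdd: "bounded (UNIV :: 'a set)" and homeo: "lipschitz_homeomorphism \<phi>"
    and fibre: "fibre_bijections \<phi> \<Phi> \<Psi>" and bs: "bounded_along_separated \<phi> \<Phi> \<Psi>"
    and ln: "lipschitz_near_points \<phi> \<Phi> \<Psi>" and ls: "lipschitz_along_separated \<phi> \<Phi> \<Psi>"
    and T: "\<And>f y. f \<in> Lip \<Longrightarrow> T f y = \<Phi> y (f (inv \<phi> y))"
  shows "biseparating Lip Lip T"
proof -
  have \<phi>: "bij \<phi>" "\<phi> \<in> Lip" "inv \<phi> \<in> Lip" using homeo by (auto simp: lipschitz_homeomorphism_def)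
  have inv: "inv \<phi> (\<phi> x) = x" "\<phi> (inv \<phi> y) = y" for x y
    using \<phi>(1) by (auto simp: bij_is_inj bij_is_surj surj_f_inv_f)
  have bij: "bij (\<Phi> y)" for y using fibre by (simp add: fibre_bijections_def)
  have \<Psi>: "\<Psi> x = inv (\<Phi> (\<phi> x))" for x using fibre by (simp add: fibre_bijections_def)
  have T_\<phi>: "T f (\<phi> x) = \<Phi> (\<phi> x) (f x)" if "f \<in> Lip" for f x using T[OF that] by (simp add: inv)
  have T_eq: "T f (\<phi> x) = T g (\<phi> x) \<longleftrightarrow> f x = g x" if "f \<in> Lip" "g \<in> Lip" for f g x
    using T_\<phi> that bij_is_inj[OF bij] by (simp add: inj_eq)
  note bs' = bs[unfolded bounded_along_separated_iff]
    and ln' = ln[unfolded lipschitz_near_points_iff]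
    and ls' = ls[unfolded lipschitz_along_separated_iff]
  have T_Lip: "T f \<in> Lip" if f: "f \<in> Lip" for f
  proof -
    have "(\<lambda>x. \<Phi> (\<phi> x) (f x)) \<in> Lip"
      by (rule fibrewise_Lip[OF bdd conjunct1[OF bs'] conjunct1[OF ln'] conjunct1[OF ls'] f])
    from Lip_comp[OF \<phi>(3) this] have "(\<lambda>y. \<Phi> y (f (inv \<phi> y))) \<in> Lip" by (simp add: inv)
    moreover have "T f = (\<lambda>y. \<Phi> y (f (inv \<phi> y)))" using T[OF f] by blast
    ultimately show ?thesis by simp
  qed
  have surj: "\<exists>f\<in>Lip. T f = g" if g: "g \<in> Lip" for g
  proof
    let ?f = "\<lambda>x. \<Psi> x (g (\<phi> x))"
    show f: "?f \<in> Lip"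
      by (rule fibrewise_Lip[OF bdd conjunct2[OF bs'] conjunct2[OF ln'] conjunct2[OF ls']
          Lip_comp[OF \<phi>(2) g]])
    show "T ?f = g"
      using T[OF f] bij by (auto simp: fun_eq_iff \<Psi> inv bij_is_surj surj_f_inv_f)
  qed
  have "inj_on T Lip"
  proof (rule inj_onI)
    fix f g assume "f \<in> Lip" "g \<in> Lip" "T f = T g"
    then show "f = g" using T_eq[of f g] by (simp add: fun_eq_iff)
  qed
  then have "bij_betw T Lip Lip" using T_Lip surj unfolding bij_betw_def by blast
  moreover have "perp h f g \<longleftrightarrow> perp (T h) (T f) (T g)" if fgh: "f \<in> Lip" "g \<in> Lip" "h \<in> Lip" for f g h
  proof -
    have "perp (T h) (T f) (T g) \<longleftrightarrow> (\<forall>x. T f (\<phi> x) = T h (\<phi> x) \<or> T g (\<phi> x) = T h (\<phi> x))"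
      unfolding perp_iff using inv(2) by metis
    then show ?thesis using fgh by (simp add: T_eq perp_iff)
  qed
  ultimately show ?thesis by (simp add: biseparating_def)
qed

lemma biseparating_pair_inv_into:
  fixes T :: "('a::complete_space \<Rightarrow> 'e::real_normed_vector) \<Rightarrow> ('b::complete_space \<Rightarrow> 'f::real_normed_vector)"
  assumes "bounded (UNIV :: 'a set)" "bounded (UNIV :: 'b set)"
    and "\<exists>u::'e. u \<noteq> 0" "\<exists>v::'f. v \<noteq> 0" and T: "biseparating Lip Lip T"
  shows "biseparating_pair T (inv_into Lip T)"
proof
  have bij: "bij_betw T Lip Lip" and perp: "\<forall>f\<in>Lip. \<forall>g\<in>Lip. \<forall>h\<in>Lip. perp h f g \<longleftrightarrow> perp (T h) (T f) (T g)"
    using T unfolding biseparating_def by blast+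
  show "T f \<in> Lip" if "f \<in> Lip" for f using bij that by (rule bij_betwE[rule_format])
  show "inv_into Lip T g \<in> Lip" if "g \<in> Lip" for g
    using bij_betw_inv_into[OF bij] that by (rule bij_betwE[rule_format])
  show "inv_into Lip T (T f) = f" if "f \<in> Lip" for f using bij that by (rule bij_betw_inv_into_left)
  show "T (inv_into Lip T g) = g" if "g \<in> Lip" for g using bij that by (rule bij_betw_inv_into_right)
  show "perp (T h) (T f) (T g) \<longleftrightarrow> perp h f g" if "f \<in> Lip" "g \<in> Lip" "h \<in> Lip" for f g h
    using perp that by blast
qed (use assms in blast)+

theorem theorem8p8:
  assumes "bounded (UNIV :: 'a::complete_space set)"
    and "bounded (UNIV :: 'b::complete_space set)"
    and "\<exists>u::'e::banach. u \<noteq> 0"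
    and "\<exists>v::'f::banach. v \<noteq> 0"
  shows "(\<forall>T :: ('a \<Rightarrow> 'e) \<Rightarrow> ('b \<Rightarrow> 'f).
            biseparating Lip Lip T \<longrightarrow>
            (\<exists>(\<phi> :: 'a \<Rightarrow> 'b) (\<Phi> :: 'b \<Rightarrow> 'e \<Rightarrow> 'f) (\<Psi> :: 'a \<Rightarrow> 'f \<Rightarrow> 'e).
               lipschitz_homeomorphism \<phi> \<and>
               fibre_bijections \<phi> \<Phi> \<Psi> \<and>
               (\<forall>f\<in>Lip. \<forall>y. T f y = \<Phi> y (f (inv \<phi> y))) \<and>
               (\<forall>g\<in>Lip. \<forall>x. inv_into Lip T g x = \<Psi> x (g (\<phi> x))) \<and>
               bounded_along_separated \<phi> \<Phi> \<Psi> \<and>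
               lipschitz_near_points \<phi> \<Phi> \<Psi> \<and>
               lipschitz_along_separated \<phi> \<Phi> \<Psi>)) \<and>
         (\<forall>(\<phi> :: 'a \<Rightarrow> 'b) (\<Phi> :: 'b \<Rightarrow> 'e \<Rightarrow> 'f) (\<Psi> :: 'a \<Rightarrow> 'f \<Rightarrow> 'e)
            (T :: ('a \<Rightarrow> 'e) \<Rightarrow> ('b \<Rightarrow> 'f)).
            lipschitz_homeomorphism \<phi> \<and>
            fibre_bijections \<phi> \<Phi> \<Psi> \<and>
            bounded_along_separated \<phi> \<Phi> \<Psi> \<and>
            lipschitz_near_points \<phi> \<Phi> \<Psi> \<and>
            lipschitz_along_separated \<phi> \<Phi> \<Psi> \<and>
            (\<forall>f\<in>Lip. \<forall>y. T f y = \<Phi> y (f (inv \<phi> y))) \<longrightarrow>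
            biseparating Lip Lip T)"
proof (rule conjI; intro allI impI)
  fix T :: "('a \<Rightarrow> 'e) \<Rightarrow> ('b \<Rightarrow> 'f)"
  assume "biseparating Lip Lip T"
  with assms have "biseparating_pair T (inv_into Lip T)" by (rule biseparating_pair_inv_into)
  then show "\<exists>(\<phi> :: 'a \<Rightarrow> 'b) (\<Phi> :: 'b \<Rightarrow> 'e \<Rightarrow> 'f) (\<Psi> :: 'a \<Rightarrow> 'f \<Rightarrow> 'e).
      lipschitz_homeomorphism \<phi> \<and> fibre_bijections \<phi> \<Phi> \<Psi> \<and>
      (\<forall>f\<in>Lip. \<forall>y. T f y = \<Phi> y (f (inv \<phi> y))) \<and>
      (\<forall>g\<in>Lip. \<forall>x. inv_into Lip T g x = \<Psi> x (g (\<phi> x))) \<and>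
      bounded_along_separated \<phi> \<Phi> \<Psi> \<and> lipschitz_near_points \<phi> \<Phi> \<Psi> \<and>
      lipschitz_along_separated \<phi> \<Phi> \<Psi>"
    by (rule biseparating_pair_representation)
next
  fix \<phi> :: "'a \<Rightarrow> 'b" and \<Phi> :: "'b \<Rightarrow> 'e \<Rightarrow> 'f" and \<Psi> :: "'a \<Rightarrow> 'f \<Rightarrow> 'e"
    and T :: "('a \<Rightarrow> 'e) \<Rightarrow> ('b \<Rightarrow> 'f)"
  assume "lipschitz_homeomorphism \<phi> \<and> fibre_bijections \<phi> \<Phi> \<Psi> \<and>
      bounded_along_separated \<phi> \<Phi> \<Psi> \<and> lipschitz_near_points \<phi> \<Phi> \<Psi> \<and>
      lipschitz_along_separated \<phi> \<Phi> \<Psi> \<and> (\<forall>f\<in>Lip. \<forall>y. T f y = \<Phi> y (f (inv \<phi> y)))"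
  then show "biseparating Lip Lip T"
    by (intro biseparating_of_fibrewise[OF assms(1), of \<phi> \<Phi> \<Psi>]) blast+
qed

end
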